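(* Let $\Omega\subset\mathbb{C}^n$ be a simply-connected bounded strongly pseudoconvex domain with smooth boundary, equipped with the Bergman metric $\omega$. For any $1$-form $\eta$ on $\Omega$ satisfying $d\eta=\omega$, the following estimate holds: $$\|\eta\|^2_{L^\infty}\ge\frac{n+1}{2}.$$ In particular, $$\mathsf{M}(\Omega,\omega)\ge\frac{n^2}{2(n+1)}.$$
   Context: Forms are smooth and $1$-forms $\eta$ are real. The Bergman metric of $\Omega$ has Kähler form $\omega=\sqrt{-1}\,\partial\bar\partial\log K(z,z)$, where $K$ is the Bergman kernel of $\Omega$. For a real $1$-form $\eta$, $|\eta|_\omega$ is the pointwise length with respect to the Riemannian metric $\omega(\cdot,J\cdot)$ associated with $\omega$ (in dimension one, $\omega=\sqrt{-1}\,h\,dz\wedge d\bar z$ corresponds to $2h(dx^2+dy^2)$), and $\|\eta\|_{L^\infty}=\sup_\Omega|\eta|_\omega\in[0,+\infty]$. The Kähler hyperbolicity modulus of a complete Kähler manifold $(X,\omega)$ is $$\mathsf{M}(X,\omega)=\inf\{\|\eta\|^2_{L^\infty}:\ \eta \text{ is a real } 1\text{-form on } X \text{ with } d\eta=\omega\}.$$ *)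

theory Defs
  imports "HOL-Analysis.Analysis"
begin

text \<open>
  Complex \<open>n\<close>-space is \<^typ>\<open>complex^'n\<close> with \<open>n = CARD('n)\<close>; it is a real Euclidean space,
  so \<^const>\<open>frechet_derivative\<close> is the real derivative and \<^const>\<open>lborel\<close> is the usual Lebesgue
  measure. The complex structure \<open>J\<close> is \<open>\<lambda>v. \<i> *s v\<close>.
\<close>

subsection \<open>Smooth and holomorphic functions on open sets\<close>

text \<open>Used only for open \<open>S\<close>; in finite dimensions this is the usual class of \<open>C\<^sup>k\<close> maps.\<close>

primrec Ck_on :: "nat \<Rightarrow> 'a::real_normed_vector set \<Rightarrow> ('a \<Rightarrow> 'b::real_normed_vector) \<Rightarrow> bool" where
  "Ck_on 0 S f \<longleftrightarrow> continuous_on S f"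
| "Ck_on (Suc k) S f \<longleftrightarrow>
     (\<forall>x\<in>S. f differentiable (at x)) \<and> (\<forall>v. Ck_on k S (\<lambda>x. frechet_derivative f (at x) v))"

definition smooth_on :: "'a::real_normed_vector set \<Rightarrow> ('a \<Rightarrow> 'b::real_normed_vector) \<Rightarrow> bool" where
  "smooth_on S f \<longleftrightarrow> (\<forall>k. Ck_on k S f)"

definition holomorphic_Cn_on :: "(complex^'n) set \<Rightarrow> (complex^'n \<Rightarrow> complex) \<Rightarrow> bool" where
  "holomorphic_Cn_on S f \<longleftrightarrow>
     (\<forall>z\<in>S. \<exists>f'. (f has_derivative f') (at z) \<and> (\<forall>c v. f' (c *s v) = c * f' v))"

subsection \<open>Wirtinger derivatives\<close>

text \<open>\<open>\<partial>f/\<partial>z\<^sub>j\<close> and \<open>\<partial>f/\<partial>z\<^sub>j\<close>-bar; here \<open>axis j 1\<close> and \<open>axis j \<i>\<close> are the real coordinate directions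
  \<open>x\<^sub>j\<close> and \<open>y\<^sub>j\<close>.\<close>

definition dz :: "'n \<Rightarrow> (complex^'n \<Rightarrow> complex) \<Rightarrow> complex^'n \<Rightarrow> complex" where
  "dz j f z = (frechet_derivative f (at z) (axis j 1)
               - \<i> * frechet_derivative f (at z) (axis j \<i>)) / 2"

definition dzbar :: "'n \<Rightarrow> (complex^'n \<Rightarrow> complex) \<Rightarrow> complex^'n \<Rightarrow> complex" where
  "dzbar j f z = (frechet_derivative f (at z) (axis j 1)
                  + \<i> * frechet_derivative f (at z) (axis j \<i>)) / 2"

subsection \<open>Strongly pseudoconvex domains with smooth boundary\<close>

definition Levi_form :: "(complex^'n \<Rightarrow> real) \<Rightarrow> complex^'n \<Rightarrow> complex^'n \<Rightarrow> complex" where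
  "Levi_form \<rho> z v =
     (\<Sum>j\<in>UNIV. \<Sum>k\<in>UNIV. dz j (dzbar k (\<lambda>w. complex_of_real (\<rho> w))) z * v $ j * cnj (v $ k))"

definition complex_tangent_space :: "(complex^'n \<Rightarrow> real) \<Rightarrow> complex^'n \<Rightarrow> (complex^'n) set" where
  "complex_tangent_space \<rho> z =
     {v. (\<Sum>j\<in>UNIV. dz j (\<lambda>w. complex_of_real (\<rho> w)) z * v $ j) = 0}"

definition smooth_defining_function ::
    "(complex^'n) set \<Rightarrow> (complex^'n) set \<Rightarrow> (complex^'n \<Rightarrow> real) \<Rightarrow> bool" where
  "smooth_defining_function \<Omega> U \<rho> \<longleftrightarrow>
     open U \<and> frontier \<Omega> \<subseteq> U \<and> smooth_on U \<rho> \<and>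
     \<Omega> \<inter> U = {z \<in> U. \<rho> z < 0} \<and>
     (\<forall>z\<in>frontier \<Omega>. \<exists>v. frechet_derivative \<rho> (at z) v \<noteq> 0)"

text \<open>The Levi form takes real values (its imaginary part vanishes because \<open>\<rho>\<close> is real). For
  \<open>n = 1\<close> the complex tangent spaces are trivial and the Levi condition is void, as usual.\<close>

definition strongly_pseudoconvex_smooth :: "(complex^'n) set \<Rightarrow> bool" where
  "strongly_pseudoconvex_smooth \<Omega> \<longleftrightarrow>
     (\<exists>U \<rho>. smooth_defining_function \<Omega> U \<rho> \<and>
        (\<forall>z\<in>frontier \<Omega>. \<forall>v\<in>complex_tangent_space \<rho> z. v \<noteq> 0 \<longrightarrow> Re (Levi_form \<rho> z v) > 0))"

subsection \<open>Bergman kernel and Bergman metric\<close>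

definition bergman_space :: "(complex^'n) set \<Rightarrow> (complex^'n \<Rightarrow> complex) set" where
  "bergman_space \<Omega> =
     {f. holomorphic_Cn_on \<Omega> f \<and> set_integrable lborel \<Omega> (\<lambda>z. (cmod (f z))\<^sup>2)}"

text \<open>The reproducing kernel of the Bergman space. Extending it by \<open>0\<close> off \<open>\<Omega> \<times> \<Omega>\<close> makes it unique
  as a total function.\<close>

definition bergman_kernel :: "(complex^'n) set \<Rightarrow> complex^'n \<Rightarrow> complex^'n \<Rightarrow> complex" where
  "bergman_kernel \<Omega> = (THE K.
     (\<forall>z w. z \<notin> \<Omega> \<or> w \<notin> \<Omega> \<longrightarrow> K z w = 0) \<and>
     (\<forall>w\<in>\<Omega>. (\<lambda>z. K z w) \<in> bergman_space \<Omega> \<and>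
        (\<forall>f\<in>bergman_space \<Omega>. f w = set_lebesgue_integral lborel \<Omega> (\<lambda>z. f z * cnj (K z w)))))"

text \<open>Differential forms are evaluated on real tangent vectors, with
  \<open>(\<alpha> \<and> \<beta>)(u,v) = \<alpha>(u)\<beta>(v) - \<alpha>(v)\<beta>(u)\<close>. The real part only changes the type: for real \<open>\<phi>\<close> the form
  \<open>\<surd>-1 \<partial>\<partial>\<close>-bar \<open>\<phi>\<close> is real.\<close>

definition i_ddbar ::
    "(complex^'n \<Rightarrow> real) \<Rightarrow> complex^'n \<Rightarrow> complex^'n \<Rightarrow> complex^'n \<Rightarrow> real" where
  "i_ddbar \<phi> z u v = Re (\<i> *
     (\<Sum>j\<in>UNIV. \<Sum>k\<in>UNIV. dz j (dzbar k (\<lambda>w. complex_of_real (\<phi> w))) z *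
        (u $ j * cnj (v $ k) - v $ j * cnj (u $ k))))"

definition bergman_form ::
    "(complex^'n) set \<Rightarrow> complex^'n \<Rightarrow> complex^'n \<Rightarrow> complex^'n \<Rightarrow> real" where
  "bergman_form \<Omega> = i_ddbar (\<lambda>z. ln (Re (bergman_kernel \<Omega> z z)))"

subsection \<open>One-forms and the Kaehler hyperbolicity modulus\<close>

definition one_form_on ::
    "(complex^'n) set \<Rightarrow> (complex^'n \<Rightarrow> complex^'n \<Rightarrow> real) \<Rightarrow> bool" where
  "one_form_on \<Omega> \<eta> \<longleftrightarrow> (\<forall>z\<in>\<Omega>. linear (\<eta> z)) \<and> (\<forall>v. smooth_on \<Omega> (\<lambda>z. \<eta> z v))"

definition exterior_derivative ::
    "(complex^'n \<Rightarrow> complex^'n \<Rightarrow> real) \<Rightarrow> complex^'n \<Rightarrow> complex^'n \<Rightarrow> complex^'n \<Rightarrow> real" where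
  "exterior_derivative \<eta> z u v =
     frechet_derivative (\<lambda>w. \<eta> w v) (at z) u - frechet_derivative (\<lambda>w. \<eta> w u) (at z) v"

definition is_primitive_on ::
    "(complex^'n) set \<Rightarrow> (complex^'n \<Rightarrow> complex^'n \<Rightarrow> real) \<Rightarrow>
     (complex^'n \<Rightarrow> complex^'n \<Rightarrow> complex^'n \<Rightarrow> real) \<Rightarrow> bool" where
  "is_primitive_on \<Omega> \<eta> \<omega> \<longleftrightarrow>
     one_form_on \<Omega> \<eta> \<and> (\<forall>z\<in>\<Omega>. \<forall>u v. exterior_derivative \<eta> z u v = \<omega> z u v)"

definition assoc_metric ::
    "(complex^'n \<Rightarrow> complex^'n \<Rightarrow> complex^'n \<Rightarrow> real) \<Rightarrow>
     complex^'n \<Rightarrow> complex^'n \<Rightarrow> complex^'n \<Rightarrow> real" where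
  "assoc_metric \<omega> z u v = \<omega> z u (\<i> *s v)"

text \<open>The length of a covector is its dual norm with respect to the associated metric.\<close>

definition form_length ::
    "(complex^'n \<Rightarrow> complex^'n \<Rightarrow> complex^'n \<Rightarrow> real) \<Rightarrow>
     (complex^'n \<Rightarrow> complex^'n \<Rightarrow> real) \<Rightarrow> complex^'n \<Rightarrow> ennreal" where
  "form_length \<omega> \<eta> z = (SUP v\<in>{v. assoc_metric \<omega> z v v \<le> 1}. ennreal \<bar>\<eta> z v\<bar>)"

definition form_sup_norm ::
    "(complex^'n) set \<Rightarrow> (complex^'n \<Rightarrow> complex^'n \<Rightarrow> complex^'n \<Rightarrow> real) \<Rightarrow>
     (complex^'n \<Rightarrow> complex^'n \<Rightarrow> real) \<Rightarrow> ennreal" where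
  "form_sup_norm \<Omega> \<omega> \<eta> = (SUP z\<in>\<Omega>. form_length \<omega> \<eta> z)"

definition kahler_hyperbolicity_modulus ::
    "(complex^'n) set \<Rightarrow> (complex^'n \<Rightarrow> complex^'n \<Rightarrow> complex^'n \<Rightarrow> real) \<Rightarrow> ennreal" where
  "kahler_hyperbolicity_modulus \<Omega> \<omega> =
     (INF \<eta>\<in>{\<eta>. is_primitive_on \<Omega> \<eta> \<omega>}. (form_sup_norm \<Omega> \<omega> \<eta>)\<^sup>2)"

end

theory Submission
  imports Defs "HOL-Complex_Analysis.Complex_Analysis"
begin

text \<open>
  Let \<open>\<eta>\<close> be a primitive of the Bergman form \<open>\<omega>\<close> with \<open>|\<eta>| \<le> C\<close>, and let \<open>F\<close> be a holomorphic disc in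
  \<open>\<Omega>\<close>. By Stokes' theorem the area \<open>A(r)\<close> of \<open>F({|\<zeta>| \<le> r})\<close> is the integral of \<open>\<eta>\<close> over the boundary
  circle, so it is at most \<open>C\<close> times the length of that circle, and the Cauchy-Schwarz inequality gives
  \<open>A\<^sup>2 \<le> 2 \<pi> C\<^sup>2 r A'\<close>. Integrating this from \<open>r\<close> to \<open>s\<close> gives \<open>A(r) \<le> 2 \<pi> C\<^sup>2 / ln (s / r)\<close>. As \<open>\<omega>\<close> has the potential
  \<open>log K(z, z)\<close>, the circle integrals \<open>m(r)\<close> of \<open>log K\<close> along \<open>F\<close> satisfy \<open>r m' = 2 A\<close>; hence they grow at most like
  \<open>4 \<pi> C\<^sup>2 ln (1 / (1 - r))\<close>.

  On the other hand, let \<open>p\<close> be a point of the closure of \<open>\<Omega>\<close> at maximal distance \<open>R\<close> from the origin. Near \<open>p\<close> the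
  domain lies between a ball of radius \<open>R\<close> and a paraboloid, both touching at \<open>p\<close>, so along the normal complex line
  \<open>K\<close> is comparable to the distance from the tangent hyperplane raised to the power \<open>-(n+1)\<close>. For the discs
  \<open>F(\<zeta>) = p - t (1 - \<zeta>) / (1 + \<zeta>) \<nu>\<close> with \<open>t\<close> small, \<open>m(r)\<close> therefore grows at least like
  \<open>2 \<pi> (n + 1) ln (1 / (1 - r))\<close>, uniformly in \<open>t\<close>. Comparing the two, \<open>2 C\<^sup>2 \<ge> n + 1\<close>.
\<close>

subsection \<open>Linear images of Lebesgue measure\<close>

text \<open>Only the exponent n + 1 of the kernel matters: the factors in its upper and lower
  estimates are unspecified constants, and letting R tend to 1 against ln (1 / (1 - R)) removes
  them. The obstacle is that, for fixed t, a disc need not stay in the domain up to the unit circle,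
  since the whole unit disc is mapped onto a half-plane of the normal line whose edge is tangent to
  the boundary. So t is chosen after R. This is harmless because both circle means contain the same
  term - (n + 1) ln t, which cancels in their difference, while the remaining constants depend on
  neither t nor R. The denominator 1 + \<zeta> does not change the coefficient either, as ln |1 +
  \<zeta>| is harmonic in the disc and vanishes at 0. A second obstacle is regularity: the kernel is
  given only by its reproducing property, yet log K(z, z) has to be differentiated twice. The
  derivatives come from functions that are holomorphic in one argument, antiholomorphic in the other
  and locally bounded, so that Cauchy estimates in one argument at a time suffice.\<close>

lemma nn_integral_lborel_plus:
  fixes f :: "'a::euclidean_space \<Rightarrow> ennreal"
  assumes [measurable]: "f \<in> borel_measurable borel"
  shows "(\<integral>\<^sup>+x. f (x + a) \<partial>lborel) = (\<integral>\<^sup>+x. f x \<partial>lborel)"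
proof -
  have "(\<integral>\<^sup>+x. f x \<partial>lborel) = (\<integral>\<^sup>+x. f x \<partial>distr lborel borel ((+) a))"
    by (simp add: lborel_distr_plus)
  also have "\<dots> = (\<integral>\<^sup>+x. f (x + a) \<partial>lborel)"
    by (subst nn_integral_distr) (auto simp: add.commute)
  finally show ?thesis ..
qed

text \<open>The uniqueness argument for Haar measure: the double integral of
  \<open>indicator A (T x) * indicator B (y + T x)\<close> is computed in both orders by translation
  invariance. With the unit box as \<open>B\<close>, preimages under \<open>T\<close> have measure
  proportional to Lebesgue measure, without any determinant.\<close>

lemma emeasure_lborel_linear_vimage_swap:
  fixes T :: "'a::euclidean_space \<Rightarrow> 'a"
  assumes T: "linear T" "bij T" and [measurable]: "A \<in> sets borel" "B \<in> sets borel"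
  shows "emeasure lborel (T -` A) * emeasure lborel B
       = emeasure lborel (T -` B) * emeasure lborel (uminus -` A)"
proof -
  have [measurable]: "T \<in> borel_measurable borel"
    using T(1) by (intro borel_measurable_continuous_onI linear_continuous_on linear_conv_bounded_linear[THEN iffD1])
  have TA[measurable]: "T -` X \<in> sets borel" if "X \<in> sets borel" for X
    using measurable_sets[OF _ that, of T borel] by simp
  have uA[measurable]: "uminus -` A \<in> sets (borel :: 'a measure)"
    using measurable_sets[of uminus borel borel A] by simp
  define S where "S = inv T"
  have TS: "T (S y) = y" for y using T(2) by (simp add: S_def bij_is_surj surj_f_inv_f)
  have TSx: "T (x - S y) = T x - y" "T (x + S y) = T x + y" for x y
    using T(1) TS by (auto simp: linear_diff linear_add)
  have "emeasure lborel (T -` A) * emeasure lborel B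
      = (\<integral>\<^sup>+x. indicator A (T x) * emeasure lborel B \<partial>lborel)"
    by (subst nn_integral_multc) (auto simp: nn_integral_indicator[symmetric] indicator_vimage simp del: nn_integral_indicator)
  also have "\<dots> = (\<integral>\<^sup>+x. indicator A (T x) * (\<integral>\<^sup>+y. indicator B (y + T x) \<partial>lborel) \<partial>lborel)"
    by (subst nn_integral_lborel_plus) auto
  also have "\<dots> = (\<integral>\<^sup>+x. \<integral>\<^sup>+y. indicator A (T x) * indicator B (y + T x) \<partial>lborel \<partial>lborel)"
    by (subst nn_integral_cmult) auto
  also have "\<dots> = (\<integral>\<^sup>+y. \<integral>\<^sup>+x. indicator A (T x) * indicator B (y + T x) \<partial>lborel \<partial>lborel)"
    by (rule lborel_pair.Fubini') measurable
  \<comment> \<open>Shifting \<open>x\<close> by \<open>S y\<close> moves the dependence on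
    \<open>y\<close> from \<open>B\<close> to \<open>A\<close>, so that the integral over
    \<open>y\<close> will measure the reflection of a translate of \<open>A\<close>.\<close>
  also have "\<dots> = (\<integral>\<^sup>+y. \<integral>\<^sup>+x. indicator A (T x - y) * indicator B (T x) \<partial>lborel \<partial>lborel)"
  proof (rule nn_integral_cong)
    fix y :: 'a
    have "(\<integral>\<^sup>+x. indicator A (T x - y) * indicator B (T x) \<partial>lborel)
        = (\<integral>\<^sup>+x. indicator A (T (x + S y) - y) * indicator B (T (x + S y)) \<partial>lborel :: ennreal)"
      by (rule nn_integral_lborel_plus[symmetric]) measurable
    also have "\<dots> = (\<integral>\<^sup>+x. indicator A (T x) * indicator B (y + T x) \<partial>lborel)"
      by (simp add: TSx add.commute)
    finally show "(\<integral>\<^sup>+x. indicator A (T x) * indicator B (y + T x) \<partial>lborel)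
        = (\<integral>\<^sup>+x. indicator A (T x - y) * indicator B (T x) \<partial>lborel :: ennreal)" ..
  qed
  also have "\<dots> = (\<integral>\<^sup>+x. \<integral>\<^sup>+y. indicator A (T x - y) * indicator B (T x) \<partial>lborel \<partial>lborel)"
    by (rule lborel_pair.Fubini') measurable
  also have "\<dots> = (\<integral>\<^sup>+x. indicator B (T x) * (\<integral>\<^sup>+y. indicator (uminus -` A) (y + (- T x)) \<partial>lborel) \<partial>lborel)"
    by (subst nn_integral_cmult[symmetric]) (auto simp: mult.commute indicator_def intro!: nn_integral_cong)
  also have "\<dots> = (\<integral>\<^sup>+x. indicator B (T x) * emeasure lborel (uminus -` A) \<partial>lborel)"
    by (subst nn_integral_lborel_plus) auto
  also have "\<dots> = emeasure lborel (T -` B) * emeasure lborel (uminus -` A)"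
    by (subst nn_integral_multc) (auto simp: nn_integral_indicator[symmetric] indicator_vimage simp del: nn_integral_indicator)
  finally show ?thesis .
qed

lemma emeasure_lborel_unit_box: "emeasure lborel (box 0 One :: 'a::euclidean_space set) = 1"
  by (simp add: emeasure_lborel_box_eq)

text \<open>The swap identity for the identity map, with the unit box as \<open>B\<close>.\<close>

lemma emeasure_lborel_uminus_vimage:
  fixes A :: "'a::euclidean_space set"
  assumes "A \<in> sets borel"
  shows "emeasure lborel (uminus -` A) = emeasure lborel A"
proof -
  have "emeasure lborel A * emeasure lborel (box 0 One :: 'a set)
      = emeasure lborel (box 0 One :: 'a set) * emeasure lborel (uminus -` A)"
    using emeasure_lborel_linear_vimage_swap[of "\<lambda>x. x" A "box 0 One"] assms
    by (simp add: linear_id[unfolded id_def] bij_id[unfolded id_def])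
  then show ?thesis by (simp add: emeasure_lborel_unit_box)
qed

text \<open>The constant is the measure of the preimage of the unit box: positive because this
  preimage is open and nonempty, finite because it is bounded. It is used for the non-unitary
  coordinate change \<open>skew\<close>.\<close>

lemma emeasure_lborel_linear_vimage:
  fixes T :: "'a::euclidean_space \<Rightarrow> 'a"
  assumes T: "linear T" "bij T"
  obtains c :: real where "c > 0"
    "\<And>A. A \<in> sets borel \<Longrightarrow> emeasure lborel (T -` A) = ennreal c * emeasure lborel A"
proof -
  let ?U = "box 0 One :: 'a set"
  have eq: "emeasure lborel (T -` A) = emeasure lborel (T -` ?U) * emeasure lborel A"
    if "A \<in> sets borel" for A
    using emeasure_lborel_linear_vimage_swap[OF T that, of ?U] that
    by (simp add: emeasure_lborel_unit_box emeasure_lborel_uminus_vimage)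
  have bl: "bounded_linear T" using T(1) by (simp add: linear_conv_bounded_linear)
  have op: "open (T -` ?U)"
    by (intro continuous_open_vimage) (auto simp: linear_continuous_at bl)
  have inj: "inj T" and surj: "surj T" using T(2) by (auto simp: bij_def)
  have "?U \<noteq> {}" by (simp add: box_ne_empty)
  then obtain u where "u \<in> ?U" unfolding ex_in_conv[symmetric] by (elim exE)
  then have ne: "T -` ?U \<noteq> {}" using surj by (simp add: surj_vimage_empty \<open>?U \<noteq> {}\<close>)
  have "linear (inv T)" using T(1) inj by (rule inj_linear_imp_inv_linear)
  then have "bounded (inv T ` ?U)"
    using bounded_linear_image[OF bounded_box] by (simp add: linear_conv_bounded_linear)
  moreover have "T -` ?U = inv T ` ?U" using T(2) by (simp add: bij_vimage_eq_inv_image)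
  ultimately have "bounded (T -` ?U)" by simp
  then obtain M where "T -` ?U \<subseteq> cball 0 M" by (auto simp: bounded_iff subset_iff)
  then have "emeasure lborel (T -` ?U) \<le> emeasure lborel (cball 0 M :: 'a set)"
    by (intro emeasure_mono) auto
  also have "\<dots> < \<infinity>" by (rule emeasure_lborel_cball_finite)
  finally have fin: "emeasure lborel (T -` ?U) < \<infinity>" .
  have "emeasure lborel (T -` ?U) \<noteq> 0"
  proof -
    obtain x where "x \<in> T -` ?U" using ne by blast
    then obtain e where e: "e > 0" "ball x e \<subseteq> T -` ?U"
      using op unfolding open_contains_ball by blast
    have "emeasure lborel (ball x e) = ennreal (measure lborel (ball x e))"
      using emeasure_lborel_ball_finite by (intro emeasure_eq_ennreal_measure less_imp_neq) simp
    then have "0 < emeasure lborel (ball x e)"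
      using content_ball_pos[OF e(1), of x] by simp
    also have "\<dots> \<le> emeasure lborel (T -` ?U)"
      using e op by (intro emeasure_mono) auto
    finally show ?thesis by simp
  qed
  then have pos: "0 < enn2real (emeasure lborel (T -` ?U))"
    using fin by (simp only: enn2real_positive_iff zero_less_iff_neq_zero) (simp add: less_top[symmetric])
  have c: "ennreal (enn2real (emeasure lborel (T -` ?U))) = emeasure lborel (T -` ?U)"
    using fin by (intro ennreal_enn2real) simp
  show ?thesis
    by (rule that[OF pos], unfold c, rule eq)
qed

text \<open>The unit ball is its own preimage and has positive finite measure, which forces the
  constant to be 1. The maps in question are the rotations of complex space by a scalar of modulus
  one.\<close>

lemma emeasure_lborel_isometry_vimage:
  fixes T :: "'a::euclidean_space \<Rightarrow> 'a"
  assumes T: "linear T" and n: "\<And>x. norm (T x) = norm x" and A: "A \<in> sets borel"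
  shows "emeasure lborel (T -` A) = emeasure lborel A"
proof -
  have "inj T" unfolding linear_injective_0[OF T] by (metis n norm_eq_zero)
  then have "bij T" using T by (simp add: bij_def linear_injective_imp_surjective)
  then obtain c where c: "c > 0" "\<And>A. A \<in> sets borel \<Longrightarrow> emeasure lborel (T -` A) = ennreal c * emeasure lborel A"
    using emeasure_lborel_linear_vimage T by blast
  have mpos: "0 < measure lborel (ball 0 1 :: 'a set)" by (simp add: content_ball_pos)
  have "T -` ball 0 1 = ball 0 1" using n by (auto simp: dist_norm)
  with c(2)[of "ball 0 1"] have "emeasure lborel (ball 0 1 :: 'a set) = ennreal c * emeasure lborel (ball 0 1 :: 'a set)" by simp
  moreover have "emeasure lborel (ball 0 1 :: 'a set) = ennreal (measure lborel (ball 0 1 :: 'a set))"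
    using emeasure_lborel_ball_finite by (intro emeasure_eq_ennreal_measure less_imp_neq) simp
  moreover have "ennreal c * ennreal (measure lborel (ball 0 1 :: 'a set))
      = ennreal (c * measure lborel (ball 0 1 :: 'a set))"
    using c(1) by (simp add: ennreal_mult')
  ultimately have "ennreal (measure lborel (ball 0 1 :: 'a set)) = ennreal (c * measure lborel (ball 0 1 :: 'a set))"
    by (simp only:)
  then have "measure lborel (ball 0 1 :: 'a set) = c * measure lborel (ball 0 1 :: 'a set)"
    using c(1) by (subst (asm) ennreal_inj) auto
  with mpos have "c = 1" by simp
  then show ?thesis using c A by simp
qed

lemma nn_integral_lborel_isometry:
  fixes T :: "'a::euclidean_space \<Rightarrow> 'a"
  assumes T: "linear T" and n: "\<And>x. norm (T x) = norm x" and [measurable]: "f \<in> borel_measurable borel"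
  shows "(\<integral>\<^sup>+x. f (T x) \<partial>lborel) = (\<integral>\<^sup>+x. f x \<partial>lborel)"
proof -
  have [measurable]: "T \<in> borel_measurable borel"
    using T(1) by (intro borel_measurable_continuous_onI linear_continuous_on linear_conv_bounded_linear[THEN iffD1])
  have "distr lborel borel T = lborel"
    by (intro measure_eqI) (simp_all add: emeasure_distr emeasure_lborel_isometry_vimage[OF T n])
  then have "(\<integral>\<^sup>+x. f x \<partial>lborel) = (\<integral>\<^sup>+x. f x \<partial>distr lborel borel T)" by simp
  also have "\<dots> = (\<integral>\<^sup>+x. f (T x) \<partial>lborel)"
    by (subst nn_integral_distr) auto
  finally show ?thesis ..
qed

subsection \<open>Holomorphic functions of several variables\<close>

lemma norm_smult_complex: "norm (c *s v) = cmod c * norm (v :: complex^'n)"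
  by (simp add: norm_vec_def L2_set_def norm_mult power_mult_distrib sum_distrib_left[symmetric] real_sqrt_mult)

lemma scaleR_smult_complex: "r *\<^sub>R v = complex_of_real r *s (v :: complex^'n)"
  by (simp add: vec_eq_iff) (simp add: scaleR_conv_of_real)

lemma bounded_linear_smult_left: "bounded_linear (\<lambda>c. c *s (v :: complex^'n))"
  by (intro linear_conv_bounded_linear[THEN iffD1] linearI) (auto simp: vec_eq_iff algebra_simps scaleR_smult_complex scaleR_conv_of_real[where 'a=complex])

lemma bounded_linear_smult_right: "bounded_linear (\<lambda>v. c *s (v :: complex^'n))"
  by (intro linear_conv_bounded_linear[THEN iffD1] linearI) (auto simp: vec_eq_iff algebra_simps scaleR_smult_complex scaleR_conv_of_real[where 'a=complex])

lemma continuous_on_smult [continuous_intros]: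
  fixes f :: "'a::topological_space \<Rightarrow> complex" and g :: "'a \<Rightarrow> complex^'n"
  assumes "continuous_on S f" "continuous_on S g"
  shows "continuous_on S (\<lambda>x. f x *s g x)"
  using assms unfolding vector_scalar_mult_def by (auto intro!: continuous_intros simp: continuous_on_vec_lambda)

lemma borel_measurable_smult [measurable (raw)]:
  fixes f :: "'a \<Rightarrow> complex" and g :: "'a \<Rightarrow> complex^'n"
  assumes [measurable]: "f \<in> borel_measurable M" "g \<in> borel_measurable M"
  shows "(\<lambda>x. f x *s g x) \<in> borel_measurable M"
proof -
  have "(\<lambda>p :: complex \<times> (complex^'n). fst p *s snd p) \<in> borel_measurable borel"
    by (intro borel_measurable_continuous_onI continuous_intros)
  moreover have "(\<lambda>x. (f x, g x)) \<in> M \<rightarrow>\<^sub>M borel"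
    by (simp add: borel_prod[symmetric])
  ultimately have "(\<lambda>x. (\<lambda>p. fst p *s snd p) ((\<lambda>x. (f x, g x)) x)) \<in> borel_measurable M"
    by (rule measurable_compose_rev)
  then show ?thesis by simp
qed

abbreviation (input) fd :: "('a::real_normed_vector \<Rightarrow> 'b::real_normed_vector) \<Rightarrow> 'a \<Rightarrow> 'a \<Rightarrow> 'b" where
  "fd f z \<equiv> frechet_derivative f (at z)"

lemma holomorphic_Cn_fd:
  assumes "holomorphic_Cn_on S f" "z \<in> S"
  shows "(f has_derivative fd f z) (at z)" "fd f z (c *s v) = c * fd f z v"
proof -
  obtain f' where f': "(f has_derivative f') (at z)" "\<forall>c v. f' (c *s v) = c * f' v"
    using assms unfolding holomorphic_Cn_on_def by blast
  moreover have "f' = fd f z" using f'(1) by (rule frechet_derivative_at)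
  ultimately show "(f has_derivative fd f z) (at z)" "fd f z (c *s v) = c * fd f z v" by auto
qed

lemma holomorphic_Cn_onI:
  assumes "\<And>z. z \<in> S \<Longrightarrow> (f has_derivative f' z) (at z)" "\<And>z c v. z \<in> S \<Longrightarrow> f' z (c *s v) = c * f' z v"
  shows "holomorphic_Cn_on S f"
  using assms unfolding holomorphic_Cn_on_def by blast

lemma holomorphic_Cn_on_subset: "holomorphic_Cn_on S f \<Longrightarrow> T \<subseteq> S \<Longrightarrow> holomorphic_Cn_on T f"
  unfolding holomorphic_Cn_on_def by blast

lemma holomorphic_Cn_on_continuous: "holomorphic_Cn_on S f \<Longrightarrow> continuous_on S f"
  by (meson continuous_at_imp_continuous_on has_derivative_continuous holomorphic_Cn_fd(1))

lemma holomorphic_Cn_on_const: "holomorphic_Cn_on S (\<lambda>_. a)"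
  by (rule holomorphic_Cn_onI[where f'="\<lambda>_ _. 0"]) auto

lemma holomorphic_Cn_on_add:
  assumes "holomorphic_Cn_on S f" "holomorphic_Cn_on S g"
  shows "holomorphic_Cn_on S (\<lambda>z. f z + g z)"
  by (rule holomorphic_Cn_onI[where f'="\<lambda>z v. fd f z v + fd g z v"])
     (auto intro!: derivative_eq_intros holomorphic_Cn_fd(1) assms simp: holomorphic_Cn_fd(2)[OF assms(1)] holomorphic_Cn_fd(2)[OF assms(2)] algebra_simps)

lemma holomorphic_Cn_on_cmult:
  assumes "holomorphic_Cn_on S f"
  shows "holomorphic_Cn_on S (\<lambda>z. a * f z)"
  by (rule holomorphic_Cn_onI[where f'="\<lambda>z v. a * fd f z v"])
     (auto intro!: derivative_eq_intros holomorphic_Cn_fd(1) assms simp: holomorphic_Cn_fd(2)[OF assms(1)])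

lemma holomorphic_Cn_on_diff:
  assumes "holomorphic_Cn_on S f" "holomorphic_Cn_on S g"
  shows "holomorphic_Cn_on S (\<lambda>z. f z - g z)"
  using holomorphic_Cn_on_add[OF assms(1) holomorphic_Cn_on_cmult[OF assms(2), of "-1"]] by simp

lemma holomorphic_Cn_on_translate:
  assumes "holomorphic_Cn_on S f" "\<And>z. z \<in> T \<Longrightarrow> z + a \<in> S"
  shows "holomorphic_Cn_on T (\<lambda>z. f (z + a))"
proof (rule holomorphic_Cn_onI[where f'="\<lambda>z. fd f (z + a)"])
  fix z assume "z \<in> T"
  then have zS: "z + a \<in> S" using assms(2) by blast
  show "((\<lambda>z. f (z + a)) has_derivative fd f (z + a)) (at z)"
    by (rule has_derivative_compose[of "\<lambda>z. z + a" "\<lambda>v. v" z UNIV f, OF _ holomorphic_Cn_fd(1)[OF assms(1) zS], simplified])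
       (auto intro!: derivative_eq_intros)
  show "fd f (z + a) (c *s v) = c * fd f (z + a) v" for c v
    by (rule holomorphic_Cn_fd(2)[OF assms(1) zS])
qed

lemma holomorphic_Cn_line_deriv:
  assumes "holomorphic_Cn_on S f" "z + \<zeta> *s v \<in> S"
  shows "((\<lambda>\<zeta>. f (z + \<zeta> *s v)) has_field_derivative fd f (z + \<zeta> *s v) v) (at \<zeta>)"
proof -
  have "((\<lambda>\<zeta>. z + \<zeta> *s v) has_derivative (\<lambda>h. h *s v)) (at \<zeta>)"
    by (auto intro!: derivative_eq_intros bounded_linear_imp_has_derivative bounded_linear_smult_left)
  from has_derivative_compose[OF this holomorphic_Cn_fd(1)[OF assms]]
  have "((\<lambda>\<zeta>. f (z + \<zeta> *s v)) has_derivative (\<lambda>h. fd f (z + \<zeta> *s v) (h *s v))) (at \<zeta>)" .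
  then show ?thesis
    by (simp add: has_field_derivative_def holomorphic_Cn_fd(2)[OF assms] mult.commute[of _ "fd f (z + \<zeta> *s v) v"])
qed

lemma holomorphic_Cn_line:
  assumes "holomorphic_Cn_on S f" "\<And>\<zeta>. \<zeta> \<in> T \<Longrightarrow> z + \<zeta> *s v \<in> S"
  shows "(\<lambda>\<zeta>. f (z + \<zeta> *s v)) holomorphic_on T"
  unfolding holomorphic_on_def field_differentiable_def
  using holomorphic_Cn_line_deriv[OF assms(1) assms(2)] has_field_derivative_at_within by blast

section \<open>Cauchy estimates, locally uniform limits and directional derivatives\<close>

lemma ball_line:
  fixes z v :: "complex^'n"
  assumes "cmod \<zeta> * norm v < r"
  shows "z + \<zeta> *s v \<in> ball z r"
  using assms by (simp add: dist_norm norm_smult_complex)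

text \<open>On the complex line through \<open>z\<close> in direction \<open>v\<close> this is the
  one-variable Cauchy inequality on a circle of radius \<open>s / norm v\<close>; letting
  \<open>s\<close> tend to \<open>r\<close> recovers the full radius.\<close>

lemma Cauchy_estimate:
  fixes f :: "complex^'n \<Rightarrow> complex"
  assumes f: "holomorphic_Cn_on (ball z r) f" and B: "\<And>w. w \<in> ball z r \<Longrightarrow> cmod (f w) \<le> B" and r: "r > 0"
  shows "cmod (fd f z v) \<le> B * norm v / r"
proof (cases "v = 0")
  case True
  have zb: "z \<in> ball z r" using r by simp
  have "fd f z (0 *s v) = 0 * fd f z v" by (rule holomorphic_Cn_fd(2)[OF f zb])
  then show ?thesis using True by simp
next
  case False
  then have nv: "norm v > 0" by simp
  have B0: "B \<ge> 0" using B[of z] r norm_ge_zero[of "f z"] by (simp del: norm_ge_zero)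
  have *: "cmod (fd f z v) \<le> B * norm v / s" if s: "0 < s" "s < r" for s
  proof -
    let ?g = "\<lambda>\<zeta>. f (z + \<zeta> *s v)" and ?t = "s / norm v"
    have in_ball: "z + \<zeta> *s v \<in> ball z r" if "\<zeta> \<in> cball 0 ?t" for \<zeta>
    proof (rule ball_line)
      have "cmod \<zeta> * norm v \<le> s" using that nv by (simp add: field_simps)
      then show "cmod \<zeta> * norm v < r" using s by simp
    qed
    have hol: "?g holomorphic_on cball 0 ?t"
      by (rule holomorphic_Cn_line[OF f in_ball])
    have "cmod ((deriv ^^ 1) ?g 0) \<le> fact 1 * B / ?t ^ 1"
    proof (rule Cauchy_inequality)
      show "?g holomorphic_on ball 0 ?t" using hol holomorphic_on_subset ball_subset_cball by blast
      show "continuous_on (cball 0 ?t) ?g" using hol by (rule holomorphic_on_imp_continuous_on)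
      show "0 < ?t" using s nv by simp
      show "cmod (?g x) \<le> B" if "cmod (0 - x) = ?t" for x
        using that by (intro B in_ball) simp
    qed
    moreover have "deriv ?g 0 = fd f z v"
      using holomorphic_Cn_line_deriv[OF f, of z 0 v] r by (simp add: DERIV_imp_deriv)
    ultimately show ?thesis by (simp add: field_simps)
  qed
  have "((\<lambda>s. B * norm v / s) \<longlongrightarrow> B * norm v / r) (at_left r)"
    using r by (intro tendsto_intros) auto
  moreover have "eventually (\<lambda>s. cmod (fd f z v) \<le> B * norm v / s) (at_left r)"
    using * r eventually_at_left[of 0 r] by (metis (mono_tags, lifting))
  ultimately show ?thesis by (intro tendsto_lowerbound) auto
qed

lemma Cauchy_estimate_ball:
  fixes f :: "complex^'n \<Rightarrow> complex"
  assumes f: "holomorphic_Cn_on (ball z r) f" and B: "\<And>w. w \<in> ball z r \<Longrightarrow> cmod (f w) \<le> B"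
    and r: "r > 0" and w: "w \<in> ball z (r / 2)"
  shows "cmod (fd f w v) \<le> 2 * B * norm v / r"
proof -
  have sub: "ball w (r/2) \<subseteq> ball z r"
  proof
    fix x assume "x \<in> ball w (r/2)"
    then show "x \<in> ball z r" using w dist_triangle[of z x w] by (simp add: dist_commute)
  qed
  have "cmod (fd f w v) \<le> B * norm v / (r/2)"
    by (rule Cauchy_estimate[OF holomorphic_Cn_on_subset[OF f sub]]) (use B sub r in auto)
  then show ?thesis by (simp add: field_simps)
qed

lemma Cauchy_Lipschitz:
  fixes f :: "complex^'n \<Rightarrow> complex"
  assumes f: "holomorphic_Cn_on (ball z r) f" and B: "\<And>w. w \<in> ball z r \<Longrightarrow> cmod (f w) \<le> B"
    and r: "r > 0" and xy: "x \<in> ball z (r / 2)" "y \<in> ball z (r / 2)"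
  shows "cmod (f x - f y) \<le> 2 * B / r * norm (x - y)"
proof (rule differentiable_bound[OF convex_ball _ _ xy])
  fix w assume w: "w \<in> ball z (r/2)"
  then have wr: "w \<in> ball z r" using r by (simp)
  show "(f has_derivative fd f w) (at w within ball z (r / 2))"
    using holomorphic_Cn_fd(1)[OF f wr] by (rule has_derivative_at_withinI)
  show "onorm (fd f w) \<le> 2 * B / r"
  proof (rule onorm_bound)
    have "0 \<le> B" using B[OF wr] norm_ge_zero order_trans by blast
    then show "0 \<le> 2 * B / r" using r by simp
    show "cmod (fd f w v) \<le> 2 * B / r * norm v" for v
      using Cauchy_estimate_ball[OF f B r w, of v] by simp
  qed
qed

text \<open>First-order Taylor formula, from 0 to 1, for the restriction of \<open>f\<close> to the
  line through \<open>z\<close> in direction \<open>h\<close>, which is holomorphic in a disc of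
  radius \<open>r / norm h > 4\<close>. The error depends on \<open>f\<close> only through
  \<open>B\<close>; this uniformity makes difference quotients converge uniformly.\<close>

lemma derivative_remainder:
  fixes f :: "complex^'n \<Rightarrow> complex"
  assumes f: "holomorphic_Cn_on (ball z r) f" and B: "\<And>w. w \<in> ball z r \<Longrightarrow> cmod (f w) \<le> B"
    and r: "r > 0" and h: "norm h < r / 4"
  shows "cmod (f (z + h) - f z - fd f z h) \<le> 8 * B / r\<^sup>2 * (norm h)\<^sup>2"
proof (cases "h = 0")
  case True
  have zb: "z \<in> ball z r" using r by simp
  have "fd f z (0 *s h) = 0 * fd f z h" by (rule holomorphic_Cn_fd(2)[OF f zb])
  then show ?thesis using True by simp
next
  case False
  define \<rho> where "\<rho> = r / norm h"
  have nh: "norm h > 0" using False by simp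
  have \<rho>: "\<rho> > 4" using h nh by (simp add: \<rho>_def field_simps)
  let ?g = "\<lambda>\<zeta>. f (z + \<zeta> *s h)"
  have in_ball: "z + \<zeta> *s h \<in> ball z r" if "\<zeta> \<in> ball 0 \<rho>" for \<zeta>
    by (rule ball_line) (use that nh in \<open>simp add: \<rho>_def field_simps\<close>)
  have hol: "?g holomorphic_on ball 0 \<rho>"
    by (rule holomorphic_Cn_line[OF f in_ball])
  have "cmod ((deriv ^^ 0) ?g 1 - (\<Sum>i\<le>1. (deriv ^^ i) ?g 0 * (1 - 0) ^ i / fact i))
      \<le> (8 * B / \<rho>\<^sup>2) * cmod (1 - 0) ^ Suc 1 / fact 1"
  proof (rule complex_Taylor[of "cball 0 1"])
    fix i :: nat and x :: complex assume x: "x \<in> cball 0 1"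
    then have "x \<in> ball 0 \<rho>" using \<rho> by simp
    then have "((deriv ^^ i) ?g has_field_derivative deriv ((deriv ^^ i) ?g) x) (at x)"
      by (intro holomorphic_derivI[OF holomorphic_higher_deriv[OF hol]]) auto
    then show "((deriv ^^ i) ?g has_field_derivative (deriv ^^ Suc i) ?g x) (at x within cball 0 1)"
      by (simp add: has_field_derivative_at_within)
  next
    fix x :: complex assume x: "x \<in> cball 0 1"
    have sub: "cball x (\<rho> / 2) \<subseteq> ball 0 \<rho>"
    proof
      fix y assume "y \<in> cball x (\<rho>/2)"
      then have "cmod y \<le> 1 + \<rho>/2" using x norm_triangle_ineq2[of y x] by (simp add: dist_norm norm_minus_commute)
      then show "y \<in> ball 0 \<rho>" using \<rho> by simp
    qed
    \<comment> \<open>Circles of radius \<open>\<rho> / 2\<close> around points of the closed unit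
      disc stay inside the disc of radius \<open>\<rho>\<close>. The factor 2 from the factorial and
      4 from the half radius give the 8 of the conclusion.\<close>
    have "cmod ((deriv ^^ 2) ?g x) \<le> fact 2 * B / (\<rho> / 2) ^ 2"
    proof (rule Cauchy_inequality)
      show "?g holomorphic_on ball x (\<rho> / 2)" using hol sub holomorphic_on_subset ball_subset_cball by blast
      show "continuous_on (cball x (\<rho> / 2)) ?g"
        using hol sub holomorphic_on_subset holomorphic_on_imp_continuous_on by blast
      show "0 < \<rho> / 2" using \<rho> by simp
      show "cmod (?g y) \<le> B" if "cmod (x - y) = \<rho> / 2" for y
        using that sub by (intro B in_ball) (auto simp: dist_norm subset_iff)
    qed
    then show "cmod ((deriv ^^ Suc 1) ?g x) \<le> 8 * B / \<rho>\<^sup>2"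
      by (simp add: numeral_2_eq_2 field_simps)
  qed auto
  moreover have "deriv ?g 0 = fd f z h"
    using holomorphic_Cn_line_deriv[OF f, of z 0 h] r by (simp add: DERIV_imp_deriv)
  ultimately show ?thesis using nh by (simp add: \<rho>_def field_simps)
qed

text \<open>Weierstrass's theorem. Cauchy estimates make the derivatives uniformly Cauchy on half
  balls, so termwise differentiation applies, and complex linearity of the derivative passes to the
  limit.\<close>

lemma holomorphic_Cn_uniform_limit:
  fixes f :: "nat \<Rightarrow> complex^'n \<Rightarrow> complex"
  assumes S: "open S" and f: "\<And>k. holomorphic_Cn_on S (f k)"
    and lim: "\<And>z. z \<in> S \<Longrightarrow> \<exists>r>0. ball z r \<subseteq> S \<and> uniform_limit (ball z r) f g sequentially"
  shows "holomorphic_Cn_on S g"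
    and "\<And>z v. z \<in> S \<Longrightarrow> (\<lambda>k. fd (f k) z v) \<longlonglongrightarrow> fd g z v"
proof -
  have *: "\<exists>g'. (g has_derivative g') (at z) \<and> (\<forall>c v. g' (c *s v) = c * g' v) \<and> (\<forall>v. (\<lambda>k. fd (f k) z v) \<longlonglongrightarrow> g' v)"
    if z: "z \<in> S" for z
  proof -
    obtain r where r: "r > 0" "ball z r \<subseteq> S" and ul: "uniform_limit (ball z r) f g sequentially"
      using lim[OF z] by blast
    let ?T = "ball z (r/2)"
    have TS: "?T \<subseteq> ball z r" using r by auto
    have holr: "holomorphic_Cn_on (ball z r) (f k)" for k
      using f r(2) by (rule holomorphic_Cn_on_subset)
    have ucauchy: "\<exists>N. \<forall>m\<ge>N. \<forall>n\<ge>N. \<forall>x\<in>ball z r. dist (f m x) (f n x) < e" if "e > 0" for e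
      using ul that uniformly_convergent_Cauchy[of "ball z r" f]
      unfolding uniformly_convergent_on_def uniformly_Cauchy_on_def by blast
    have dcauchy: "\<exists>N. \<forall>m\<ge>N. \<forall>n\<ge>N. \<forall>x\<in>?T. \<forall>v. cmod (fd (f m) x v - fd (f n) x v) \<le> e * norm v" if e: "e > 0" for e
    proof -
      obtain N where N: "\<And>m n x. m \<ge> N \<Longrightarrow> n \<ge> N \<Longrightarrow> x \<in> ball z r \<Longrightarrow> dist (f m x) (f n x) < e * r / 2"
        using ucauchy[of "e * r / 2"] e r by (meson half_gt_zero mult_pos_pos)
      have "cmod (fd (f m) x v - fd (f n) x v) \<le> e * norm v" if mn: "m \<ge> N" "n \<ge> N" and x: "x \<in> ?T" for m n x v
      proof -
        have xr: "x \<in> ball z r" using x TS by blast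
        have "fd (\<lambda>x. f m x - f n x) x = (\<lambda>v. fd (f m) x v - fd (f n) x v)"
          by (rule frechet_derivative_at[symmetric]) (intro has_derivative_diff holomorphic_Cn_fd(1)[OF holr xr])
        moreover have "cmod (fd (\<lambda>x. f m x - f n x) x v) \<le> 2 * (e * r / 2) * norm v / r"
          by (rule Cauchy_estimate_ball[OF holomorphic_Cn_on_diff[OF holr holr] _ r(1) x])
             (use N mn in \<open>auto simp: dist_norm intro!: less_imp_le\<close>)
        ultimately show ?thesis using r by simp
      qed
      then show ?thesis by blast
    qed
    define g' where "g' x v = lim (\<lambda>k. fd (f k) x v)" for x v
    have conv: "(\<lambda>k. fd (f k) x v) \<longlonglongrightarrow> g' x v" if x: "x \<in> ?T" for x v
    proof -
      have "Cauchy (\<lambda>k. fd (f k) x v)"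
      proof (rule CauchyI)
        fix e :: real assume e: "e > 0"
        obtain N where N: "\<forall>m\<ge>N. \<forall>n\<ge>N. cmod (fd (f m) x v - fd (f n) x v) \<le> e / (norm v + 1) * norm v"
          using dcauchy[of "e / (norm v + 1)"] e x by (meson add_nonneg_pos divide_pos_pos norm_ge_zero zero_less_one)
        have "e / (norm v + 1) * norm v < e"
          using e mult_strict_left_mono[of "norm v" "norm v + 1" "e / (norm v + 1)"]
          by (simp add: add_nonneg_pos add_nonneg_eq_0_iff)
        with N show "\<exists>N. \<forall>m\<ge>N. \<forall>n\<ge>N. norm (fd (f m) x v - fd (f n) x v) < e" by (meson order_le_less_trans)
      qed
      then show ?thesis unfolding g'_def by (simp only: Cauchy_convergent_iff convergent_LIMSEQ_iff)
    qed
    have ev: "\<forall>\<^sub>F n in sequentially. \<forall>x\<in>?T. \<forall>h. norm (fd (f n) x h - g' x h) \<le> e * norm h" if e: "e > 0" for e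
    proof -
      obtain N where N: "\<forall>m\<ge>N. \<forall>n\<ge>N. \<forall>x\<in>?T. \<forall>v. cmod (fd (f m) x v - fd (f n) x v) \<le> e * norm v"
        using dcauchy[OF e] by blast
      have "norm (fd (f n) x h - g' x h) \<le> e * norm h" if "n \<ge> N" "x \<in> ?T" for n x h
      proof (rule tendsto_upperbound)
        show "(\<lambda>m. norm (fd (f n) x h - fd (f m) x h)) \<longlonglongrightarrow> norm (fd (f n) x h - g' x h)"
          by (intro tendsto_intros conv that)
        show "\<forall>\<^sub>F m in sequentially. norm (fd (f n) x h - fd (f m) x h) \<le> e * norm h"
          using N that by (intro eventually_sequentiallyI[of N]) auto
      qed simp
      then show ?thesis by (intro eventually_sequentiallyI[of N]) auto
    qed
    have zT: "z \<in> ?T" using r by simp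
    have ptlim: "(\<lambda>k. f k x) \<longlonglongrightarrow> g x" if "x \<in> ?T" for x
      by (rule tendsto_uniform_limitI[OF ul subsetD[OF TS that]])
    obtain g2 where g2: "\<And>x. x \<in> ?T \<Longrightarrow> (\<lambda>n. f n x) \<longlonglongrightarrow> g2 x \<and> (g2 has_derivative g' x) (at x within ?T)"
    proof -
      have "\<exists>g. \<forall>x\<in>?T. (\<lambda>n. f n x) \<longlonglongrightarrow> g x \<and> (g has_derivative g' x) (at x within ?T)"
      proof (rule has_derivative_sequence[where S="?T" and f=f and g'=g' and f'="\<lambda>n. fd (f n)", OF convex_ball _ _ zT ptlim[OF zT]])
        show "(f n has_derivative fd (f n) x) (at x within ?T)" if "x \<in> ?T" for n x
          by (rule has_derivative_at_withinI[OF holomorphic_Cn_fd(1)[OF holr subsetD[OF TS that]]])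
        show "\<forall>\<^sub>F n in sequentially. \<forall>x\<in>?T. \<forall>h. norm (fd (f n) x h - g' x h) \<le> e * norm h" if "e > 0" for e
          by (rule ev[OF that])
      qed
      then show ?thesis using that by blast
    qed
    have eq: "g2 x = g x" if "x \<in> ?T" for x using g2[OF that] ptlim[OF that] LIMSEQ_unique by blast
    have d2: "(g2 has_derivative g' z) (at z)"
      using g2[OF zT, THEN conjunct2] unfolding at_within_open[OF zT open_ball] .
    have "(g has_derivative g' z) (at z)"
      by (rule has_derivative_transform_within_open[OF d2 open_ball zT eq])
    moreover have "g' z (c *s v) = c * g' z v" for c v
    proof (rule LIMSEQ_unique[OF conv[OF zT]])
      have "fd (f k) z (c *s v) = c * fd (f k) z v" for k
        by (rule holomorphic_Cn_fd(2)[OF f z])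
      then show "(\<lambda>k. fd (f k) z (c *s v)) \<longlonglongrightarrow> c * g' z v"
        using conv[OF zT] by (auto intro!: tendsto_intros)
    qed
    ultimately show ?thesis using conv[OF zT] by blast
  qed
  show "holomorphic_Cn_on S g" unfolding holomorphic_Cn_on_def using * by blast
  show "(\<lambda>k. fd (f k) z v) \<longlonglongrightarrow> fd g z v" if z: "z \<in> S" for z v
  proof -
    obtain g' where g': "(g has_derivative g') (at z)" "(\<lambda>k. fd (f k) z v) \<longlonglongrightarrow> g' v" using *[OF z] by blast
    show ?thesis using g'(2) unfolding frechet_derivative_at[OF g'(1)] .
  qed
qed

text \<open>Near each point the directional derivative is a uniform limit of difference quotients
  with real steps, the error being controlled by \<open>derivative_remainder\<close>.\<close>

lemma holomorphic_Cn_on_fd: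
  assumes S: "open S" and f: "holomorphic_Cn_on S f"
  shows "holomorphic_Cn_on S (\<lambda>z. fd f z v)"
proof -
  have *: "\<exists>r>0. holomorphic_Cn_on (ball z r) (\<lambda>z. fd f z v)" if z: "z \<in> S" for z
  proof -
    obtain r where r: "r > 0" "cball z r \<subseteq> S" using S z open_contains_cball by blast
    have "compact (f ` cball z r)"
      using holomorphic_Cn_on_continuous[OF holomorphic_Cn_on_subset[OF f r(2)]] by (intro compact_continuous_image) auto
    then obtain B where B: "\<And>w. w \<in> cball z r \<Longrightarrow> cmod (f w) \<le> B"
      using compact_imp_bounded bounded_iff by (metis imageI)
    let ?T = "ball z (r/2)" and ?R = "r/2"
    have sub: "ball w ?R \<subseteq> ball z r" if "w \<in> ?T" for w
    proof
      fix x assume "x \<in> ball w ?R"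
      then show "x \<in> ball z r" using that dist_triangle[of z x w] by (simp add: dist_commute)
    qed
    have holr: "holomorphic_Cn_on (ball w ?R) f" if "w \<in> ?T" for w
      by (rule holomorphic_Cn_on_subset[OF f]) (use sub[OF that] r(2) ball_subset_cball in blast)
    \<comment> \<open>Starting the steps at index \<open>N\<close> keeps every translate by
      \<open>t k\<close> times \<open>v\<close> inside the ball on which \<open>f\<close> is bounded
      by \<open>B\<close>.\<close>
    obtain N :: nat where N: "N > 0" "norm v / real N < ?R / 4"
    proof -
      obtain N :: nat where "norm v / (?R/4) < real N" using reals_Archimedean2 by blast
      moreover from this have "N > 0" using r order_le_less_trans[of 0 "norm v / (?R/4)" "real N"] by simp
      ultimately show ?thesis using that[of N] r by (simp add: field_simps)
    qed
    define t where "t k = inverse (real (N + k))" for k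
    have t0: "t k > 0" for k using N(1) by (simp add: t_def)
    have small: "norm (complex_of_real (t k) *s v) < ?R / 4" for k
    proof -
      have "norm (complex_of_real (t k) *s v) = norm v / real (N + k)"
        using t0[of k] by (simp add: norm_smult_complex del: of_real_inverse) (simp add: t_def divide_inverse)
      also have "\<dots> \<le> norm v / real N" using N(1) by (intro divide_left_mono) auto
      also have "\<dots> < ?R / 4" by (rule N(2))
      finally show ?thesis .
    qed
    define q where "q k w = complex_of_real (inverse (t k)) * (f (w + complex_of_real (t k) *s v) - f w)" for k w
    have tlim: "t \<longlonglongrightarrow> 0"
      using LIMSEQ_ignore_initial_segment[OF lim_inverse_n, of N] unfolding t_def[abs_def] by (simp add: add.commute)
    have holq: "holomorphic_Cn_on ?T (q k)" for k
      unfolding q_def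
    proof (intro holomorphic_Cn_on_cmult holomorphic_Cn_on_diff holomorphic_Cn_on_translate[of "ball z r"])
      show "w + complex_of_real (t k) *s v \<in> ball z r" if "w \<in> ?T" for w
        by (rule subsetD[OF sub[OF that]]) (use small[of k] r in \<open>simp add: dist_norm\<close>)
      show "holomorphic_Cn_on (ball z r) f" "holomorphic_Cn_on ?T f"
        using r by (auto intro!: holomorphic_Cn_on_subset[OF f] subset_trans[OF _ r(2)])
    qed
    have est: "dist (q k w) (fd f w v) \<le> t k * (8 * B / ?R\<^sup>2 * (norm v)\<^sup>2)" if w: "w \<in> ?T" for k w
    proof -
      have "cmod (f (w + complex_of_real (t k) *s v) - f w - fd f w (complex_of_real (t k) *s v))
          \<le> 8 * B / ?R\<^sup>2 * (norm (complex_of_real (t k) *s v))\<^sup>2"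
        using sub[OF w] r by (intro derivative_remainder[OF holr[OF w] _ _ small]) (auto intro!: B)
      moreover have "fd f w (complex_of_real (t k) *s v) = complex_of_real (t k) * fd f w v"
        using w r by (intro holomorphic_Cn_fd(2)[OF holr[OF w]]) auto
      moreover have "q k w - fd f w v = complex_of_real (inverse (t k)) * (f (w + complex_of_real (t k) *s v) - f w - complex_of_real (t k) * fd f w v)"
        using t0[of k] by (simp add: q_def field_simps)
      ultimately have "cmod (q k w - fd f w v) \<le> inverse (t k) * (8 * B / ?R\<^sup>2 * (norm (complex_of_real (t k) *s v))\<^sup>2)"
        using t0[of k] by (simp only: norm_mult norm_of_real abs_of_pos positive_imp_inverse_positive mult_left_mono less_imp_le)
      also have "norm (complex_of_real (t k) *s v) = t k * norm v"
        using t0[of k] by (simp add: norm_smult_complex)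
      also have "inverse (t k) * (8 * B / ?R\<^sup>2 * (t k * norm v)\<^sup>2) = t k * (8 * B / ?R\<^sup>2 * (norm v)\<^sup>2)"
        using t0[of k] by (simp add: power2_eq_square)
      finally show ?thesis by (simp add: dist_norm)
    qed
    have ul: "uniform_limit ?T q (\<lambda>w. fd f w v) sequentially"
    proof (rule uniform_limitI)
      fix e :: real assume e: "e > 0"
      have "(\<lambda>k. t k * (8 * B / ?R\<^sup>2 * (norm v)\<^sup>2)) \<longlonglongrightarrow> 0 * (8 * B / ?R\<^sup>2 * (norm v)\<^sup>2)"
        by (intro tendsto_intros tlim)
      then have "\<forall>\<^sub>F k in sequentially. t k * (8 * B / ?R\<^sup>2 * (norm v)\<^sup>2) < e"
        using e by (auto dest: order_tendstoD)
      then show "\<forall>\<^sub>F k in sequentially. \<forall>w\<in>?T. dist (q k w) (fd f w v) < e"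
        by eventually_elim (use est order_le_less_trans in blast)
    qed
    have "holomorphic_Cn_on ?T (\<lambda>w. fd f w v)"
    proof (rule holomorphic_Cn_uniform_limit(1)[OF open_ball holq])
      fix w assume "w \<in> ?T"
      then obtain s where "s > 0" "ball w s \<subseteq> ?T" using open_ball open_contains_ball by blast
      then show "\<exists>r>0. ball w r \<subseteq> ?T \<and> uniform_limit (ball w r) q (\<lambda>w. fd f w v) sequentially"
        using uniform_limit_on_subset[OF ul] by blast
    qed
    then show ?thesis using r(1) half_gt_zero by blast
  qed
  show ?thesis
    unfolding holomorphic_Cn_on_def
  proof
    fix z assume "z \<in> S"
    then obtain r where r: "r > 0" "holomorphic_Cn_on (ball z r) (\<lambda>z. fd f z v)" using * by blast
    then have "z \<in> ball z r" by simp
    with r show "\<exists>f'. ((\<lambda>z. fd f z v) has_derivative f') (at z) \<and> (\<forall>c v. f' (c *s v) = c * f' v)"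
      unfolding holomorphic_Cn_on_def by blast
  qed
qed

subsection \<open>Growth of circle averages on the disc\<close>

lemma continuous_on_polar:
  assumes "continuous_on (ball 0 \<rho>) f" "\<And>x. x \<in> S \<Longrightarrow> \<bar>r x\<bar> < \<rho>" "continuous_on S r" "continuous_on S t"
  shows "continuous_on S (\<lambda>x. f (complex_of_real (r x) * cis (t x)))"
  using assms(2) by (intro continuous_on_compose2[OF assms(1)] continuous_intros assms(3,4) continuous_on_cis) (auto simp: norm_mult)

text \<open>Green's theorem in differentiated form. A real form a dx + b dy is encoded as
  \<open>c\<close> = a - i b, so the integrand is its pullback to the circle of radius
  \<open>r\<close>, and - Im (c_x + i c_y) is its curl b_x - a_y.\<close>

lemma circle_integral_deriv:
  fixes c :: "complex \<Rightarrow> complex"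
  assumes c: "\<And>z. z \<in> ball 0 \<rho> \<Longrightarrow> (c has_derivative c' z) (at z)"
    and c1: "continuous_on (ball 0 \<rho>) (\<lambda>z. c' z 1)" and ci: "continuous_on (ball 0 \<rho>) (\<lambda>z. c' z \<i>)"
    and r0: "\<bar>r0\<bar> < \<rho>"
  shows "((\<lambda>r. integral {0..2*pi} (\<lambda>\<theta>. Re (c (of_real r * cis \<theta>) * (\<i> * (of_real r * cis \<theta>)))))
    has_real_derivative integral {0..2*pi} (\<lambda>\<theta>. - r0 * Im (c' (of_real r0 * cis \<theta>) 1 + \<i> * c' (of_real r0 * cis \<theta>) \<i>)))
    (at r0)"
proof -
  let ?U = "{-\<rho><..<\<rho>}" and ?I = "{0..2*pi}"
  let ?z = "\<lambda>r \<theta>. complex_of_real r * cis \<theta>"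
  have in_ball: "?z r \<theta> \<in> ball 0 \<rho>" if "\<bar>r\<bar> < \<rho>" for r \<theta> using that by (simp add: norm_mult)
  have cc: "continuous_on (ball 0 \<rho>) c"
    using c by (meson continuous_at_imp_continuous_on has_derivative_continuous)
  have lin: "c' z v = of_real (Re v) * c' z 1 + of_real (Im v) * c' z \<i>" if "z \<in> ball 0 \<rho>" for z v
  proof -
    have "linear (c' z)" using c[OF that] has_derivative_linear by blast
    moreover have "v = Re v *\<^sub>R 1 + Im v *\<^sub>R \<i>" by (simp add: complex_eq_iff)
    ultimately have "c' z v = Re v *\<^sub>R c' z 1 + Im v *\<^sub>R c' z \<i>"
      by (metis linear_add linear_cmul)
    then show ?thesis by (simp add: scaleR_conv_of_real)
  qed
  define f where "f r \<theta> = Re (c (?z r \<theta>) * (\<i> * ?z r \<theta>))" for r \<theta>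
  define fx where "fx r \<theta> = Re ((of_real (cos \<theta>) * c' (?z r \<theta>) 1 + of_real (sin \<theta>) * c' (?z r \<theta>) \<i>) * (\<i> * ?z r \<theta>)
      + c (?z r \<theta>) * (\<i> * cis \<theta>))" for r \<theta>
  have dz: "((\<lambda>r. ?z r \<theta>) has_derivative (\<lambda>h. of_real h * cis \<theta>)) (at r within S)" for r \<theta> S
    by (auto intro!: derivative_eq_intros)
  have fx: "((\<lambda>r. f r \<theta>) has_field_derivative fx r \<theta>) (at r within ?U)" if "r \<in> ?U" for r \<theta>
  proof -
    have b: "?z r \<theta> \<in> ball 0 \<rho>" using that by (intro in_ball) auto
    have "((\<lambda>r. c (?z r \<theta>)) has_derivative (\<lambda>h. c' (?z r \<theta>) (of_real h * cis \<theta>))) (at r within ?U)"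
      by (rule has_derivative_compose[OF dz c[OF b]])
    then have "((\<lambda>r. c (?z r \<theta>)) has_derivative (\<lambda>h. of_real h * (of_real (cos \<theta>) * c' (?z r \<theta>) 1 + of_real (sin \<theta>) * c' (?z r \<theta>) \<i>))) (at r within ?U)"
      by (rule has_derivative_eq_rhs) (intro ext, subst lin[OF b], simp add: algebra_simps)
    then have "((\<lambda>r. f r \<theta>) has_derivative (\<lambda>h. Re (of_real h * (of_real (cos \<theta>) * c' (?z r \<theta>) 1 + of_real (sin \<theta>) * c' (?z r \<theta>) \<i>) * (\<i> * ?z r \<theta>)
        + c (?z r \<theta>) * (\<i> * (of_real h * cis \<theta>))))) (at r within ?U)"
      unfolding f_def by (auto intro!: derivative_eq_intros dz simp: algebra_simps)
    then show ?thesis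
      unfolding has_field_derivative_def fx_def
      by (rule has_derivative_eq_rhs) (auto simp: fun_eq_iff algebra_simps)
  qed
  have "((\<lambda>r. integral (cbox 0 (2*pi)) (f r)) has_field_derivative integral (cbox 0 (2*pi)) (fx r0)) (at r0 within ?U)"
  proof (rule leibniz_rule_field_derivative[OF fx])
    show "f r integrable_on cbox 0 (2 * pi)" if "r \<in> ?U" for r
      unfolding f_def using that
      by (intro integrable_continuous continuous_intros continuous_on_polar[OF cc]) auto
    show "continuous_on (?U \<times> cbox 0 (2 * pi)) (\<lambda>(x, t). fx x t)"
      unfolding fx_def split_def
      by (intro continuous_intros continuous_on_polar[OF cc] continuous_on_polar[OF c1] continuous_on_polar[OF ci]) auto
  qed (use r0 in auto)
  moreover have "integral (cbox 0 (2*pi)) (fx r0)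
      = integral ?I (\<lambda>\<theta>. - r0 * Im (c' (?z r0 \<theta>) 1 + \<i> * c' (?z r0 \<theta>) \<i>))" (is "_ = integral ?I ?h")
  proof -
    \<comment> \<open>\<open>g\<close> is the radial component of the form. The derivative of the
      integrand in \<open>r\<close> exceeds the curl term by the derivative of \<open>g\<close> in
      \<open>\<theta>\<close>, which integrates to 0 over a period.\<close>
    define g where "g \<theta> = Re (c (?z r0 \<theta>) * cis \<theta>)" for \<theta>
    have dcis: "((\<lambda>\<theta>. cis \<theta>) has_derivative (\<lambda>h. of_real h * (\<i> * cis \<theta>))) (at \<theta> within S)" for \<theta> S
    proof -
      have "((\<lambda>\<theta>. of_real (cos \<theta>) + \<i> * of_real (sin \<theta>)) has_derivative (\<lambda>h. of_real h * (\<i> * cis \<theta>))) (at \<theta> within S)"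
        by (auto intro!: derivative_eq_intros simp: complex_eq_iff)
      moreover have "cis = (\<lambda>\<theta>. of_real (cos \<theta>) + \<i> * of_real (sin \<theta>))"
        by (auto simp: complex_eq_iff)
      ultimately show ?thesis by simp
    qed
    have dt: "((\<lambda>\<theta>. ?z r0 \<theta>) has_derivative (\<lambda>h. of_real h * (\<i> * ?z r0 \<theta>))) (at \<theta> within S)" for \<theta> S
    proof -
      have "((\<lambda>\<theta>. cis \<theta>) has_derivative (\<lambda>h. of_real h * (\<i> * cis \<theta>))) (at \<theta> within S)" by (rule dcis)
      then show ?thesis by (auto intro!: derivative_eq_intros simp: algebra_simps scaleR_conv_of_real)
    qed
    have "(g has_vector_derivative fx r0 \<theta> - ?h \<theta>) (at \<theta> within ?I)" for \<theta>
    proof -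
      have b: "?z r0 \<theta> \<in> ball 0 \<rho>" by (rule in_ball[OF r0])
      have "((\<lambda>\<theta>. c (?z r0 \<theta>)) has_derivative (\<lambda>h. c' (?z r0 \<theta>) (of_real h * (\<i> * ?z r0 \<theta>)))) (at \<theta> within ?I)"
        by (rule has_derivative_compose[OF dt c[OF b]])
      then have "((\<lambda>\<theta>. c (?z r0 \<theta>)) has_derivative (\<lambda>h. of_real h * (of_real (- r0 * sin \<theta>) * c' (?z r0 \<theta>) 1 + of_real (r0 * cos \<theta>) * c' (?z r0 \<theta>) \<i>))) (at \<theta> within ?I)"
        by (rule has_derivative_eq_rhs) (intro ext, subst lin[OF b], simp add: algebra_simps)
      then have "(g has_derivative (\<lambda>h. Re (of_real h * (of_real (- r0 * sin \<theta>) * c' (?z r0 \<theta>) 1 + of_real (r0 * cos \<theta>) * c' (?z r0 \<theta>) \<i>) * cis \<theta>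
         + c (?z r0 \<theta>) * (of_real h * (\<i> * cis \<theta>))))) (at \<theta> within ?I)"
        unfolding g_def by (auto intro!: derivative_eq_intros dcis simp: algebra_simps)
      moreover have "Re (of_real h * (of_real (- r0 * sin \<theta>) * c' (?z r0 \<theta>) 1 + of_real (r0 * cos \<theta>) * c' (?z r0 \<theta>) \<i>) * cis \<theta>
         + c (?z r0 \<theta>) * (of_real h * (\<i> * cis \<theta>))) = h *\<^sub>R (fx r0 \<theta> - ?h \<theta>)" for h
      proof -
        have s: "sin \<theta> * sin \<theta> = 1 - cos \<theta> * cos \<theta>" using sin_cos_squared_add[of \<theta>] by (simp add: power2_eq_square algebra_simps)
        obtain a1 b1 where 1: "c' (?z r0 \<theta>) 1 = Complex a1 b1" using complex.exhaust by blast
        obtain a2 b2 where 2: "c' (?z r0 \<theta>) \<i> = Complex a2 b2" using complex.exhaust by blast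
        obtain a3 b3 where 3: "c (?z r0 \<theta>) = Complex a3 b3" using complex.exhaust by blast
        show ?thesis unfolding fx_def 1 2 3
          by (simp add: algebra_simps) (use s in algebra)
      qed
      ultimately show ?thesis by (simp add: has_vector_derivative_def)
    qed
    then have "((\<lambda>\<theta>. fx r0 \<theta> - ?h \<theta>) has_integral g (2*pi) - g 0) ?I"
      by (intro fundamental_theorem_of_calculus) auto
    then have "integral ?I (\<lambda>\<theta>. fx r0 \<theta> - ?h \<theta>) = 0"
      by (simp add: g_def integral_unique)
    moreover have "integral ?I (\<lambda>\<theta>. fx r0 \<theta> - ?h \<theta>) = integral ?I (fx r0) - integral ?I ?h"
      unfolding fx_def using r0
      by (intro Henstock_Kurzweil_Integration.integral_diff integrable_continuous_interval continuous_intros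
          continuous_on_polar[OF cc] continuous_on_polar[OF c1] continuous_on_polar[OF ci]) auto
    ultimately show ?thesis by simp
  qed
  moreover have "at r0 within ?U = at r0" using r0 by (intro at_within_open) auto
  ultimately show ?thesis
    unfolding f_def by (simp only: box_real)
qed

text \<open>Nonnegativity of the variance of \<open>u\<close> about its mean
  \<open>M\<close>.\<close>

lemma integral_square_le:
  fixes u :: "real \<Rightarrow> real"
  assumes ab: "a < b" and u: "continuous_on {a..b} u"
  shows "(integral {a..b} u)\<^sup>2 \<le> (b - a) * integral {a..b} (\<lambda>x. (u x)\<^sup>2)"
proof -
  define M where "M = integral {a..b} u / (b - a)"
  have [simp]: "u integrable_on {a..b}" "(\<lambda>x. (u x)\<^sup>2) integrable_on {a..b}"
    by (auto intro!: integrable_continuous_interval continuous_intros u)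
  have "0 \<le> integral {a..b} (\<lambda>x. (u x - M)\<^sup>2)"
    by (intro integral_nonneg) (auto intro!: integrable_continuous_interval continuous_intros u)
  also have "\<dots> = integral {a..b} (\<lambda>x. (u x)\<^sup>2 - (2 * M * u x - M\<^sup>2))"
    by (simp add: power2_diff algebra_simps)
  also have "\<dots> = integral {a..b} (\<lambda>x. (u x)\<^sup>2) - (integral {a..b} (\<lambda>x. 2 * M * u x) - integral {a..b} (\<lambda>x. M\<^sup>2))"
    by (subst Henstock_Kurzweil_Integration.integral_diff Henstock_Kurzweil_Integration.integral_diff,
        auto intro!: integrable_continuous_interval continuous_intros u)+
  also have "\<dots> = integral {a..b} (\<lambda>x. (u x)\<^sup>2) - (integral {a..b} u)\<^sup>2 / (b - a)"
  proof -
    have I: "integral {a..b} u = M * (b - a)" using ab by (simp add: M_def)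
    have e: "(M * (b - a))\<^sup>2 / (b - a) = M * M * (b - a)" using ab by (simp add: power2_eq_square)
    show ?thesis unfolding I e using ab by (simp add: I power2_eq_square algebra_simps)
  qed
  finally show ?thesis using ab by (simp add: field_simps)
qed

text \<open>Where \<open>A\<close> is positive, the hypothesis says that the derivative of - 1 / A
  is at least 1 / (k x). So - 1 / A - ln x / k is nondecreasing; it is compared at \<open>r\<close>
  and \<open>s\<close>, and the positive term 1 / A(s) is dropped.\<close>

lemma log_decay_of_square_le:
  fixes A :: "real \<Rightarrow> real"
  assumes A: "\<And>r. 0 < r \<Longrightarrow> r < \<rho> \<Longrightarrow> (A has_real_derivative A' r) (at r)"
    and mono: "\<And>r. 0 < r \<Longrightarrow> r < \<rho> \<Longrightarrow> 0 \<le> A' r"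
    and sq: "\<And>r. 0 < r \<Longrightarrow> r < \<rho> \<Longrightarrow> (A r)\<^sup>2 \<le> k * r * A' r"
    and k: "k > 0" and r: "0 < r" "r < s" "s < \<rho>"
  shows "A r * ln (s / r) \<le> k"
proof (cases "A r > 0")
  case False
  then have "A r * ln (s / r) \<le> 0" using r by (intro mult_nonpos_nonneg) auto
  then show ?thesis using k by simp
next
  case True
  have pos: "A x > 0" if x: "r \<le> x" "x \<le> s" for x
  proof -
    have "A r \<le> A x"
    proof (rule DERIV_nonneg_imp_nondecreasing[OF x(1)])
      fix y assume "r \<le> y" "y \<le> x"
      then have "0 < y" "y < \<rho>" using r x by auto
      then show "\<exists>d. DERIV A y :> d \<and> 0 \<le> d" using A mono by blast
    qed
    with True show ?thesis by simp
  qed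
  have "- (1 / A r) - ln r / k \<le> - (1 / A s) - ln s / k"
  proof (rule DERIV_nonneg_imp_nondecreasing[of r s "\<lambda>x. - (1 / A x) - ln x / k"])
    fix x assume x: "r \<le> x" "x \<le> s"
    then have x': "0 < x" "x < \<rho>" "A x > 0" using r pos by auto
    have "((\<lambda>x. - (1 / A x) - ln x / k) has_real_derivative A' x / (A x)\<^sup>2 - 1 / x / k) (at x)"
      using x' k by (auto intro!: derivative_eq_intros A simp: power2_eq_square)
    moreover have "1 / x / k \<le> A' x / (A x)\<^sup>2"
      using sq[OF x'(1,2)] x' k by (simp add: field_simps)
    ultimately show "\<exists>d. DERIV (\<lambda>x. - (1 / A x) - ln x / k) x :> d \<and> 0 \<le> d" by force
  qed (use r in auto)
  moreover have "1 / A s > 0" using pos[of s] r by simp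
  ultimately have "(ln s - ln r) / k \<le> 1 / A r" unfolding diff_divide_distrib by linarith
  then show ?thesis using True k r by (simp add: ln_div field_simps)
qed

text \<open>Inserting the decay of \<open>A\<close> into the formula for the derivative of
  \<open>m\<close> bounds it by 2 k / (x ln (s / x)), the derivative of - 2 k ln (ln (s / x)). An
  outer radius \<open>s\<close> strictly beyond \<open>R\<close> keeps ln (s / x) positive up to
  \<open>R\<close>.\<close>

lemma loglog_growth_of_square_le:
  fixes A m :: "real \<Rightarrow> real"
  assumes A: "\<And>r. 0 < r \<Longrightarrow> r < \<rho> \<Longrightarrow> (A has_real_derivative A' r) (at r)"
    and mono: "\<And>r. 0 < r \<Longrightarrow> r < \<rho> \<Longrightarrow> 0 \<le> A' r"
    and sq: "\<And>r. 0 < r \<Longrightarrow> r < \<rho> \<Longrightarrow> (A r)\<^sup>2 \<le> k * r * A' r"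
    and m: "\<And>r. 0 < r \<Longrightarrow> r < \<rho> \<Longrightarrow> (m has_real_derivative 2 * A r / r) (at r)"
    and k: "k > 0" and r: "0 < r" "r < R" "R < s" "s < \<rho>"
  shows "m R - m r \<le> 2 * k * (ln (ln (s / r)) - ln (ln (s / R)))"
proof -
  have "m R + 2 * k * ln (ln (s / R)) \<le> m r + 2 * k * ln (ln (s / r))"
  proof (rule DERIV_nonpos_imp_nonincreasing[of r R "\<lambda>x. m x + 2 * k * ln (ln (s / x))"])
    fix x assume x: "r \<le> x" "x \<le> R"
    then have x': "0 < x" "x < s" "x < \<rho>" using r by auto
    have l: "ln (s / x) > 0" using x' by simp
    have "((\<lambda>x. m x + 2 * k * ln (ln (s / x))) has_real_derivative 2 * A x / x + 2 * k * (- (1 / x) / ln (s / x))) (at x)"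
      using x' l by (auto intro!: derivative_eq_intros m simp: field_simps power2_eq_square)
    moreover have "2 * A x / x + 2 * k * (- (1 / x) / ln (s / x)) = 2 / x * (A x - k / ln (s / x))"
      using x' l by (simp add: field_simps)
    moreover have "A x \<le> k / ln (s / x)"
      using log_decay_of_square_le[OF A mono sq k x'(1,2) r(4)] l by (simp add: field_simps)
    ultimately show "\<exists>d. DERIV (\<lambda>x. m x + 2 * k * ln (ln (s / x))) x :> d \<and> d \<le> 0"
      using x' by (smt (verit, ccfv_SIG) divide_pos_pos mult_nonneg_nonpos)
  qed (use r in auto)
  then show ?thesis by (simp add: algebra_simps)
qed

text \<open>Two forms with the same curl \<open>\<kappa>\<close> have different tasks:
  \<open>c\<close> encodes the primitive, which satisfies a pointwise bound, and \<open>d\<close>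
  encodes the form taking v to - d\<phi>(i v) / 2, whose circle integrals are governed by the radial
  derivative of the means of \<open>\<phi>\<close>. Both circle integrals have the same derivative
  in the radius and vanish at radius 0, hence they coincide.\<close>

lemma disc_mean_growth:
  fixes c c0 :: "complex \<Rightarrow> complex" and \<phi> :: "complex \<Rightarrow> real"
  assumes c: "\<And>z. z \<in> ball 0 \<rho> \<Longrightarrow> (c has_derivative c' z) (at z)"
    and c1: "continuous_on (ball 0 \<rho>) (\<lambda>z. c' z 1)" and ci: "continuous_on (ball 0 \<rho>) (\<lambda>z. c' z \<i>)"
    and d: "\<And>z. z \<in> ball 0 \<rho> \<Longrightarrow> (d has_derivative d' z) (at z)"
    and d1: "continuous_on (ball 0 \<rho>) (\<lambda>z. d' z 1)" and di: "continuous_on (ball 0 \<rho>) (\<lambda>z. d' z \<i>)"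
    and cd: "\<And>z. z \<in> ball 0 \<rho> \<Longrightarrow> Im (c' z 1 + \<i> * c' z \<i>) = - \<kappa> z"
      "\<And>z. z \<in> ball 0 \<rho> \<Longrightarrow> Im (d' z 1 + \<i> * d' z \<i>) = - \<kappa> z"
    and \<kappa>: "\<And>z. z \<in> ball 0 \<rho> \<Longrightarrow> 0 \<le> \<kappa> z"
    and bd: "\<And>z v. z \<in> ball 0 \<rho> \<Longrightarrow> \<bar>Re (c z * v)\<bar> \<le> C * cmod v * sqrt (\<kappa> z)"
    and \<phi>: "\<And>z. z \<in> ball 0 \<rho> \<Longrightarrow> (\<phi> has_derivative (\<lambda>v. 2 * Re (\<i> * d z * v))) (at z)"
    and C: "C > 0" and r: "0 < r" "r < R" "R < s" "s < \<rho>"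
  shows "integral {0..2*pi} (\<lambda>\<theta>. \<phi> (of_real R * cis \<theta>)) - integral {0..2*pi} (\<lambda>\<theta>. \<phi> (of_real r * cis \<theta>))
    \<le> 4 * pi * C\<^sup>2 * (ln (ln (s / r)) - ln (ln (s / R)))"
proof -
  let ?I = "{0..2*pi}" and ?z = "\<lambda>r \<theta>. complex_of_real r * cis \<theta>"
  have in_ball: "?z r \<theta> \<in> ball 0 \<rho>" if "\<bar>r\<bar> < \<rho>" for r \<theta> using that by (simp add: norm_mult)
  define A where "A r = integral ?I (\<lambda>\<theta>. Re (c (?z r \<theta>) * (\<i> * ?z r \<theta>)))" for r
  define D where "D r = integral ?I (\<lambda>\<theta>. Re (d (?z r \<theta>) * (\<i> * ?z r \<theta>)))" for r
  define A' where "A' r = r * integral ?I (\<lambda>\<theta>. \<kappa> (?z r \<theta>))" for r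
  define m where "m r = integral ?I (\<lambda>\<theta>. \<phi> (?z r \<theta>))" for r
  have cc: "continuous_on (ball 0 \<rho>) c" and dc: "continuous_on (ball 0 \<rho>) d" and \<phi>c: "continuous_on (ball 0 \<rho>) \<phi>"
    using c d \<phi> by (meson continuous_at_imp_continuous_on has_derivative_continuous)+
  have \<kappa>c: "continuous_on (ball 0 \<rho>) \<kappa>"
  proof -
    have "continuous_on (ball 0 \<rho>) (\<lambda>z. - Im (c' z 1 + \<i> * c' z \<i>))" by (intro continuous_intros c1 ci)
    then show ?thesis by (rule continuous_on_eq) (simp only: cd minus_minus)
  qed
  have A: "(A has_real_derivative A' r) (at r)" if r: "\<bar>r\<bar> < \<rho>" for r
  proof -
    have "(A has_real_derivative integral ?I (\<lambda>\<theta>. - r * Im (c' (?z r \<theta>) 1 + \<i> * c' (?z r \<theta>) \<i>))) (at r)"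
      unfolding A_def by (rule circle_integral_deriv[OF c c1 ci r])
    also have "integral ?I (\<lambda>\<theta>. - r * Im (c' (?z r \<theta>) 1 + \<i> * c' (?z r \<theta>) \<i>)) = A' r"
      unfolding A'_def cd(1)[OF in_ball[OF r]] by simp
    finally show ?thesis .
  qed
  have D: "(D has_real_derivative A' r) (at r)" if r: "\<bar>r\<bar> < \<rho>" for r
  proof -
    have "(D has_real_derivative integral ?I (\<lambda>\<theta>. - r * Im (d' (?z r \<theta>) 1 + \<i> * d' (?z r \<theta>) \<i>))) (at r)"
      unfolding D_def by (rule circle_integral_deriv[OF d d1 di r])
    also have "integral ?I (\<lambda>\<theta>. - r * Im (d' (?z r \<theta>) 1 + \<i> * d' (?z r \<theta>) \<i>)) = A' r"
      unfolding A'_def cd(2)[OF in_ball[OF r]] by simp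
    finally show ?thesis .
  qed
  have AD: "A r = D r" if r: "0 < r" "r < \<rho>" for r
  proof -
    have "A r - D r = A 0 - D 0"
    proof (rule DERIV_isconst2[of 0 r "\<lambda>x. A x - D x"])
      have *: "((\<lambda>x. A x - D x) has_real_derivative 0) (at x)" if "\<bar>x\<bar> < \<rho>" for x
        using DERIV_diff[OF A[OF that] D[OF that]] by simp
      show "continuous_on {0..r} (\<lambda>x. A x - D x)"
        using r by (intro continuous_at_imp_continuous_on ballI DERIV_isCont[OF *]) auto
      show "((\<lambda>x. A x - D x) has_real_derivative 0) (at x)" if "0 < x" "x < r" for x
        using that r by (intro *) auto
    qed (use r in auto)
    then show ?thesis by (simp add: A_def D_def)
  qed
  have A'0: "0 \<le> A' r" if "0 < r" "r < \<rho>" for r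
    unfolding A'_def using that
    by (intro mult_nonneg_nonneg integral_nonneg \<kappa> in_ball integrable_continuous_interval continuous_on_polar[OF \<kappa>c] continuous_intros) auto
  have sq: "(A r)\<^sup>2 \<le> (2 * pi * C\<^sup>2) * r * A' r" if r: "0 < r" "r < \<rho>" for r
  proof -
    have sc: "continuous_on ?I (\<lambda>\<theta>. sqrt (\<kappa> (?z r \<theta>)))"
      using r by (intro continuous_intros continuous_on_polar[OF \<kappa>c]) auto
    have "norm (A r) \<le> integral ?I (\<lambda>\<theta>. C * r * sqrt (\<kappa> (?z r \<theta>)))"
      unfolding A_def
    proof (rule integral_norm_bound_integral)
      show "(\<lambda>\<theta>. Re (c (?z r \<theta>) * (\<i> * ?z r \<theta>))) integrable_on ?I"
        using r by (intro integrable_continuous_interval continuous_intros continuous_on_polar[OF cc]) auto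
      show "(\<lambda>\<theta>. C * r * sqrt (\<kappa> (?z r \<theta>))) integrable_on ?I"
        by (intro integrable_continuous_interval continuous_intros sc)
      show "norm (Re (c (?z r \<theta>) * (\<i> * ?z r \<theta>))) \<le> C * r * sqrt (\<kappa> (?z r \<theta>))" for \<theta>
        using bd[OF in_ball, of r \<theta> "\<i> * ?z r \<theta>"] r by (simp add: norm_mult)
    qed
    then have "\<bar>A r\<bar> \<le> C * r * integral ?I (\<lambda>\<theta>. sqrt (\<kappa> (?z r \<theta>)))" by simp
    then have "(A r)\<^sup>2 \<le> (C * r * integral ?I (\<lambda>\<theta>. sqrt (\<kappa> (?z r \<theta>))))\<^sup>2" by (metis abs_ge_zero power2_abs power_mono)
    also have "\<dots> = (C * r)\<^sup>2 * (integral ?I (\<lambda>\<theta>. sqrt (\<kappa> (?z r \<theta>))))\<^sup>2" by (simp add: power_mult_distrib)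
    also have "\<dots> \<le> (C * r)\<^sup>2 * ((2 * pi - 0) * integral ?I (\<lambda>\<theta>. (sqrt (\<kappa> (?z r \<theta>)))\<^sup>2))"
      by (intro mult_left_mono integral_square_le sc) auto
    also have "integral ?I (\<lambda>\<theta>. (sqrt (\<kappa> (?z r \<theta>)))\<^sup>2) = integral ?I (\<lambda>\<theta>. \<kappa> (?z r \<theta>))"
      using r by (intro integral_cong real_sqrt_pow2 \<kappa> in_ball) auto
    finally show ?thesis by (simp add: A'_def power2_eq_square algebra_simps)
  qed
  have m: "(m has_real_derivative 2 * A r / r) (at r)" if r: "0 < r" "r < \<rho>" for r
  proof -
    let ?U = "{0<..<\<rho>}"
    have "((\<lambda>r. integral (cbox 0 (2*pi)) (\<lambda>\<theta>. \<phi> (?z r \<theta>))) has_field_derivative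
        integral (cbox 0 (2*pi)) (\<lambda>\<theta>. 2 * Re (\<i> * d (?z r \<theta>) * cis \<theta>))) (at r within ?U)"
    proof (rule leibniz_rule_field_derivative)
      fix x t assume x: "x \<in> ?U"
      have "((\<lambda>r. ?z r t) has_derivative (\<lambda>h. of_real h * cis t)) (at x within ?U)"
        by (auto intro!: derivative_eq_intros)
      from has_derivative_compose[OF this \<phi>[OF in_ball]]
      show "((\<lambda>x. \<phi> (?z x t)) has_field_derivative 2 * Re (\<i> * d (?z x t) * cis t)) (at x within ?U)"
        unfolding has_field_derivative_def using x
        by (auto elim!: has_derivative_eq_rhs simp: algebra_simps fun_eq_iff)
    next
      show "(\<lambda>\<theta>. \<phi> (?z x \<theta>)) integrable_on cbox 0 (2 * pi)" if "x \<in> ?U" for x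
        using that by (intro integrable_continuous continuous_on_polar[OF \<phi>c] continuous_intros) auto
      show "continuous_on (?U \<times> cbox 0 (2 * pi)) (\<lambda>(x, t). 2 * Re (\<i> * d (?z x t) * cis t))"
        unfolding split_def by (intro continuous_intros continuous_on_polar[OF dc]) auto
    qed (use r in auto)
    moreover have "integral (cbox 0 (2*pi)) (\<lambda>\<theta>. 2 * Re (\<i> * d (?z r \<theta>) * cis \<theta>)) = 2 * D r / r"
    proof -
      have "2 * D r / r = integral ?I (\<lambda>\<theta>. 2 / r * Re (d (?z r \<theta>) * (\<i> * ?z r \<theta>)))"
        unfolding D_def by (subst integral_mult_right) simp
      also have "\<dots> = integral ?I (\<lambda>\<theta>. 2 * Re (\<i> * d (?z r \<theta>) * cis \<theta>))"
        using r by (intro integral_cong) (simp add: field_simps)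
      finally show ?thesis by simp
    qed
    moreover have "at r within ?U = at r" using r by (intro at_within_open) auto
    ultimately show ?thesis unfolding m_def AD[OF r] by (simp only: box_real)
  qed
  have "m R - m r \<le> 2 * (2 * pi * C\<^sup>2) * (ln (ln (s / r)) - ln (ln (s / R)))"
    by (rule loglog_growth_of_square_le[OF A A'0 sq m _ r]) (use C in auto)
  then show ?thesis by (simp add: m_def)
qed

subsection \<open>The Bergman kernel\<close>

lemma mean_value_circle:
  assumes g: "g holomorphic_on cball 0 r" and r: "r > 0"
  shows "((\<lambda>x. g (of_real r * cis (2 * pi * x))) has_integral g 0) {0..1}"
proof -
  have "((\<lambda>u. g u / (u - 0)) has_contour_integral (2 * of_real pi * \<i> * g 0)) (circlepath 0 r)"
    using g r by (intro Cauchy_integral_circlepath_simple) auto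
  then have *: "((\<lambda>x. g (circlepath 0 r x) / circlepath 0 r x * vector_derivative (circlepath 0 r) (at x within {0..1}))
      has_integral (2 * of_real pi * \<i> * g 0)) {0..1}"
    by (simp add: has_contour_integral_def)
  have e: "exp (2 * of_real pi * \<i> * of_real x) = cis (2 * pi * x)" for x
    by (simp add: cis_conv_exp mult_ac)
  have "((\<lambda>x. 2 * of_real pi * \<i> * g (of_real r * cis (2 * pi * x))) has_integral (2 * of_real pi * \<i> * g 0)) {0..1}"
  proof (rule has_integral_eq[OF _ *])
    fix x :: real assume x: "x \<in> {0..1}"
    have v: "vector_derivative (circlepath 0 r) (at x within {0..1}) = 2 * of_real pi * \<i> * of_real r * exp (2 * of_real pi * \<i> * of_real x)"
      using x vector_derivative_circlepath01[of x 0 r] by simp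
    have p: "circlepath 0 r x = of_real r * cis (2 * pi * x)" by (simp add: circlepath e)
    show "g (circlepath 0 r x) / circlepath 0 r x * vector_derivative (circlepath 0 r) (at x within {0..1})
        = 2 * of_real pi * \<i> * g (of_real r * cis (2 * pi * x))"
      unfolding v p e using r by simp
  qed
  from has_integral_mult_right[OF this, of "1 / (2 * of_real pi * \<i>)"] show ?thesis by simp
qed

lemma holomorphic_mean_le_nn_integral:
  assumes g: "g holomorphic_on cball 0 1"
  shows "ennreal (cmod (g 0)) \<le> (\<integral>\<^sup>+x. indicator {0..1} x * ennreal (cmod (g (cis (2 * pi * x)))) \<partial>lborel)"
proof -
  have c: "continuous_on {0..1} (\<lambda>x::real. g (cis (2 * pi * x)))"
    by (rule continuous_on_compose2[OF holomorphic_on_imp_continuous_on[OF g]]) (auto intro!: continuous_intros continuous_on_cis)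
  then have si: "set_integrable lborel {0..1} (\<lambda>x::real. g (cis (2 * pi * x)))"
    by (rule borel_integrable_atLeastAtMost')
  have "g 0 = (LINT x:{0..1}|lborel. g (cis (2 * pi * x)))"
    using set_borel_integral_eq_integral(2)[OF si] mean_value_circle[OF g] by (simp add: integral_unique)
  then have "ennreal (cmod (g 0)) \<le> (\<integral>\<^sup>+x. ennreal (cmod (indicator {0..1} x *\<^sub>R g (cis (2 * pi * x)))) \<partial>lborel)"
    using integral_norm_bound_ennreal[OF si[unfolded set_integrable_def]] by (simp add: set_lebesgue_integral_def)
  also have "\<dots> = (\<integral>\<^sup>+x. indicator {0..1} x * ennreal (cmod (g (cis (2 * pi * x)))) \<partial>lborel)"
    by (intro nn_integral_cong) (auto simp: indicator_def)
  finally show ?thesis .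
qed

text \<open>The condition under which the circle mean value property can be averaged over
  \<open>E\<close>. It covers balls as well as regions with different sizes in normal and tangential
  directions, which give the right exponent in the upper bound for the kernel.\<close>

definition balanced :: "(complex^'n) set \<Rightarrow> bool" where
  "balanced E \<longleftrightarrow> (\<forall>c. \<forall>v\<in>E. cmod c \<le> 1 \<longrightarrow> c *s v \<in> E)"

section \<open>The Bergman space of a bounded open set\<close>

locale bounded_open_set =
  fixes \<Omega> :: "(complex^'n) set"
  assumes open_domain: "open \<Omega>" and bounded_domain: "bounded \<Omega>"
begin

definition sqn :: "(complex^'n \<Rightarrow> complex) \<Rightarrow> real" where
  "sqn f = set_lebesgue_integral lborel \<Omega> (\<lambda>z. (cmod (f z))\<^sup>2)"

definition ip :: "(complex^'n \<Rightarrow> complex) \<Rightarrow> (complex^'n \<Rightarrow> complex) \<Rightarrow> complex" where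
  "ip f g = set_lebesgue_integral lborel \<Omega> (\<lambda>z. f z * cnj (g z))"

lemma sets_domain [measurable]: "\<Omega> \<in> sets borel"
  using open_domain by simp

lemma bergmanD:
  assumes "f \<in> bergman_space \<Omega>"
  shows "holomorphic_Cn_on \<Omega> f" "set_integrable lborel \<Omega> (\<lambda>z. (cmod (f z))\<^sup>2)"
  using assms by (auto simp: bergman_space_def)

lemma meas_indicator:
  assumes "holomorphic_Cn_on \<Omega> f"
  shows "(\<lambda>z. indicator \<Omega> z *\<^sub>R f z) \<in> borel_measurable borel"
  using holomorphic_Cn_on_continuous[OF assms] by (intro borel_measurable_continuous_on_indicator) auto

lemma sqn_nonneg: "0 \<le> sqn f"
  unfolding sqn_def set_lebesgue_integral_def by (intro Bochner_Integration.integral_nonneg) simp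

lemma nn_integral_sqn:
  assumes "f \<in> bergman_space \<Omega>"
  shows "(\<integral>\<^sup>+z. indicator \<Omega> z * ennreal ((cmod (f z))\<^sup>2) \<partial>lborel) = ennreal (sqn f)"
proof -
  have "(\<integral>\<^sup>+z. ennreal (indicator \<Omega> z *\<^sub>R (cmod (f z))\<^sup>2) \<partial>lborel) = ennreal (sqn f)"
    unfolding sqn_def set_lebesgue_integral_def
    by (rule nn_integral_eq_integral) (use bergmanD(2)[OF assms] in \<open>auto simp: set_integrable_def\<close>)
  also have "(\<integral>\<^sup>+z. ennreal (indicator \<Omega> z *\<^sub>R (cmod (f z))\<^sup>2) \<partial>lborel) = (\<integral>\<^sup>+z. indicator \<Omega> z * ennreal ((cmod (f z))\<^sup>2) \<partial>lborel)"
    by (intro nn_integral_cong) (auto simp: indicator_def)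
  finally show ?thesis .
qed

text \<open>Since \<open>\<Omega>\<close> is open, derivatives at its points ignore values outside.
  This is applied to reproducing functions truncated to 0 off \<open>\<Omega>\<close>, the
  normalisation built into \<open>bergman_kernel\<close>.\<close>

lemma bergman_cong:
  assumes f: "f \<in> bergman_space \<Omega>" and eq: "\<And>z. z \<in> \<Omega> \<Longrightarrow> g z = f z"
  shows "g \<in> bergman_space \<Omega>"
proof -
  have "(g has_derivative fd f z) (at z)" if "z \<in> \<Omega>" for z
    using has_derivative_transform_within_open[OF holomorphic_Cn_fd(1)[OF bergmanD(1)[OF f] that] open_domain that] eq by metis
  then have "holomorphic_Cn_on \<Omega> g"
    by (rule holomorphic_Cn_onI) (auto simp: holomorphic_Cn_fd(2)[OF bergmanD(1)[OF f]])
  moreover have "set_integrable lborel \<Omega> (\<lambda>z. (cmod (g z))\<^sup>2)"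
    using bergmanD(2)[OF f] by (rule set_integrable_cong[OF refl refl, THEN iffD2, rotated]) (simp add: eq)
  ultimately show ?thesis by (simp add: bergman_space_def)
qed

lemma meas_sq:
  assumes "holomorphic_Cn_on \<Omega> f"
  shows "(\<lambda>z. indicator \<Omega> z * ennreal ((cmod (f z))\<^sup>2)) \<in> borel_measurable borel"
proof -
  note [measurable] = meas_indicator[OF assms]
  have "(\<lambda>z. ennreal ((cmod (indicator \<Omega> z *\<^sub>R f z))\<^sup>2)) \<in> borel_measurable borel" by measurable
  also have "(\<lambda>z. ennreal ((cmod (indicator \<Omega> z *\<^sub>R f z))\<^sup>2)) = (\<lambda>z. indicator \<Omega> z * ennreal ((cmod (f z))\<^sup>2))"
    by (auto simp: fun_eq_iff indicator_def)
  finally show ?thesis .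
qed

text \<open>Averaging the mean value property on the circles \<open>z + e\<^sup>i\<^sup>\<theta> v\<close> over \<open>v \<in> E\<close>; rotations preserve Lebesgue measure.\<close>

lemma mean_value_balanced:
  assumes f: "f \<in> bergman_space \<Omega>" and E[measurable]: "E \<in> sets borel" and bal: "balanced E"
    and sub: "\<And>v. v \<in> E \<Longrightarrow> z + v \<in> \<Omega>"
  shows "ennreal ((cmod (f z))\<^sup>2) * emeasure lborel E \<le> ennreal (sqn f)"
proof -
  define F where "F w = indicator \<Omega> w * ennreal ((cmod (f w))\<^sup>2)" for w
  have [measurable]: "F \<in> borel_measurable borel"
    unfolding F_def by (rule meas_sq[OF bergmanD(1)[OF f]])
  let ?e = "\<lambda>x::real. cis (2 * pi * x)"
  have [measurable]: "?e \<in> borel_measurable borel"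
    by (intro borel_measurable_continuous_onI continuous_intros continuous_on_cis)
  have pt: "indicator E v * ennreal ((cmod (f z))\<^sup>2)
      \<le> (\<integral>\<^sup>+x. indicator {0..1} x * (indicator E v * F (z + ?e x *s v)) \<partial>lborel)" for v
  proof (cases "v \<in> E")
    case True
    have inO: "z + \<zeta> *s v \<in> \<Omega>" if "\<zeta> \<in> cball 0 1" for \<zeta>
      using bal True that by (intro sub) (auto simp: balanced_def)
    have "(\<lambda>\<zeta>. (f (z + \<zeta> *s v))\<^sup>2) holomorphic_on cball 0 1"
      by (intro holomorphic_intros holomorphic_Cn_line[OF bergmanD(1)[OF f] inO])
    from holomorphic_mean_le_nn_integral[OF this]
    have "ennreal ((cmod (f z))\<^sup>2) \<le> (\<integral>\<^sup>+x. indicator {0..1} x * ennreal ((cmod (f (z + ?e x *s v)))\<^sup>2) \<partial>lborel)"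
      by (simp add: norm_power)
    also have "\<dots> = (\<integral>\<^sup>+x. indicator {0..1} x * (indicator E v * F (z + ?e x *s v)) \<partial>lborel)"
      using True inO by (intro nn_integral_cong) (auto simp: F_def)
    finally show ?thesis using True by simp
  qed simp
  have "ennreal ((cmod (f z))\<^sup>2) * emeasure lborel E = (\<integral>\<^sup>+v. indicator E v * ennreal ((cmod (f z))\<^sup>2) \<partial>lborel)"
    by (subst nn_integral_multc) (auto simp: mult.commute)
  also have "\<dots> \<le> (\<integral>\<^sup>+v. (\<integral>\<^sup>+x. indicator {0..1} x * (indicator E v * F (z + ?e x *s v)) \<partial>lborel) \<partial>lborel)"
    by (intro nn_integral_mono pt)
  also have "\<dots> = (\<integral>\<^sup>+x. (\<integral>\<^sup>+v. indicator {0..1} x * (indicator E v * F (z + ?e x *s v)) \<partial>lborel) \<partial>lborel)"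
    by (rule lborel_pair.Fubini') measurable
  also have "\<dots> \<le> (\<integral>\<^sup>+x. indicator {0..1::real} x * ennreal (sqn f) \<partial>lborel)"
  proof (intro nn_integral_mono)
    fix x :: real
    have iso: "norm (?e x *s v) = norm v" for v :: "complex^'n" by (simp add: norm_smult_complex)
    have lin: "linear (\<lambda>v :: complex^'n. ?e x *s v)"
      using bounded_linear_smult_right by (simp add: linear_conv_bounded_linear)
    have Ee: "v \<in> E \<longleftrightarrow> ?e x *s v \<in> E" for v
    proof
      assume "?e x *s v \<in> E"
      then have "cis (- (2 * pi * x)) *s (?e x *s v) \<in> E"
        by (rule bal[unfolded balanced_def, rule_format]) simp
      moreover have "cis (- (2 * pi * x)) * cis (2 * pi * x) = 1" unfolding cis_mult by simp
      ultimately show "v \<in> E" by (simp only: vector_smult_assoc vector_smult_lid)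
    qed (use bal in \<open>simp add: balanced_def\<close>)
    have "(\<integral>\<^sup>+v. indicator E v * F (z + ?e x *s v) \<partial>lborel) = (\<integral>\<^sup>+v. indicator E (?e x *s v) * F (?e x *s v + z) \<partial>lborel)"
      using Ee by (intro nn_integral_cong) (auto simp: indicator_def add.commute)
    also have "\<dots> = (\<integral>\<^sup>+v. indicator E v * F (v + z) \<partial>lborel)"
      by (rule nn_integral_lborel_isometry[OF lin iso]) measurable
    also have "\<dots> \<le> (\<integral>\<^sup>+v. F (v + z) \<partial>lborel)"
      by (intro nn_integral_mono) (auto simp: indicator_def)
    also have "\<dots> = (\<integral>\<^sup>+v. F v \<partial>lborel)" by (rule nn_integral_lborel_plus) measurable
    also have "\<dots> = ennreal (sqn f)" unfolding F_def by (rule nn_integral_sqn[OF f])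
    finally have *: "(\<integral>\<^sup>+v. indicator E v * F (z + ?e x *s v) \<partial>lborel) \<le> ennreal (sqn f)" .
    show "(\<integral>\<^sup>+v. indicator {0..1} x * (indicator E v * F (z + ?e x *s v)) \<partial>lborel) \<le> indicator {0..1} x * ennreal (sqn f)"
      by (subst nn_integral_cmult) (auto intro!: mult_left_mono *)
  qed
  also have "\<dots> = ennreal (sqn f)" by (subst nn_integral_multc) auto
  finally show ?thesis .
qed

lemma mean_value_balanced_real:
  assumes f: "f \<in> bergman_space \<Omega>" and E: "E \<in> sets borel" "bounded E" and bal: "balanced E"
    and sub: "\<And>v. v \<in> E \<Longrightarrow> z + v \<in> \<Omega>"
  shows "(cmod (f z))\<^sup>2 * measure lborel E \<le> sqn f"
proof -
  have "emeasure lborel E < \<infinity>" using E(2) by (rule emeasure_bounded_finite)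
  then have "emeasure lborel E = ennreal (measure lborel E)"
    by (intro emeasure_eq_ennreal_measure less_imp_neq) simp
  with mean_value_balanced[OF f E(1) bal sub] have "ennreal ((cmod (f z))\<^sup>2 * measure lborel E) \<le> ennreal (sqn f)"
    by (simp add: ennreal_mult')
  then show ?thesis by (simp add: sqn_nonneg)
qed

lemma bergman_bound_ball:
  assumes f: "f \<in> bergman_space \<Omega>" and "ball z r \<subseteq> \<Omega>"
  shows "(cmod (f z))\<^sup>2 * measure lborel (ball (0::complex^'n) r) \<le> sqn f"
proof (rule mean_value_balanced_real[OF f])
  show "balanced (ball (0::complex^'n) r)"
    unfolding balanced_def
  proof (intro allI ballI impI)
    fix c :: complex and v :: "complex^'n" assume "v \<in> ball 0 r" "cmod c \<le> 1"
    moreover from this have "cmod c * norm v \<le> norm v" by (simp add: mult_left_le_one_le)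
    ultimately show "c *s v \<in> ball 0 r" by (simp add: norm_smult_complex)
  qed
  show "z + v \<in> \<Omega>" if "v \<in> ball 0 r" for v
    using assms(2) that by (auto simp: dist_norm subset_iff)
qed auto

lemma ip_integrable:
  assumes f: "f \<in> bergman_space \<Omega>" and g: "g \<in> bergman_space \<Omega>"
  shows "set_integrable lborel \<Omega> (\<lambda>z. f z * cnj (g z))"
proof (rule set_integrable_bound)
  show "set_integrable lborel \<Omega> (\<lambda>z. (cmod (f z))\<^sup>2 + (cmod (g z))\<^sup>2)"
    by (intro set_integral_add bergmanD f g)
  have "continuous_on \<Omega> (\<lambda>z. f z * cnj (g z))"
    by (intro continuous_intros holomorphic_Cn_on_continuous bergmanD f g)
  then show "set_borel_measurable lborel \<Omega> (\<lambda>z. f z * cnj (g z))"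
    unfolding set_borel_measurable_def using borel_measurable_continuous_on_indicator[OF sets_domain] by simp
  have "a * b \<le> a\<^sup>2 + b\<^sup>2" if "a \<ge> 0" "b \<ge> 0" for a b :: real
    using sum_squares_bound[of a b] mult_nonneg_nonneg[OF that] by linarith
  then show "AE z in lborel. z \<in> \<Omega> \<longrightarrow> cmod (f z * cnj (g z)) \<le> norm ((cmod (f z))\<^sup>2 + (cmod (g z))\<^sup>2)"
    by (auto simp: norm_mult)
qed

lemma sq_expand: "(cmod (a + c * b))\<^sup>2 = (cmod a)\<^sup>2 + (2 * Re (cnj c * (a * cnj b)) + (cmod c)\<^sup>2 * (cmod b)\<^sup>2)"
  unfolding cmod_power2 by (simp add: power2_eq_square algebra_simps)

lemma
  assumes f: "f \<in> bergman_space \<Omega>" and g: "g \<in> bergman_space \<Omega>"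
  shows bergman_lincomb: "(\<lambda>z. f z + c * g z) \<in> bergman_space \<Omega>"
    and sqn_lincomb: "sqn (\<lambda>z. f z + c * g z) = sqn f + (2 * Re (cnj c * ip f g) + (cmod c)\<^sup>2 * sqn g)"
proof -
  have 1: "set_integrable lborel \<Omega> (\<lambda>z. cnj c * (f z * cnj (g z)))"
    by (rule set_integrable_mult_right) (rule ip_integrable[OF f g])
  have 2: "set_integrable lborel \<Omega> (\<lambda>z. Re (cnj c * (f z * cnj (g z))))"
    using integrable_Re[OF 1[unfolded set_integrable_def]] by (simp add: set_integrable_def)
  have 3: "set_integrable lborel \<Omega> (\<lambda>z. 2 * Re (cnj c * (f z * cnj (g z))))"
    by (rule set_integrable_mult_right) (rule 2)
  have 4: "set_integrable lborel \<Omega> (\<lambda>z. (cmod c)\<^sup>2 * (cmod (g z))\<^sup>2)"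
    by (rule set_integrable_mult_right) (rule bergmanD(2)[OF g])
  have 5: "set_integrable lborel \<Omega> (\<lambda>z. (cmod (f z + c * g z))\<^sup>2)"
    unfolding sq_expand by (intro set_integral_add bergmanD(2) f 3 4)
  show "(\<lambda>z. f z + c * g z) \<in> bergman_space \<Omega>"
    unfolding bergman_space_def
    using 5 holomorphic_Cn_on_add[OF bergmanD(1)[OF f] holomorphic_Cn_on_cmult[OF bergmanD(1)[OF g]]] by blast
  have "sqn (\<lambda>z. f z + c * g z) = sqn f + (set_lebesgue_integral lborel \<Omega> (\<lambda>z. 2 * Re (cnj c * (f z * cnj (g z)))) + set_lebesgue_integral lborel \<Omega> (\<lambda>z. (cmod c)\<^sup>2 * (cmod (g z))\<^sup>2))"
    unfolding sqn_def sq_expand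
    by (simp only: set_integral_add[OF bergmanD(2)[OF f] set_integral_add(1)[OF 3 4]] set_integral_add[OF 3 4])
  also have "set_lebesgue_integral lborel \<Omega> (\<lambda>z. 2 * Re (cnj c * (f z * cnj (g z)))) = 2 * Re (cnj c * ip f g)"
  proof -
    have "set_lebesgue_integral lborel \<Omega> (\<lambda>z. Re (cnj c * (f z * cnj (g z)))) = Re (set_lebesgue_integral lborel \<Omega> (\<lambda>z. cnj c * (f z * cnj (g z))))"
      using integral_Re[OF 1[unfolded set_integrable_def]]
      by (simp only: set_lebesgue_integral_def scaleR_complex.simps real_scaleR_def)
    then show ?thesis by (simp only: ip_def set_integral_mult_right)
  qed
  finally show "sqn (\<lambda>z. f z + c * g z) = sqn f + (2 * Re (cnj c * ip f g) + (cmod c)\<^sup>2 * sqn g)"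
    by (simp only: sqn_def set_integral_mult_right)
qed

lemma ip_lincomb:
  assumes "f \<in> bergman_space \<Omega>" "g \<in> bergman_space \<Omega>" "h \<in> bergman_space \<Omega>"
  shows "ip (\<lambda>z. f z + c * g z) h = ip f h + c * ip g h"
proof -
  have "set_integrable lborel \<Omega> (\<lambda>z. c * (g z * cnj (h z)))" by (rule set_integrable_mult_right) (rule ip_integrable[OF assms(2,3)])
  from set_integral_add(2)[OF ip_integrable[OF assms(1,3)] this] show ?thesis
    by (simp only: ip_def distrib_right mult.assoc set_integral_mult_right)
qed

lemma ip_cnj: "cnj (ip f g) = ip g f"
  unfolding ip_def set_lebesgue_integral_def
  by (simp flip: Bochner_Integration.integral_cnj) (simp add: mult.commute)

lemma ip_self: "ip f f = of_real (sqn f)"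
  unfolding ip_def sqn_def set_lebesgue_integral_def integral_complex_of_real[symmetric]
  by (intro Bochner_Integration.integral_cong refl) (simp add: scaleR_conv_of_real complex_norm_square del: of_real_power)

lemma bergman_const: "(\<lambda>_. a) \<in> bergman_space \<Omega>"
proof -
  have "emeasure lborel \<Omega> < \<infinity>" using bounded_domain by (rule emeasure_bounded_finite)
  then have "integrable lborel (\<lambda>x. indicat_real \<Omega> x * (cmod a)\<^sup>2)"
    by (intro integrable_mult_left integrable_real_indicator) auto
  then have "set_integrable lborel \<Omega> (\<lambda>_. (cmod a)\<^sup>2)" by (simp only: set_integrable_def real_scaleR_def)
  then show ?thesis by (simp add: bergman_space_def holomorphic_Cn_on_const)
qed

lemma bergman_cmult: "f \<in> bergman_space \<Omega> \<Longrightarrow> (\<lambda>z. c * f z) \<in> bergman_space \<Omega>"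
  using bergman_lincomb[OF bergman_const[of 0], of f c] by simp

lemma sqn_cmult: "f \<in> bergman_space \<Omega> \<Longrightarrow> sqn (\<lambda>z. c * f z) = (cmod c)\<^sup>2 * sqn f"
  unfolding sqn_def by (simp only: norm_mult power_mult_distrib set_integral_mult_right)

section \<open>Completeness, extremal functions and the reproducing property\<close>

lemma bergman_norm_bound:
  assumes f: "f \<in> bergman_space \<Omega>" and r: "r > 0" and sub: "ball z0 (2 * r) \<subseteq> \<Omega>" and z: "z \<in> ball z0 r"
  shows "cmod (f z) \<le> sqrt (sqn f / measure lborel (ball (0::complex^'n) r))"
proof -
  have "ball z r \<subseteq> \<Omega>"
  proof
    fix x assume "x \<in> ball z r"
    then have "x \<in> ball z0 (2 * r)" using z dist_triangle[of z0 x z] by (simp add: dist_commute)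
    then show "x \<in> \<Omega>" using sub by blast
  qed
  from bergman_bound_ball[OF f this]
  have "(cmod (f z))\<^sup>2 \<le> sqn f / measure lborel (ball (0::complex^'n) r)"
    using content_ball_pos[OF r, of "0::complex^'n"] by (simp add: field_simps)
  then show ?thesis by (rule real_le_rsqrt)
qed

text \<open>Mean value bounds turn L^2 Cauchy sequences into locally uniformly Cauchy ones, so the
  pointwise limit is holomorphic; Fatou's lemma bounds its norm. The conclusion is shaped for
  minimising sequences: pointwise convergence preserves the constraint, and the norm does not exceed
  the limit \<open>m\<close>.\<close>

lemma bergman_complete:
  assumes f: "\<And>k::nat. f k \<in> bergman_space \<Omega>"
    and cauchy: "\<And>e. e > 0 \<Longrightarrow> \<exists>N. \<forall>j\<ge>N. \<forall>k\<ge>N. sqn (\<lambda>z. f j z - f k z) < e"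
    and bnd: "(\<lambda>k. sqn (f k)) \<longlonglongrightarrow> m"
  obtains g where "g \<in> bergman_space \<Omega>" "sqn g \<le> m" "\<And>z. z \<in> \<Omega> \<Longrightarrow> (\<lambda>k. f k z) \<longlonglongrightarrow> g z"
proof -
  have diff: "(\<lambda>z. f j z - f k z) \<in> bergman_space \<Omega>" for j k
    using bergman_lincomb[OF f f, of j "-1" k] by simp
  have uc: "\<exists>r>0. ball z r \<subseteq> \<Omega> \<and> uniformly_Cauchy_on (ball z r) f" if z: "z \<in> \<Omega>" for z
  proof -
    obtain R where R: "R > 0" "ball z R \<subseteq> \<Omega>" using open_domain z open_contains_ball by blast
    define r where "r = R / 2"
    have r: "r > 0" "ball z (2 * r) \<subseteq> \<Omega>" using R by (auto simp: r_def)
    let ?M = "measure lborel (ball (0::complex^'n) r)"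
    have M: "?M > 0" using content_ball_pos[OF r(1)] by simp
    have "uniformly_Cauchy_on (ball z r) f"
      unfolding uniformly_Cauchy_on_def
    proof (intro allI impI)
      fix e :: real assume e: "e > 0"
      obtain N where N: "\<And>j k. j \<ge> N \<Longrightarrow> k \<ge> N \<Longrightarrow> sqn (\<lambda>z. f j z - f k z) < e\<^sup>2 * ?M"
        using cauchy[of "e\<^sup>2 * ?M"] e M by (meson mult_pos_pos zero_less_power)
      have "dist (f j x) (f k x) < e" if "x \<in> ball z r" "j \<ge> N" "k \<ge> N" for x j k
      proof -
        have "cmod (f j x - f k x) \<le> sqrt (sqn (\<lambda>z. f j z - f k z) / ?M)"
          by (rule bergman_norm_bound[OF diff r that(1)])
        also have "\<dots> < sqrt (e\<^sup>2)"
          using N[OF that(2,3)] M by (intro real_sqrt_less_mono) (simp add: field_simps)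
        finally show ?thesis using e by (simp add: dist_norm)
      qed
      then show "\<exists>M. \<forall>x\<in>ball z r. \<forall>m\<ge>M. \<forall>n\<ge>M. dist (f m x) (f n x) < e" by blast
    qed
    moreover have "ball z r \<subseteq> \<Omega>" using r by auto
    ultimately show ?thesis using r(1) by blast
  qed
  define g where "g z = lim (\<lambda>k. f k z)" for z
  have ul: "\<exists>r>0. ball z r \<subseteq> \<Omega> \<and> uniform_limit (ball z r) f g sequentially" if z: "z \<in> \<Omega>" for z
  proof -
    obtain r where r: "r > 0" "ball z r \<subseteq> \<Omega>" and C: "uniformly_Cauchy_on (ball z r) f" using uc[OF z] by blast
    have "uniformly_convergent_on (ball z r) f" using C by (rule Cauchy_uniformly_convergent)
    then have "uniform_limit (ball z r) f g sequentially"
      unfolding uniformly_convergent_uniform_limit_iff g_def .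
    with r show ?thesis by blast
  qed
  have lim: "(\<lambda>k. f k z) \<longlonglongrightarrow> g z" if z: "z \<in> \<Omega>" for z
  proof -
    obtain r where r: "r > 0" "uniform_limit (ball z r) f g sequentially" using ul[OF z] by blast
    then have "z \<in> ball z r" by simp
    then show ?thesis by (rule tendsto_uniform_limitI[OF r(2)])
  qed
  have hol: "holomorphic_Cn_on \<Omega> g"
    by (rule holomorphic_Cn_uniform_limit(1)[OF open_domain bergmanD(1)[OF f] ul])
  have fatou: "(\<integral>\<^sup>+z. indicator \<Omega> z * ennreal ((cmod (g z))\<^sup>2) \<partial>lborel) \<le> ennreal m"
  proof -
    have "(\<integral>\<^sup>+z. indicator \<Omega> z * ennreal ((cmod (g z))\<^sup>2) \<partial>lborel)
        = (\<integral>\<^sup>+z. liminf (\<lambda>k. indicator \<Omega> z * ennreal ((cmod (f k z))\<^sup>2)) \<partial>lborel)"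
    proof (rule nn_integral_cong)
      fix z :: "complex^'n"
      show "indicator \<Omega> z * ennreal ((cmod (g z))\<^sup>2) = liminf (\<lambda>k. indicator \<Omega> z * ennreal ((cmod (f k z))\<^sup>2))"
      proof (cases "z \<in> \<Omega>")
        case True
        have "(\<lambda>k. ennreal ((cmod (f k z))\<^sup>2)) \<longlonglongrightarrow> ennreal ((cmod (g z))\<^sup>2)"
          by (intro tendsto_intros lim True)
        from lim_imp_Liminf[OF sequentially_bot this] show ?thesis using True by simp
      qed (simp add: Liminf_const)
    qed
    also have "\<dots> \<le> liminf (\<lambda>k. \<integral>\<^sup>+z. indicator \<Omega> z * ennreal ((cmod (f k z))\<^sup>2) \<partial>lborel)"
      using meas_sq[OF bergmanD(1)[OF f]] by (intro nn_integral_liminf) simp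
    also have "\<dots> = liminf (\<lambda>k. ennreal (sqn (f k)))" by (simp only: nn_integral_sqn[OF f])
    also have "\<dots> = ennreal m" by (intro lim_imp_Liminf tendsto_intros bnd) simp
    finally show ?thesis .
  qed
  have si: "set_integrable lborel \<Omega> (\<lambda>z. (cmod (g z))\<^sup>2)"
    unfolding set_integrable_def
  proof (rule integrableI_bounded)
    have "continuous_on \<Omega> (\<lambda>z. (cmod (g z))\<^sup>2)"
      by (intro continuous_intros holomorphic_Cn_on_continuous hol)
    from borel_measurable_continuous_on_indicator[OF sets_domain this]
    show "(\<lambda>z. indicat_real \<Omega> z *\<^sub>R (cmod (g z))\<^sup>2) \<in> borel_measurable lborel" by simp
    have "(\<integral>\<^sup>+z. ennreal (norm (indicat_real \<Omega> z *\<^sub>R (cmod (g z))\<^sup>2)) \<partial>lborel)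
        = (\<integral>\<^sup>+z. indicator \<Omega> z * ennreal ((cmod (g z))\<^sup>2) \<partial>lborel)"
      by (intro nn_integral_cong) (auto simp: indicator_def)
    also have "\<dots> < \<infinity>" using fatou by (rule order_le_less_trans) simp
    finally show "(\<integral>\<^sup>+z. ennreal (norm (indicat_real \<Omega> z *\<^sub>R (cmod (g z))\<^sup>2)) \<partial>lborel) < \<infinity>" .
  qed
  have gA: "g \<in> bergman_space \<Omega>" using hol si by (simp add: bergman_space_def)
  have "0 \<le> m" by (rule LIMSEQ_le_const[OF bnd]) (auto simp: sqn_nonneg)
  then have "sqn g \<le> m" using fatou unfolding nn_integral_sqn[OF gA] by simp
  then show ?thesis using that gA lim by blast
qed

lemma exists_minimizer:
  assumes w: "w \<in> \<Omega>"
  obtains f where "f \<in> bergman_space \<Omega>" "f w = 1" "\<And>g. g \<in> bergman_space \<Omega> \<Longrightarrow> g w = 1 \<Longrightarrow> sqn f \<le> sqn g"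
proof -
  let ?S = "{f \<in> bergman_space \<Omega>. f w = 1}"
  define m where "m = (INF f\<in>?S. sqn f)"
  have ne: "?S \<noteq> {}" using bergman_const[of 1] by auto
  have bdd: "bdd_below (sqn ` ?S)" by (rule bdd_belowI[of _ 0]) (auto simp: sqn_nonneg)
  have low: "m \<le> sqn g" if "g \<in> ?S" for g unfolding m_def by (rule cINF_lower[OF bdd that])
  have "\<exists>f. f \<in> ?S \<and> sqn f < m + inverse (real (Suc k))" for k
  proof -
    have "m < m + inverse (real (Suc k))" by simp
    then show ?thesis unfolding m_def using cINF_less_iff[OF ne bdd] by blast
  qed
  then have "\<exists>f. \<forall>k. f k \<in> ?S \<and> sqn (f k) < m + inverse (real (Suc k))" by (intro choice allI)
  then obtain f where f: "\<And>k. f k \<in> ?S" "\<And>k. sqn (f k) < m + inverse (real (Suc k))" by blast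
  have fA: "f k \<in> bergman_space \<Omega>" and fw: "f k w = 1" for k using f(1)[of k] by auto
  have lim: "(\<lambda>k. sqn (f k)) \<longlonglongrightarrow> m"
  proof (rule tendsto_sandwich[of "\<lambda>_. m" _ _ "\<lambda>k. m + inverse (real (Suc k))"])
    show "(\<lambda>k. m + inverse (real (Suc k))) \<longlonglongrightarrow> m"
      using tendsto_add[OF tendsto_const[of m] LIMSEQ_inverse_real_of_nat] by simp
  qed (use low f in \<open>auto intro!: always_eventually less_imp_le\<close>)
  \<comment> \<open>The midpoint of two competitors is again a competitor, so its squared norm is at
    least \<open>m\<close>; by the parallelogram law a minimising sequence is therefore
    Cauchy.\<close>
  have par: "sqn (\<lambda>z. f j z - f k z) \<le> 2 * (sqn (f j) - m) + 2 * (sqn (f k) - m)" for j k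
  proof -
    have h: "(\<lambda>z. (1/2) * (f j z + 1 * f k z)) \<in> ?S"
      using bergman_cmult[OF bergman_lincomb[OF fA[of j] fA[of k], of 1], of "1/2"] fw by simp
    have "sqn (\<lambda>z. (1/2) * (f j z + 1 * f k z)) = (1/4) * sqn (\<lambda>z. f j z + 1 * f k z)"
      by (subst sqn_cmult[OF bergman_lincomb[OF fA fA]]) (simp add: power2_eq_square)
    with low[OF h] have "4 * m \<le> sqn (\<lambda>z. f j z + 1 * f k z)" by simp
    moreover have "sqn (\<lambda>z. f j z + (-1) * f k z) + sqn (\<lambda>z. f j z + 1 * f k z) = 2 * sqn (f j) + 2 * sqn (f k)"
      unfolding sqn_lincomb[OF fA fA] by simp
    ultimately show ?thesis by simp
  qed
  have cauchy: "\<exists>N. \<forall>j\<ge>N. \<forall>k\<ge>N. sqn (\<lambda>z. f j z - f k z) < e" if e: "e > 0" for e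
  proof -
    have "\<forall>\<^sub>F k in sequentially. sqn (f k) < m + e / 4" using order_tendstoD(2)[OF lim] e by simp
    then obtain N where N: "\<And>k. k \<ge> N \<Longrightarrow> sqn (f k) < m + e / 4" by (auto simp: eventually_sequentially)
    have "sqn (\<lambda>z. f j z - f k z) < e" if "j \<ge> N" "k \<ge> N" for j k
    proof -
      have "sqn (f j) - m < e / 4" "sqn (f k) - m < e / 4" using N[OF that(1)] N[OF that(2)] by auto
      then have "2 * (sqn (f j) - m) + 2 * (sqn (f k) - m) < e" by simp
      with par[of j k] show ?thesis by (rule order_le_less_trans)
    qed
    then show ?thesis by blast
  qed
  obtain g where g: "g \<in> bergman_space \<Omega>" "sqn g \<le> m" "\<And>z. z \<in> \<Omega> \<Longrightarrow> (\<lambda>k. f k z) \<longlonglongrightarrow> g z"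
    using bergman_complete[OF fA cauchy lim] by blast
  have "g w = 1" using g(3)[OF w] LIMSEQ_unique[of "\<lambda>k. f k w" "g w" 1] by (simp add: fw)
  moreover have "sqn g \<le> sqn h" if "h \<in> bergman_space \<Omega>" "h w = 1" for h
    using g(2) low[of h] that by auto
  ultimately show ?thesis using that[of g] g(1) by blast
qed

text \<open>A function \<open>f\<close> of least norm with \<open>f w = 1\<close> is orthogonal to
  all functions vanishing at \<open>w\<close>, and h - h(w) f is such a function. Hence
  \<open>f\<close> divided by its squared norm reproduces values at \<open>w\<close>.\<close>

lemma exists_reproducing:
  assumes w: "w \<in> \<Omega>"
  shows "\<exists>k. k \<in> bergman_space \<Omega> \<and> (\<forall>f\<in>bergman_space \<Omega>. f w = ip f k)"
proof -
  obtain f where f: "f \<in> bergman_space \<Omega>" "f w = 1"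
    and min: "\<And>g. g \<in> bergman_space \<Omega> \<Longrightarrow> g w = 1 \<Longrightarrow> sqn f \<le> sqn g"
    using exists_minimizer[OF w] by blast
  have pos: "sqn f > 0"
  proof -
    obtain r where r: "r > 0" "ball w r \<subseteq> \<Omega>" using open_domain w open_contains_ball by blast
    have "0 < measure lborel (ball (0::complex^'n) r)" using content_ball_pos[OF r(1)] by simp
    also have "\<dots> \<le> sqn f" using bergman_bound_ball[OF f(1) r(2)] f(2) by simp
    finally show ?thesis .
  qed
  have orth: "ip g f = 0" if g: "g \<in> bergman_space \<Omega>" "g w = 0" for g
  proof (rule ccontr)
    assume "ip g f \<noteq> 0"
    have "ip f g = cnj (ip g f)" by (rule ip_cnj[symmetric])
    then have n0: "ip f g \<noteq> 0" using \<open>ip g f \<noteq> 0\<close> by simp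
    \<comment> \<open>With this step size \<open>t * sqn g < 1\<close>, so the perturbation of
      \<open>f\<close> by \<open>g\<close> would strictly decrease the norm.\<close>
    define t where "t = 1 / (sqn g + 1)"
    have t: "t > 0" "t * sqn g < 1" using sqn_nonneg[of g] by (auto simp: t_def field_simps add_nonneg_pos)
    let ?c = "- (of_real t * ip f g)"
    have "sqn f \<le> sqn (\<lambda>z. f z + ?c * g z)"
      by (rule min[OF bergman_lincomb[OF f(1) g(1)]]) (simp add: f g)
    then have "0 \<le> 2 * Re (cnj ?c * ip f g) + (cmod ?c)\<^sup>2 * sqn g"
      unfolding sqn_lincomb[OF f(1) g(1)] by simp
    also have "Re (cnj ?c * ip f g) = - t * (cmod (ip f g))\<^sup>2"
      unfolding cmod_power2 by (simp add: power2_eq_square algebra_simps)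
    also have "(cmod ?c)\<^sup>2 = t\<^sup>2 * (cmod (ip f g))\<^sup>2"
      by (simp add: norm_mult power_mult_distrib)
    finally have "0 \<le> t * (cmod (ip f g))\<^sup>2 * (t * sqn g - 2)" by (simp add: power2_eq_square algebra_simps)
    moreover have "0 < t * (cmod (ip f g))\<^sup>2" using t n0 by simp
    ultimately show False using t(2) by (simp add: zero_le_mult_iff)
  qed
  define k where "k = (\<lambda>z. of_real (1 / sqn f) * f z)"
  have "h w = ip h k" if h: "h \<in> bergman_space \<Omega>" for h
  proof -
    have "ip (\<lambda>z. h z + (- h w) * f z) f = 0"
      by (rule orth[OF bergman_lincomb[OF h f(1)]]) (simp add: f)
    then have "ip h f = h w * ip f f" unfolding ip_lincomb[OF h f(1) f(1)] by simp
    moreover have "ip f f = of_real (sqn f)" by (rule ip_self)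
    moreover have "ip h k = of_real (1 / sqn f) * ip h f"
    proof -
      have "ip h k = set_lebesgue_integral lborel \<Omega> (\<lambda>z. of_real (1 / sqn f) * (h z * cnj (f z)))"
        unfolding ip_def k_def by (simp add: mult_ac)
      then show ?thesis by (simp only: set_integral_mult_right ip_def)
    qed
    ultimately show ?thesis using pos by simp
  qed
  moreover have "k \<in> bergman_space \<Omega>" unfolding k_def by (rule bergman_cmult[OF f(1)])
  ultimately show ?thesis by blast
qed

section \<open>The kernel, its extremal property and bounds on the diagonal\<close>

definition K :: "complex^'n \<Rightarrow> complex^'n \<Rightarrow> complex" where
  "K = bergman_kernel \<Omega>"

text \<open>This discharges the definite description in \<open>bergman_kernel\<close>. For
  uniqueness, the difference of two candidate columns is reproduced to the same value by both, hence
  orthogonal to itself; a mean value bound turns norm 0 into vanishing at each point.\<close>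

lemma bergman_kernel_props:
  shows "\<And>w. w \<in> \<Omega> \<Longrightarrow> (\<lambda>z. K z w) \<in> bergman_space \<Omega>"
    and "\<And>w f. w \<in> \<Omega> \<Longrightarrow> f \<in> bergman_space \<Omega> \<Longrightarrow> f w = ip f (\<lambda>z. K z w)"
    and "\<And>z w. z \<notin> \<Omega> \<or> w \<notin> \<Omega> \<Longrightarrow> K z w = 0"
proof -
  define P where "P K \<longleftrightarrow> (\<forall>z w. z \<notin> \<Omega> \<or> w \<notin> \<Omega> \<longrightarrow> K z w = 0) \<and>
     (\<forall>w\<in>\<Omega>. (\<lambda>z. K z w) \<in> bergman_space \<Omega> \<and>
        (\<forall>f\<in>bergman_space \<Omega>. f w = set_lebesgue_integral lborel \<Omega> (\<lambda>z. f z * cnj (K z w))))" for K :: "complex^'n \<Rightarrow> complex^'n \<Rightarrow> complex"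
  have PD0: "K' z w = 0" if "P K'" "z \<notin> \<Omega> \<or> w \<notin> \<Omega>" for K' z w
    using that unfolding P_def by blast
  have PD1: "(\<lambda>z. K' z w) \<in> bergman_space \<Omega>" if "P K'" "w \<in> \<Omega>" for K' w
    using that unfolding P_def by blast
  have PD2: "ip f (\<lambda>z. K' z w) = f w" if "P K'" "w \<in> \<Omega>" "f \<in> bergman_space \<Omega>" for K' w f
    using that(1)[unfolded P_def, THEN conjunct2, rule_format, OF that(2), THEN conjunct2, rule_format, OF that(3)]
    unfolding ip_def by (rule sym)
  have K: "K = (THE K. P K)" unfolding K_def bergman_kernel_def P_def ..
  define k where "k w = (SOME k. k \<in> bergman_space \<Omega> \<and> (\<forall>f\<in>bergman_space \<Omega>. f w = ip f k))" for w
  have k: "k w \<in> bergman_space \<Omega>" "\<And>f. f \<in> bergman_space \<Omega> \<Longrightarrow> f w = ip f (k w)" if "w \<in> \<Omega>" for w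
    using someI_ex[OF exists_reproducing[OF that]] unfolding k_def by auto
  define K0 where "K0 z w = (if z \<in> \<Omega> \<and> w \<in> \<Omega> then k w z else 0)" for z w
  have P0: "P K0"
    unfolding P_def
  proof (intro conjI allI ballI impI)
    show "K0 z w = 0" if "z \<notin> \<Omega> \<or> w \<notin> \<Omega>" for z w using that by (auto simp: K0_def)
    fix w assume w: "w \<in> \<Omega>"
    show "(\<lambda>z. K0 z w) \<in> bergman_space \<Omega>"
      by (rule bergman_cong[OF k(1)[OF w]]) (simp add: K0_def w)
    fix f assume f: "f \<in> bergman_space \<Omega>"
    have "ip f (k w) = set_lebesgue_integral lborel \<Omega> (\<lambda>z. f z * cnj (K0 z w))"
      unfolding ip_def by (rule set_lebesgue_integral_cong) (auto simp: K0_def w)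
    with k(2)[OF w f] show "f w = set_lebesgue_integral lborel \<Omega> (\<lambda>z. f z * cnj (K0 z w))" by simp
  qed
  have uniq: "K1 = K0" if P1: "P K1" for K1
  proof (intro ext)
    fix z w
    show "K1 z w = K0 z w"
    proof (cases "z \<in> \<Omega> \<and> w \<in> \<Omega>")
      case False
      then show ?thesis using PD0[OF P0] PD0[OF P1] by simp
    next
      case True
      let ?d = "\<lambda>z. K1 z w + (-1) * K0 z w"
      have w: "w \<in> \<Omega>" using True by simp
      note K1 = PD1[OF P1 w] and K0 = PD1[OF P0 w]
      have d: "?d \<in> bergman_space \<Omega>" by (rule bergman_lincomb[OF K1 K0])
      note r = PD2[OF P1 w d] PD2[OF P0 w d]
      have "ip ?d ?d = ip (\<lambda>z. K1 z w) ?d + (-1) * ip (\<lambda>z. K0 z w) ?d"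
        by (rule ip_lincomb[OF K1 K0 d])
      also have "\<dots> = cnj (ip ?d (\<lambda>z. K1 z w)) + (-1) * cnj (ip ?d (\<lambda>z. K0 z w))"
        unfolding ip_cnj ..
      also have "\<dots> = 0" unfolding r by simp
      finally have "sqn ?d = 0" unfolding ip_self by simp
      obtain r where r: "r > 0" "ball z r \<subseteq> \<Omega>" using open_domain True open_contains_ball by blast
      have "(cmod (?d z))\<^sup>2 * measure lborel (ball (0::complex^'n) r) \<le> 0"
        using bergman_bound_ball[OF d r(2)] unfolding \<open>sqn ?d = 0\<close> .
      moreover have "measure lborel (ball (0::complex^'n) r) > 0" using content_ball_pos[OF r(1)] by simp
      ultimately have "(cmod (?d z))\<^sup>2 \<le> 0" by (simp add: mult_le_0_iff)
      then show ?thesis by simp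
    qed
  qed
  have PK: "P K" unfolding K by (rule theI[of P K0, OF P0 uniq])
  show "(\<lambda>z. K z w) \<in> bergman_space \<Omega>" if "w \<in> \<Omega>" for w
    by (rule PD1[OF PK that])
  show "f w = ip f (\<lambda>z. K z w)" if "w \<in> \<Omega>" "f \<in> bergman_space \<Omega>" for w f
    by (rule PD2[OF PK that, symmetric])
  show "K z w = 0" if "z \<notin> \<Omega> \<or> w \<notin> \<Omega>" for z w by (rule PD0[OF PK that])
qed

lemma kernel_hermitian: "K z w = cnj (K w z)"
proof (cases "z \<in> \<Omega> \<and> w \<in> \<Omega>")
  case True
  then have z: "z \<in> \<Omega>" and w: "w \<in> \<Omega>" by auto
  show ?thesis
    unfolding bergman_kernel_props(2)[OF z bergman_kernel_props(1)[OF w]]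
      bergman_kernel_props(2)[OF w bergman_kernel_props(1)[OF z]] ip_cnj ..
next
  case False
  then show ?thesis using bergman_kernel_props(3)[of z w] bergman_kernel_props(3)[of w z] by auto
qed

lemma kernel_diag: "w \<in> \<Omega> \<Longrightarrow> K w w = of_real (sqn (\<lambda>z. K z w))"
  by (subst bergman_kernel_props(2)[OF _ bergman_kernel_props(1)]) (simp_all add: ip_self)

text \<open>Expansion of the squared norm of f - t f(w) K(., w). The parameter stays free because
  positivity of K(w, w) is not yet available: large \<open>t\<close> with f = 1 will give it, and
  then t = 1 / K(w, w) gives the extremal inequality.\<close>

lemma bergman_extremal_aux:
  assumes f: "f \<in> bergman_space \<Omega>" and w: "w \<in> \<Omega>"
  shows "2 * t * (cmod (f w))\<^sup>2 \<le> sqn f + t\<^sup>2 * (cmod (f w))\<^sup>2 * Re (K w w)"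
proof -
  let ?k = "\<lambda>z. K z w" and ?c = "- (of_real t * f w)"
  note k = bergman_kernel_props(1)[OF w]
  have "0 \<le> sqn (\<lambda>z. f z + ?c * ?k z)" by (rule sqn_nonneg)
  also have "\<dots> = sqn f + (2 * Re (cnj ?c * f w) + (cmod ?c)\<^sup>2 * Re (K w w))"
    unfolding sqn_lincomb[OF f k] bergman_kernel_props(2)[OF w f, symmetric] kernel_diag[OF w] by simp
  also have "Re (cnj ?c * f w) = - t * (cmod (f w))\<^sup>2"
    unfolding cmod_power2 by (simp add: power2_eq_square algebra_simps)
  also have "(cmod ?c)\<^sup>2 = t\<^sup>2 * (cmod (f w))\<^sup>2"
    by (simp add: norm_mult power_mult_distrib)
  finally show ?thesis by simp
qed

lemma kernel_pos:
  assumes w: "w \<in> \<Omega>"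
  shows "Re (K w w) > 0"
proof (rule ccontr)
  assume "\<not> Re (K w w) > 0"
  then have "Re (K w w) \<le> 0" by simp
  then have "t\<^sup>2 * (cmod 1)\<^sup>2 * Re (K w w) \<le> 0" for t :: real by (intro mult_nonneg_nonpos) auto
  then have "2 * t \<le> sqn (\<lambda>_. 1)" for t :: real
    using bergman_extremal_aux[OF bergman_const[of 1] w, of t] by (smt (verit) norm_one one_power2 mult_cancel_left2)
  from this[of "sqn (\<lambda>_. 1) + 1"] show False using sqn_nonneg[of "\<lambda>_. 1"] by simp
qed

lemma bergman_extremal:
  assumes f: "f \<in> bergman_space \<Omega>" and w: "w \<in> \<Omega>"
  shows "(cmod (f w))\<^sup>2 \<le> sqn f * Re (K w w)"
  using bergman_extremal_aux[OF f w, of "1 / Re (K w w)"] kernel_pos[OF w]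
  by (simp add: power2_eq_square field_simps)

lemma kernel_bound:
  assumes z: "z \<in> \<Omega>" and w: "w \<in> \<Omega>"
  shows "(cmod (K z w))\<^sup>2 \<le> Re (K w w) * Re (K z z)"
  using bergman_extremal[OF bergman_kernel_props(1)[OF w] z] kernel_diag[OF w] by simp

text \<open>The mean value inequality for the column K(., w), whose value at \<open>w\<close> equals
  its squared norm; one factor K(w, w) cancels.\<close>

lemma kernel_diag_upper:
  assumes w: "w \<in> \<Omega>" and E: "E \<in> sets borel" "bounded E" and bal: "balanced E"
    and sub: "\<And>v. v \<in> E \<Longrightarrow> w + v \<in> \<Omega>"
  shows "Re (K w w) * measure lborel E \<le> 1"
proof -
  have "(cmod (K w w))\<^sup>2 * measure lborel E \<le> sqn (\<lambda>z. K z w)"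
    by (rule mean_value_balanced_real[OF bergman_kernel_props(1)[OF w] E bal sub])
  moreover have "sqn (\<lambda>z. K z w) = Re (K w w)" using kernel_diag[OF w] by simp
  moreover have "cmod (K w w) = Re (K w w)"
    using kernel_diag[OF w] sqn_nonneg by simp
  ultimately have "Re (K w w) * (Re (K w w) * measure lborel E) \<le> Re (K w w) * 1"
    by (simp add: power2_eq_square mult.assoc)
  then show ?thesis using kernel_pos[OF w] by (simp only: mult_le_cancel_left_pos)
qed

lemma kernel_locally_bounded:
  assumes "z0 \<in> \<Omega>"
  obtains r B where "r > 0" "ball z0 r \<subseteq> \<Omega>" "\<And>z. z \<in> ball z0 r \<Longrightarrow> Re (K z z) \<le> B"
proof -
  obtain R where R: "R > 0" "ball z0 R \<subseteq> \<Omega>" using open_domain assms open_contains_ball by blast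
  let ?r = "R / 2"
  let ?M = "measure lborel (ball (0::complex^'n) ?r)"
  have M: "?M > 0" using content_ball_pos[of ?r] R by simp
  have "Re (K z z) \<le> 1 / ?M" if z: "z \<in> ball z0 ?r" for z
  proof -
    have sub: "ball z ?r \<subseteq> \<Omega>"
    proof
      fix x assume "x \<in> ball z ?r"
      then have "x \<in> ball z0 R" using z dist_triangle[of z0 x z] by (simp add: dist_commute)
      then show "x \<in> \<Omega>" using R by blast
    qed
    have z\<Omega>: "z \<in> \<Omega>" using z R by auto
    have "(cmod (K z z))\<^sup>2 * ?M \<le> sqn (\<lambda>w. K w z)"
      by (rule bergman_bound_ball[OF bergman_kernel_props(1)[OF z\<Omega>] sub])
    moreover have "sqn (\<lambda>w. K w z) = Re (K z z)" "cmod (K z z) = Re (K z z)"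
      using kernel_diag[OF z\<Omega>] sqn_nonneg by simp_all
    ultimately have "Re (K z z) * (Re (K z z) * ?M) \<le> Re (K z z) * 1"
      by (simp add: power2_eq_square mult.assoc)
    then have "Re (K z z) * ?M \<le> 1" using kernel_pos[OF z\<Omega>] by (simp only: mult_le_cancel_left_pos)
    then show ?thesis using M by (simp add: field_simps)
  qed
  then show ?thesis using that[of ?r "1 / ?M"] R by (auto simp: subset_iff)
qed

end

subsection \<open>Sesquiholomorphic functions\<close>

text \<open>Holomorphic in the first and antiholomorphic in the second argument. Joint local
  boundedness is part of the definition because it makes Cauchy estimates in one argument uniform in
  the other.\<close>

definition sesqui :: "(complex^'n) set \<Rightarrow> (complex^'n \<Rightarrow> complex^'n \<Rightarrow> complex) \<Rightarrow> bool" where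
  "sesqui S H \<longleftrightarrow> (\<forall>w\<in>S. holomorphic_Cn_on S (\<lambda>z. H z w)) \<and> (\<forall>z\<in>S. holomorphic_Cn_on S (\<lambda>w. cnj (H z w))) \<and>
     (\<forall>z0\<in>S. \<forall>w0\<in>S. \<exists>r>0. \<exists>B. ball z0 r \<subseteq> S \<and> ball w0 r \<subseteq> S \<and> (\<forall>z\<in>ball z0 r. \<forall>w\<in>ball w0 r. cmod (H z w) \<le> B))"

text \<open>An involution on the class \<open>sesqui\<close>; facts about the second argument are
  transported from the first along it.\<close>

definition conj_swap :: "(complex^'n \<Rightarrow> complex^'n \<Rightarrow> complex) \<Rightarrow> complex^'n \<Rightarrow> complex^'n \<Rightarrow> complex" where
  "conj_swap H z w = cnj (H w z)"

definition dL :: "complex^'n \<Rightarrow> (complex^'n \<Rightarrow> complex^'n \<Rightarrow> complex) \<Rightarrow> complex^'n \<Rightarrow> complex^'n \<Rightarrow> complex" where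
  "dL v H z w = frechet_derivative (\<lambda>z. H z w) (at z) v"

text \<open>The real directional derivative in the second argument; on the class
  \<open>sesqui\<close> it is conjugate-linear in \<open>v\<close>.\<close>

definition dR :: "complex^'n \<Rightarrow> (complex^'n \<Rightarrow> complex^'n \<Rightarrow> complex) \<Rightarrow> complex^'n \<Rightarrow> complex^'n \<Rightarrow> complex" where
  "dR v H = conj_swap (dL v (conj_swap H))"

lemma sesquiD:
  assumes "sesqui S H"
  shows "w \<in> S \<Longrightarrow> holomorphic_Cn_on S (\<lambda>z. H z w)"
    and "z \<in> S \<Longrightarrow> holomorphic_Cn_on S (\<lambda>w. cnj (H z w))"
  using assms unfolding sesqui_def by blast+

lemma sesqui_bounded:
  assumes "sesqui S H" "z0 \<in> S" "w0 \<in> S"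
  obtains r B where "r > 0" "ball z0 r \<subseteq> S" "ball w0 r \<subseteq> S" "\<And>z w. z \<in> ball z0 r \<Longrightarrow> w \<in> ball w0 r \<Longrightarrow> cmod (H z w) \<le> B"
proof -
  have "\<exists>r>0. \<exists>B. ball z0 r \<subseteq> S \<and> ball w0 r \<subseteq> S \<and> (\<forall>z\<in>ball z0 r. \<forall>w\<in>ball w0 r. cmod (H z w) \<le> B)"
    using assms unfolding sesqui_def by blast
  then show ?thesis using that by (elim exE conjE) blast
qed

lemma sesqui_conj_swap:
  assumes "sesqui S H"
  shows "sesqui S (conj_swap H)"
  unfolding sesqui_def conj_swap_def complex_cnj_cnj
proof (intro conjI ballI)
  fix z0 w0 assume zw: "z0 \<in> S" "w0 \<in> S"
  obtain r B where r: "r > 0" "ball w0 r \<subseteq> S" "ball z0 r \<subseteq> S" "\<And>z w. z \<in> ball w0 r \<Longrightarrow> w \<in> ball z0 r \<Longrightarrow> cmod (H z w) \<le> B"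
    using sesqui_bounded[OF assms zw(2,1)] by blast
  show "\<exists>r>0. \<exists>B. ball z0 r \<subseteq> S \<and> ball w0 r \<subseteq> S \<and> (\<forall>z\<in>ball z0 r. \<forall>w\<in>ball w0 r. cmod (cnj (H w z)) \<le> B)"
  proof (rule exI[of _ r], intro conjI r(1), rule exI[of _ B], intro conjI ballI)
    show "cmod (cnj (H w z)) \<le> B" if "z \<in> ball z0 r" "w \<in> ball w0 r" for z w
      using r(4)[OF that(2,1)] by simp
  qed (rule r)+
qed (auto intro: sesquiD[OF assms])

lemma dL_has_derivative:
  assumes "sesqui S H" "z \<in> S" "w \<in> S"
  shows "((\<lambda>z. H z w) has_derivative (\<lambda>v. dL v H z w)) (at z)"
  unfolding dL_def by (rule holomorphic_Cn_fd(1)[OF sesquiD(1)[OF assms(1,3)] assms(2)])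

lemma dR_has_derivative:
  assumes "sesqui S H" "z \<in> S" "w \<in> S"
  shows "((\<lambda>w. H z w) has_derivative (\<lambda>v. dR v H z w)) (at w)"
proof -
  have "((\<lambda>w. conj_swap H w z) has_derivative (\<lambda>v. dL v (conj_swap H) w z)) (at w)"
    by (rule dL_has_derivative[OF sesqui_conj_swap[OF assms(1)] assms(3,2)])
  from has_derivative_cnj[OF this] show ?thesis by (simp add: conj_swap_def dR_def)
qed

lemma dL_scale:
  assumes "sesqui S H" "z \<in> S" "w \<in> S"
  shows "dL (c *s v) H z w = c * dL v H z w"
  unfolding dL_def by (rule holomorphic_Cn_fd(2)[OF sesquiD(1)[OF assms(1,3)] assms(2)])

lemma dR_scale:
  assumes "sesqui S H" "z \<in> S" "w \<in> S"
  shows "dR (c *s v) H z w = cnj c * dR v H z w"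
  by (simp add: dR_def conj_swap_def[of "dL _ _"] dL_scale[OF sesqui_conj_swap[OF assms(1)] assms(3,2)])

lemma dR_sum:
  assumes "sesqui S H" "z \<in> S" "w \<in> S"
  shows "dR v H z w = (\<Sum>k\<in>UNIV. cnj (v $ k) * dR (axis k 1) H z w)"
proof -
  have l: "linear (\<lambda>v. dR v H z w)" using dR_has_derivative[OF assms] has_derivative_linear by blast
  have "dR v H z w = dR (\<Sum>k\<in>UNIV. (v $ k) *s axis k 1) H z w" by (simp add: basis_expansion)
  also have "\<dots> = (\<Sum>k\<in>UNIV. dR ((v $ k) *s axis k 1) H z w)" by (rule linear_sum[OF l])
  finally show ?thesis by (simp add: dR_scale[OF assms])
qed

text \<open>The point is antiholomorphy in the second argument: difference quotients in the first
  argument have it, and \<open>derivative_remainder\<close> makes them converge locally uniformly in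
  the second. The local bound is a Cauchy estimate.\<close>

lemma sesqui_dL:
  assumes S: "open S" and H: "sesqui S H"
  shows "sesqui S (dL v H)"
  unfolding sesqui_def
proof (intro conjI ballI)
  fix w assume "w \<in> S"
  then show "holomorphic_Cn_on S (\<lambda>z. dL v H z w)"
    unfolding dL_def by (intro holomorphic_Cn_on_fd[OF S] sesquiD(1)[OF H])
next
  fix z0 w0 assume zw: "z0 \<in> S" "w0 \<in> S"
  obtain r B where r: "r > 0" "ball z0 r \<subseteq> S" "ball w0 r \<subseteq> S"
    and B: "\<And>z w. z \<in> ball z0 r \<Longrightarrow> w \<in> ball w0 r \<Longrightarrow> cmod (H z w) \<le> B"
    using sesqui_bounded[OF H zw] by blast
  have sub: "ball z0 (r/2) \<subseteq> S" "ball w0 (r/2) \<subseteq> S" using r by auto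
  have "cmod (dL v H z w) \<le> 2 * B * norm v / r" if "z \<in> ball z0 (r/2)" "w \<in> ball w0 (r/2)" for z w
  proof -
    have wr: "w \<in> ball w0 r" using that r by simp
    then have "w \<in> S" using r by blast
    then have "holomorphic_Cn_on (ball z0 r) (\<lambda>z. H z w)"
      using holomorphic_Cn_on_subset[OF sesquiD(1)[OF H] r(2)] by blast
    then show ?thesis unfolding dL_def
      by (rule Cauchy_estimate_ball[OF _ B[OF _ wr] r(1) that(1)])
  qed
  note bd = this
  show "\<exists>r>0. \<exists>B. ball z0 r \<subseteq> S \<and> ball w0 r \<subseteq> S \<and> (\<forall>z\<in>ball z0 r. \<forall>w\<in>ball w0 r. cmod (dL v H z w) \<le> B)"
    by (rule exI[of _ "r/2"], intro conjI, use r(1) in simp, rule exI[of _ "2 * B * norm v / r"], intro conjI ballI)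
       (rule sub bd | assumption)+
next
  fix z assume z: "z \<in> S"
  obtain R where R: "R > 0" "ball z R \<subseteq> S" using S z open_contains_ball by blast
  \<comment> \<open>The factor in front of the null sequence ensures
    \<open>t k * norm v < R\<close>, so that all translates of \<open>z\<close> stay in
    \<open>S\<close>.\<close>
  define t where "t k = R / (norm v + 1) * inverse (real (Suc k))" for k
  have t0: "t k > 0" for k unfolding t_def using R by (intro mult_pos_pos divide_pos_pos) (auto simp: add_nonneg_pos)
  have ntv: "norm (complex_of_real (t k) *s v) = t k * norm v" for k
    using t0[of k] by (simp add: norm_smult_complex)
  have inS: "z + complex_of_real (t k) *s v \<in> S" for k
  proof -
    have "t k * norm v \<le> R / (norm v + 1) * norm v"
      unfolding t_def using R by (intro mult_right_mono mult_left_le) (auto simp: field_simps)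
    also have "\<dots> < R" using R mult_strict_left_mono[of "norm v" "norm v + 1" "R / (norm v + 1)"]
      by (simp add: add_nonneg_pos add_nonneg_eq_0_iff)
    finally have "z + complex_of_real (t k) *s v \<in> ball z R" using ntv[of k] by (simp add: dist_norm)
    then show ?thesis using R by blast
  qed
  have tlim: "t \<longlonglongrightarrow> 0"
    unfolding t_def[abs_def] using tendsto_mult_left[OF LIMSEQ_inverse_real_of_nat, of "R / (norm v + 1)"] by simp
  define q where "q k w = complex_of_real (inverse (t k)) * (cnj (H (z + complex_of_real (t k) *s v) w) - cnj (H z w))" for k w
  have holq: "holomorphic_Cn_on S (q k)" for k
    unfolding q_def by (intro holomorphic_Cn_on_cmult holomorphic_Cn_on_diff sesquiD(2)[OF H] z inS)
  show "holomorphic_Cn_on S (\<lambda>w. cnj (dL v H z w))"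
  proof (rule holomorphic_Cn_uniform_limit(1)[OF S holq])
    fix w0 assume w0: "w0 \<in> S"
    obtain r B where r: "r > 0" "ball z r \<subseteq> S" "ball w0 r \<subseteq> S"
      and B: "\<And>x w. x \<in> ball z r \<Longrightarrow> w \<in> ball w0 r \<Longrightarrow> cmod (H x w) \<le> B"
      using sesqui_bounded[OF H z w0] by blast
    let ?C = "8 * B / r\<^sup>2 * (norm v)\<^sup>2"
    have est: "dist (q k w) (cnj (dL v H z w)) \<le> t k * ?C" if w: "w \<in> ball w0 r" and k: "t k * norm v < r / 4" for k w
    proof -
      have wS: "w \<in> S" using w r by blast
      then have hol: "holomorphic_Cn_on (ball z r) (\<lambda>z. H z w)"
        using holomorphic_Cn_on_subset[OF sesquiD(1)[OF H] r(2)] by blast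
      let ?h = "complex_of_real (t k) *s v"
      have "cmod (H (z + ?h) w - H z w - dL ?h H z w) \<le> 8 * B / r\<^sup>2 * (norm ?h)\<^sup>2"
        unfolding dL_def using k by (intro derivative_remainder[OF hol B[OF _ w] r(1)]) (simp_all only: ntv)
      then have le: "cmod (H (z + ?h) w - H z w - complex_of_real (t k) * dL v H z w) \<le> 8 * B / r\<^sup>2 * (t k * norm v)\<^sup>2"
        unfolding ntv dL_scale[OF H z wS] .
      have "q k w - cnj (dL v H z w) = complex_of_real (inverse (t k)) * cnj (H (z + ?h) w - H z w - complex_of_real (t k) * dL v H z w)"
        using t0[of k] by (simp add: q_def field_simps)
      then have "cmod (q k w - cnj (dL v H z w)) = inverse (t k) * cmod (H (z + ?h) w - H z w - complex_of_real (t k) * dL v H z w)"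
        using t0[of k] by (simp only: norm_mult complex_mod_cnj norm_of_real abs_of_pos positive_imp_inverse_positive)
      also have "\<dots> \<le> inverse (t k) * (8 * B / r\<^sup>2 * (t k * norm v)\<^sup>2)"
        using le t0[of k] by (intro mult_left_mono) auto
      also have "\<dots> = t k * ?C" using t0[of k] by (simp add: power2_eq_square)
      finally show ?thesis by (simp add: dist_norm)
    qed
    have "uniform_limit (ball w0 r) q (\<lambda>w. cnj (dL v H z w)) sequentially"
    proof (rule uniform_limitI)
      fix e :: real assume e: "e > 0"
      have "(\<lambda>k. t k * ?C) \<longlonglongrightarrow> 0 * ?C" "(\<lambda>k. t k * norm v) \<longlonglongrightarrow> 0 * norm v" by (intro tendsto_intros tlim)+
      then have "(\<lambda>k. t k * ?C) \<longlonglongrightarrow> 0" "(\<lambda>k. t k * norm v) \<longlonglongrightarrow> 0" by (simp_all only: mult_zero_left)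
      from order_tendstoD(2)[OF this(1) e] order_tendstoD(2)[OF this(2), of "r/4"] r(1)
      have "\<forall>\<^sub>F k in sequentially. t k * ?C < e \<and> t k * norm v < r / 4" by (intro eventually_conj) auto
      then show "\<forall>\<^sub>F k in sequentially. \<forall>w\<in>ball w0 r. dist (q k w) (cnj (dL v H z w)) < e"
        by eventually_elim (use est order_le_less_trans in blast)
    qed
    then show "\<exists>r>0. ball w0 r \<subseteq> S \<and> uniform_limit (ball w0 r) q (\<lambda>w. cnj (dL v H z w)) sequentially"
      using r by blast
  qed
qed

lemma sesqui_dR:
  assumes "open S" "sesqui S H"
  shows "sesqui S (dR v H)"
  unfolding dR_def by (intro sesqui_conj_swap sesqui_dL assms)

lemma has_derivative_0_of_quadratic:
  fixes f :: "'a::real_normed_vector \<Rightarrow> 'b::real_normed_vector"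
  assumes r: "r > 0" and le: "\<And>y. norm (y - x) < r \<Longrightarrow> norm (f y) \<le> C * (norm (y - x))\<^sup>2" and "f x = 0"
  shows "(f has_derivative (\<lambda>_. 0)) (at x)"
proof (rule has_derivativeI_sandwich[OF r, where s=UNIV and f=f and x=x and f'="\<lambda>_. 0" and H="\<lambda>y. C * norm (y - x)"])
  fix y assume y: "y \<noteq> x" "dist y x < r"
  have n: "norm (y - x) > 0" using y(1) by simp
  have "norm (f y) \<le> C * (norm (y - x))\<^sup>2" by (rule le) (use y(2) in \<open>simp only: dist_norm\<close>)
  also have "\<dots> = C * norm (y - x) * norm (y - x)" by (simp only: power2_eq_square mult.assoc)
  finally have "norm (f y) / norm (y - x) \<le> C * norm (y - x)" using n by (simp only: pos_divide_le_eq)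
  then show "norm (f y - f x - 0) / norm (y - x) \<le> C * norm (y - x)" using assms(3) by simp
next
  have "((\<lambda>y. C * norm (y - x)) \<longlongrightarrow> C * norm (x - x)) (at x)" by (intro tendsto_intros)
  then show "((\<lambda>y. C * norm (y - x)) \<longlongrightarrow> 0) (at x)" by simp
qed (rule bounded_linear_zero)

text \<open>The mixed second difference \<open>M\<close> measures the failure of the increments in
  the two arguments to add up. Applying \<open>Cauchy_Lipschitz\<close> in each argument in turn
  shows that it is of second order, so the two partial derivatives simply add on the
  diagonal.\<close>

lemma sesqui_diag_has_derivative:
  assumes H: "sesqui S H" and z: "z \<in> S"
  shows "((\<lambda>z. H z z) has_derivative (\<lambda>v. dL v H z z + dR v H z z)) (at z)"
proof -
  obtain r B where r: "r > 0" "ball z r \<subseteq> S"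
    and B': "\<forall>x\<in>ball z r. \<forall>w\<in>ball z r. cmod (H x w) \<le> B"
    using H[unfolded sesqui_def, THEN conjunct2, THEN conjunct2, THEN bspec, OF z, THEN bspec, OF z]
    by (elim exE conjE)
  have B: "cmod (H x w) \<le> B" if "x \<in> ball z r" "w \<in> ball z r" for x w
    using B' that by blast
  define M where "M y = H y y - H y z - H z y + H z z" for y
  have zr: "z \<in> ball z (r/2)" using r by simp
  have half: "x \<in> ball z r" if "x \<in> ball z (r/2)" for x using that r by simp
  have M: "(M has_derivative (\<lambda>_. 0)) (at z)"
  proof (rule has_derivative_0_of_quadratic[where r="r/2" and C="2 * (2 * B / r) / r"])
    fix y assume "norm (y - z) < r / 2"
    then have y: "y \<in> ball z (r/2)" by (simp add: dist_norm norm_minus_commute)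
    have yS: "y \<in> S" using half[OF y] r by blast
    have bd: "cmod (cnj (H y w) - cnj (H z w)) \<le> 2 * B / r * norm (y - z)" if w: "w \<in> ball z r" for w
    proof -
      have "w \<in> S" using w r by blast
      then have "holomorphic_Cn_on (ball z r) (\<lambda>z. H z w)"
        using holomorphic_Cn_on_subset[OF sesquiD(1)[OF H] r(2)] by blast
      from Cauchy_Lipschitz[OF this B[OF _ w] r(1) y zr]
      show ?thesis by (simp flip: complex_cnj_diff)
    qed
    have hol: "holomorphic_Cn_on (ball z r) (\<lambda>w. cnj (H y w) - cnj (H z w))"
      by (intro holomorphic_Cn_on_diff holomorphic_Cn_on_subset[OF sesquiD(2)[OF H] r(2)] yS z)
    \<comment> \<open>Second application: the function of \<open>w\<close> is already bounded by a
      multiple of \<open>norm (y - z)\<close>, and its increment supplies the second such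
      factor.\<close>
    have "cmod ((cnj (H y y) - cnj (H z y)) - (cnj (H y z) - cnj (H z z))) \<le> 2 * (2 * B / r * norm (y - z)) / r * norm (y - z)"
      by (rule Cauchy_Lipschitz[OF hol bd r(1) y zr])
    moreover have "(cnj (H y y) - cnj (H z y)) - (cnj (H y z) - cnj (H z z)) = cnj (M y)" by (simp add: M_def)
    ultimately show "cmod (M y) \<le> 2 * (2 * B / r) / r * (norm (y - z))\<^sup>2"
      by (simp add: power2_eq_square mult_ac)
  qed (use r in \<open>auto simp: M_def\<close>)
  have "((\<lambda>y. H y z + H z y - H z z + M y) has_derivative (\<lambda>v. dL v H z z + dR v H z z - 0 + 0)) (at z)"
    by (intro has_derivative_add has_derivative_diff has_derivative_const dL_has_derivative[OF H z z] dR_has_derivative[OF H z z] M)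
  then show ?thesis by (simp add: M_def)
qed

lemma sesqui_diag_continuous:
  assumes "sesqui S H"
  shows "continuous_on S (\<lambda>z. H z z)"
  using sesqui_diag_has_derivative[OF assms] by (meson continuous_at_imp_continuous_on has_derivative_continuous)

subsection \<open>The Bergman metric along complex lines\<close>

context bounded_open_set
begin

text \<open>Antiholomorphy in the second argument is hermitian symmetry; joint local boundedness
  follows from \<open>kernel_bound\<close>, which controls K(z, w) by the diagonal values.\<close>

lemma sesqui_K: "sesqui \<Omega> K"
  unfolding sesqui_def
proof (intro conjI ballI)
  show "holomorphic_Cn_on \<Omega> (\<lambda>z. K z w)" if "w \<in> \<Omega>" for w
    by (rule bergmanD(1)[OF bergman_kernel_props(1)[OF that]])
  then show "holomorphic_Cn_on \<Omega> (\<lambda>w. cnj (K z w))" if "z \<in> \<Omega>" for z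
    unfolding kernel_hermitian[of z, symmetric] using that by (simp add: kernel_hermitian[symmetric])
next
  fix z0 w0 assume zw: "z0 \<in> \<Omega>" "w0 \<in> \<Omega>"
  obtain r1 B1 where 1: "r1 > 0" "ball z0 r1 \<subseteq> \<Omega>" "\<And>z. z \<in> ball z0 r1 \<Longrightarrow> Re (K z z) \<le> B1"
    using kernel_locally_bounded[OF zw(1)] by blast
  obtain r2 B2 where 2: "r2 > 0" "ball w0 r2 \<subseteq> \<Omega>" "\<And>z. z \<in> ball w0 r2 \<Longrightarrow> Re (K z z) \<le> B2"
    using kernel_locally_bounded[OF zw(2)] by blast
  define r where "r = min r1 r2"
  have r: "r > 0" "ball z0 r \<subseteq> ball z0 r1" "ball w0 r \<subseteq> ball w0 r2" using 1 2 by (auto simp: r_def)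
  have B: "cmod (K z w) \<le> sqrt (B2 * B1)" if z: "z \<in> ball z0 r" and w: "w \<in> ball w0 r" for z w
  proof (rule real_le_rsqrt)
    have z1: "z \<in> ball z0 r1" and w2: "w \<in> ball w0 r2" using z w r by blast+
    then have zO: "z \<in> \<Omega>" and wO: "w \<in> \<Omega>" using 1 2 by blast+
    have "(cmod (K z w))\<^sup>2 \<le> Re (K w w) * Re (K z z)" by (rule kernel_bound[OF zO wO])
    also have "\<dots> \<le> B2 * B1"
      using 1(3)[OF z1] 2(3)[OF w2] kernel_pos[OF zO] kernel_pos[OF wO] by (intro mult_mono) auto
    finally show "(cmod (K z w))\<^sup>2 \<le> B2 * B1" .
  qed
  show "\<exists>r>0. \<exists>B. ball z0 r \<subseteq> \<Omega> \<and> ball w0 r \<subseteq> \<Omega> \<and> (\<forall>z\<in>ball z0 r. \<forall>w\<in>ball w0 r. cmod (K z w) \<le> B)"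
    by (rule exI[of _ r], intro conjI r(1), rule exI[of _ "sqrt (B2 * B1)"], intro conjI ballI B)
       (use r 1 2 in blast)+
qed

lemma dL_K: "dL v K z w = cnj (dR v K w z)"
proof -
  have "conj_swap K = K" by (intro ext) (simp add: conj_swap_def kernel_hermitian[symmetric])
  then show ?thesis by (simp add: dR_def conj_swap_def)
qed

lemma K_diag_real: "z \<in> \<Omega> \<Longrightarrow> K z z = of_real (Re (K z z))"
  using kernel_diag[of z] by simp

lemma K_diag_nonzero: "z \<in> \<Omega> \<Longrightarrow> K z z \<noteq> 0"
  using kernel_pos[of z] by auto

definition pot :: "complex^'n \<Rightarrow> real" where
  "pot z = ln (Re (K z z))"

text \<open>\<open>P v\<close> is the antiholomorphic derivative of the potential \<open>log K\<close> in the direction \<open>v\<close>.\<close>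

definition P :: "complex^'n \<Rightarrow> complex^'n \<Rightarrow> complex" where
  "P v z = dR v K z z / K z z"

text \<open>By hermitian symmetry the derivatives in the two arguments are conjugate to each other
  on the diagonal, hence the factor 2 and the real part.\<close>

lemma pot_has_derivative:
  assumes z: "z \<in> \<Omega>"
  shows "(pot has_derivative (\<lambda>v. 2 * Re (P v z))) (at z)"
proof -
  have "((\<lambda>z. Re (K z z)) has_derivative (\<lambda>v. Re (dL v K z z + dR v K z z))) (at z)"
    by (intro derivative_intros sesqui_diag_has_derivative[OF sesqui_K z])
  from has_derivative_ln[OF kernel_pos[OF z] this]
  have "(pot has_derivative (\<lambda>v. Re (dL v K z z + dR v K z z) * inverse (Re (K z z)))) (at z)"
    unfolding pot_def[abs_def] .
  moreover have "Re (dL v K z z + dR v K z z) * inverse (Re (K z z)) = 2 * Re (P v z)" for v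
  proof -
    obtain \<kappa> where k: "K z z = complex_of_real \<kappa>" using K_diag_real[OF z] by blast
    show ?thesis unfolding P_def dL_K k
      by (simp only: Re_divide_of_real Re_complex_of_real plus_complex.sel cnj.sel) (simp add: divide_inverse)
  qed
  ultimately show ?thesis by simp
qed

definition P' :: "complex^'n \<Rightarrow> complex^'n \<Rightarrow> complex^'n \<Rightarrow> complex" where
  "P' v z u = ((dL u (dR v K) z z + dR u (dR v K) z z) * K z z - dR v K z z * (dL u K z z + dR u K z z)) / (K z z * K z z)"

lemma P_has_derivative:
  assumes z: "z \<in> \<Omega>"
  shows "(P v has_derivative P' v z) (at z)"
proof -
  have "((\<lambda>z. dR v K z z / K z z) has_derivative P' v z) (at z)"
    unfolding P'_def[abs_def]
    by (intro has_derivative_divide' sesqui_diag_has_derivative[OF sesqui_K z]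
        sesqui_diag_has_derivative[OF sesqui_dR[OF open_domain sesqui_K] z] K_diag_nonzero[OF z])
  then show ?thesis by (simp add: P_def[abs_def])
qed

lemma P'_continuous: "continuous_on \<Omega> (\<lambda>z. P' v z u)"
proof -
  note sR = sesqui_dR[OF open_domain sesqui_K, of v]
  note c = sesqui_diag_continuous[OF sesqui_K] sesqui_diag_continuous[OF sR]
    sesqui_diag_continuous[OF sesqui_dL[OF open_domain sR, of u]] sesqui_diag_continuous[OF sesqui_dR[OF open_domain sR, of u]]
    sesqui_diag_continuous[OF sesqui_dL[OF open_domain sesqui_K, of u]] sesqui_diag_continuous[OF sesqui_dR[OF open_domain sesqui_K, of u]]
  show ?thesis
    unfolding P'_def
    by (rule continuous_on_divide; (intro continuous_on_mult continuous_on_add continuous_on_diff c)?)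
       (simp add: K_diag_nonzero)
qed

lemma P_scale: "z \<in> \<Omega> \<Longrightarrow> P (c *s v) z = cnj c * P v z"
  by (simp add: P_def dR_scale[OF sesqui_K])

lemma P_sum: "z \<in> \<Omega> \<Longrightarrow> P v z = (\<Sum>k\<in>UNIV. cnj (v $ k) * P (axis k 1) z)"
  unfolding P_def by (subst dR_sum[OF sesqui_K]) (simp_all add: sum_divide_distrib)

lemma axis_i: "axis k \<i> = \<i> *s (axis k 1 :: complex^'n)"
  by (simp add: vec_eq_iff axis_def)

lemma dzbar_pot:
  assumes z: "z \<in> \<Omega>"
  shows "dzbar k (\<lambda>w. complex_of_real (pot w)) z = P (axis k 1) z"
proof -
  have "((\<lambda>w. complex_of_real (pot w)) has_derivative (\<lambda>v. complex_of_real (2 * Re (P v z)))) (at z)"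
    by (intro has_derivative_of_real pot_has_derivative[OF z])
  from frechet_derivative_at[OF this, symmetric]
  show ?thesis unfolding dzbar_def axis_i by (simp add: P_scale[OF z] complex_eq_iff)
qed

lemma dz_dzbar_pot:
  assumes z: "z \<in> \<Omega>"
  shows "dz j (dzbar k (\<lambda>w. complex_of_real (pot w))) z = (P' (axis k 1) z (axis j 1) - \<i> * P' (axis k 1) z (axis j \<i>)) / 2"
proof -
  have "(dzbar k (\<lambda>w. complex_of_real (pot w)) has_derivative P' (axis k 1) z) (at z)"
    by (rule has_derivative_transform_within_open[OF P_has_derivative[OF z] open_domain z]) (simp add: dzbar_pot)
  from frechet_derivative_at[OF this, symmetric] show ?thesis by (simp add: dz_def)
qed

text \<open>The squared length of \<open>v\<close> in the Bergman metric, that is \<omega>(v, i v).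
  In complex notation it is the real part of 2 \<partial>_v applied to \<open>P v\<close>, written
  out with real derivatives.\<close>

definition dens :: "complex^'n \<Rightarrow> complex^'n \<Rightarrow> real" where
  "dens v z = Re (P' v z v) + Im (P' v z (\<i> *s v))"

lemma P'_sum:
  assumes z: "z \<in> \<Omega>"
  shows "P' v z u = (\<Sum>k\<in>UNIV. cnj (v $ k) * P' (axis k 1) z u)"
proof -
  have "((\<lambda>z. \<Sum>k\<in>UNIV. cnj (v $ k) * P (axis k 1) z) has_derivative (\<lambda>u. \<Sum>k\<in>UNIV. cnj (v $ k) * P' (axis k 1) z u)) (at z)"
    by (intro has_derivative_sum has_derivative_mult_right P_has_derivative[OF z])
  then have "(P v has_derivative (\<lambda>u. \<Sum>k\<in>UNIV. cnj (v $ k) * P' (axis k 1) z u)) (at z)"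
    by (rule has_derivative_transform_within_open[OF _ open_domain z]) (rule P_sum[symmetric])
  from has_derivative_unique[OF this P_has_derivative[OF z]] show ?thesis by (simp add: fun_eq_iff)
qed

text \<open>The left side is twice the complex linear part of \<open>L\<close>, hence determined by
  its values on the coordinate vectors.\<close>

lemma real_linear_complex_coords:
  fixes L :: "complex^'n \<Rightarrow> complex"
  assumes L: "linear L"
  shows "L v - \<i> * L (\<i> *s v) = (\<Sum>j\<in>UNIV. v $ j * (L (axis j 1) - \<i> * L (axis j \<i>)))"
proof -
  have c: "L (c *s w) = of_real (Re c) * L w + of_real (Im c) * L (\<i> *s w)" for c w
  proof -
    have "c *s w = Re c *\<^sub>R w + Im c *\<^sub>R (\<i> *s w)"
      by (simp add: scaleR_smult_complex vector_smult_assoc flip: vector_sadd_rdistrib) (simp add: complex_eq_iff mult.commute)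
    then have "L (c *s w) = Re c *\<^sub>R L w + Im c *\<^sub>R L (\<i> *s w)"
      by (simp only: linear_add[OF L] linear_cmul[OF L])
    then show ?thesis by (simp add: scaleR_conv_of_real)
  qed
  have iv: "(\<Sum>j\<in>UNIV. (\<i> * v $ j) *s axis j 1) = \<i> *s v"
    using basis_expansion[of "\<i> *s v"] by simp
  have "L (\<Sum>j\<in>UNIV. (v $ j) *s axis j 1) = (\<Sum>j\<in>UNIV. L ((v $ j) *s axis j 1))" by (rule linear_sum[OF L])
  then have "L v = (\<Sum>j\<in>UNIV. L ((v $ j) *s axis j 1))" unfolding basis_expansion .
  moreover have "L (\<Sum>j\<in>UNIV. (\<i> * v $ j) *s axis j 1) = (\<Sum>j\<in>UNIV. L ((\<i> * v $ j) *s axis j 1))" by (rule linear_sum[OF L])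
  then have "L (\<i> *s v) = (\<Sum>j\<in>UNIV. L ((\<i> * v $ j) *s axis j 1))" unfolding iv .
  ultimately have "L v - \<i> * L (\<i> *s v) = (\<Sum>j\<in>UNIV. L ((v $ j) *s axis j 1) - \<i> * L ((\<i> * v $ j) *s axis j 1))"
    by (simp add: sum_subtractf sum_distrib_left)
  also have "\<dots> = (\<Sum>j\<in>UNIV. v $ j * (L (axis j 1) - \<i> * L (axis j \<i>)))"
  proof (rule sum.cong[OF refl])
    fix j
    show "L ((v $ j) *s axis j 1) - \<i> * L ((\<i> * v $ j) *s axis j 1) = v $ j * (L (axis j 1) - \<i> * L (axis j \<i>))"
      unfolding axis_i[of j] c[of "v $ j" "axis j 1"] c[of "\<i> * v $ j" "axis j 1"]
      by (simp add: complex_eq_iff algebra_simps)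
  qed
  finally show ?thesis .
qed

text \<open>The link between the coordinate definition of the Bergman form and derivatives along a
  single complex line, where the disc argument takes place.\<close>

lemma bergman_form_line:
  assumes z: "z \<in> \<Omega>"
  shows "bergman_form \<Omega> z (c *s v) (\<i> *s (c *s v)) = (cmod c)\<^sup>2 * dens v z"
proof -
  define A where "A j k = dz j (dzbar k (\<lambda>w. complex_of_real (pot w))) z" for j k
  have A: "A j k = (P' (axis k 1) z (axis j 1) - \<i> * P' (axis k 1) z (axis j \<i>)) / 2" for j k
    unfolding A_def by (rule dz_dzbar_pot[OF z])
  have lin: "linear (P' v z)" using P_has_derivative[OF z] has_derivative_linear by blast
  have "bergman_form \<Omega> z (c *s v) (\<i> *s (c *s v)) = Re (\<i> * (\<Sum>j\<in>UNIV. \<Sum>k\<in>UNIV. A j k *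
      ((c *s v) $ j * cnj ((\<i> *s (c *s v)) $ k) - (\<i> *s (c *s v)) $ j * cnj ((c *s v) $ k))))"
    unfolding bergman_form_def i_ddbar_def A_def pot_def K_def ..
  also have "(\<Sum>j\<in>UNIV. \<Sum>k\<in>UNIV. A j k *
      ((c *s v) $ j * cnj ((\<i> *s (c *s v)) $ k) - (\<i> *s (c *s v)) $ j * cnj ((c *s v) $ k)))
      = (\<Sum>j\<in>UNIV. \<Sum>k\<in>UNIV. (- 2 * \<i> * of_real ((cmod c)\<^sup>2)) * (A j k * v $ j * cnj (v $ k)))"
    by (intro sum.cong refl) (simp add: complex_norm_square algebra_simps del: of_real_power)
  also have "\<dots> = (- 2 * \<i> * of_real ((cmod c)\<^sup>2)) * (\<Sum>j\<in>UNIV. \<Sum>k\<in>UNIV. A j k * v $ j * cnj (v $ k))"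
    by (simp only: sum_distrib_left)
  also have "(\<Sum>j\<in>UNIV. \<Sum>k\<in>UNIV. A j k * v $ j * cnj (v $ k)) = (P' v z v - \<i> * P' v z (\<i> *s v)) / 2"
  proof -
    have "P' v z v - \<i> * P' v z (\<i> *s v) = (\<Sum>j\<in>UNIV. v $ j * (P' v z (axis j 1) - \<i> * P' v z (axis j \<i>)))"
      by (rule real_linear_complex_coords[OF lin])
    also have "\<dots> = (\<Sum>j\<in>UNIV. \<Sum>k\<in>UNIV. 2 * (A j k * v $ j * cnj (v $ k)))"
      unfolding P'_sum[OF z, of v] A
      by (intro sum.cong refl) (simp add: sum_distrib_left flip: sum_subtractf, intro sum.cong refl, simp add: field_simps)
    finally show ?thesis by (simp add: sum_distrib_left[symmetric])
  qed
  finally show ?thesis by (simp add: dens_def algebra_simps)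
qed

text \<open>The quotient rule for the mixed second derivative of log K(z, z), with denominators
  cleared. The right side has the shape of a Gram determinant, so its sign is a Cauchy-Schwarz
  question.\<close>

lemma dens_formula:
  assumes z: "z \<in> \<Omega>"
  shows "dens v z * (Re (K z z))\<^sup>2 = 2 * (Re (dL v (dR v K) z z) * Re (K z z) - (cmod (dR v K z z))\<^sup>2)"
proof -
  note sR = sesqui_dR[OF open_domain sesqui_K, of v]
  have K0: "K z z \<noteq> 0" by (rule K_diag_nonzero[OF z])
  define X where "X = (dL v (dR v K) z z * K z z - dR v K z z * dL v K z z) / (K z z * K z z)"
  have "P' v z v - \<i> * P' v z (\<i> *s v) = 2 * X"
    unfolding P'_def X_def dL_scale[OF sR z z] dR_scale[OF sR z z] dL_scale[OF sesqui_K z z] dR_scale[OF sesqui_K z z]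
    using K0 by (simp add: field_simps)
  moreover have "dens v z = Re (P' v z v - \<i> * P' v z (\<i> *s v))" by (simp add: dens_def)
  ultimately have d: "dens v z = 2 * Re X" by simp
  obtain \<kappa> where k: "K z z = complex_of_real \<kappa>" using K_diag_real[OF z] by blast
  then have k0: "\<kappa> \<noteq> 0" using K0 by auto
  define N where "N = dR v K z z"
  define D where "D = dL v (dR v K) z z"
  have "X = (D * of_real \<kappa> - N * cnj N) / (of_real \<kappa> * of_real \<kappa>)"
    unfolding X_def dL_K[of v z z] k N_def D_def ..
  also have "\<dots> = (D * of_real \<kappa> - of_real ((cmod N)\<^sup>2)) / of_real (\<kappa> * \<kappa>)"
    by (simp only: complex_norm_square of_real_mult)
  finally have "Re X = (Re D * \<kappa> - (cmod N)\<^sup>2) / (\<kappa> * \<kappa>)"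
    by (simp only: Re_divide_of_real minus_complex.sel Re_complex_of_real times_complex.sel Im_complex_of_real mult_zero_right diff_zero)
  then have "Re X * \<kappa>\<^sup>2 = Re D * \<kappa> - (cmod N)\<^sup>2"
    using k0 by (simp add: power2_eq_square)
  then have "Re X * (Re (K z z))\<^sup>2 = Re (dL v (dR v K) z z) * Re (K z z) - (cmod (dR v K z z))\<^sup>2"
    unfolding k N_def D_def by simp
  then show ?thesis unfolding d by simp
qed

text \<open>The extremal inequality for the difference of the columns at z + s v and at z, divided
  by s^2 as s tends to 0, becomes exactly the inequality between the two terms in
  \<open>dens_formula\<close>.\<close>

lemma dens_nonneg:
  assumes z: "z \<in> \<Omega>"
  shows "0 \<le> dens v z"
proof -
  note sR = sesqui_dR[OF open_domain sesqui_K, of v]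
  obtain r where r: "r > 0" "ball z r \<subseteq> \<Omega>" using open_domain z open_contains_ball by blast
  define \<delta> where "\<delta> = r / (norm v + 1)"
  have \<delta>: "\<delta> > 0" unfolding \<delta>_def using r(1) by (intro divide_pos_pos add_nonneg_pos) auto
  let ?p = "\<lambda>s. z + s *\<^sub>R v"
  have inO: "?p s \<in> \<Omega>" if s: "\<bar>s\<bar> < \<delta>" for s
  proof -
    have "\<bar>s\<bar> * (norm v + 1) < r" using s unfolding \<delta>_def by (subst (asm) pos_less_divide_eq) (auto intro: add_nonneg_pos)
    then have "\<bar>s\<bar> * norm v < r" by (simp add: distrib_left)
    then have "?p s \<in> ball z r" by (simp add: dist_norm)
    then show ?thesis using r(2) by blast
  qed
  have dp: "(?p has_derivative (\<lambda>h. h *\<^sub>R v)) (at s)" for s by (auto intro!: derivative_eq_intros)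
  have diag: "((\<lambda>s. Re (H (?p s) (?p s))) has_real_derivative Re (dL v H (?p s) (?p s) + dR v H (?p s) (?p s))) (at s)"
    if H: "sesqui \<Omega> H" and s: "\<bar>s\<bar> < \<delta>" for H s
  proof -
    note D = sesqui_diag_has_derivative[OF H inO[OF s]]
    have l: "linear (\<lambda>u. dL u H (?p s) (?p s) + dR u H (?p s) (?p s))" using D has_derivative_linear by blast
    from has_derivative_Re[OF has_derivative_compose[OF dp D]]
    show ?thesis unfolding has_field_derivative_def
      by (rule has_derivative_eq_rhs) (simp add: fun_eq_iff linear_cmul[OF l] mult.commute)
  qed
  have right: "((\<lambda>s. Re (H z (?p s))) has_real_derivative Re (dR v H z (?p s))) (at s)"
    if H: "sesqui \<Omega> H" and s: "\<bar>s\<bar> < \<delta>" for H s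
  proof -
    note D = dR_has_derivative[OF H z inO[OF s]]
    have l: "linear (\<lambda>u. dR u H z (?p s))" using D has_derivative_linear by blast
    from has_derivative_Re[OF has_derivative_compose[OF dp D]]
    show ?thesis unfolding has_field_derivative_def
      by (rule has_derivative_eq_rhs) (simp add: fun_eq_iff linear_cmul[OF l] mult.commute)
  qed
  \<comment> \<open>The squared norm of the difference of the columns at z + s v and at z, expanded
    by the reproducing property.\<close>
  define M where "M s = Re (K (?p s) (?p s)) - 2 * Re (K z (?p s)) + Re (K z z)" for s
  define M1 where "M1 s = 2 * Re (dR v K (?p s) (?p s)) - 2 * Re (dR v K z (?p s))" for s
  have p0: "?p 0 = z" by simp
  have MD: "(M has_real_derivative M1 s) (at s)" if s: "\<bar>s\<bar> < \<delta>" for s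
  proof -
    have "(M has_real_derivative Re (dL v K (?p s) (?p s) + dR v K (?p s) (?p s)) - 2 * Re (dR v K z (?p s)) + 0) (at s)"
      unfolding M_def[abs_def]
      by (intro DERIV_add DERIV_diff DERIV_cmult DERIV_const diag[OF sesqui_K s] right[OF sesqui_K s])
    then show ?thesis unfolding M1_def dL_K by simp
  qed
  \<comment> \<open>In the derivative of \<open>M1\<close> at 0 the two terms with both derivatives
    in the second argument cancel, leaving only the mixed derivative.\<close>
  define G where "G = 2 * Re (dL v (dR v K) z z)"
  have "(M1 has_real_derivative 2 * Re (dL v (dR v K) (?p 0) (?p 0) + dR v (dR v K) (?p 0) (?p 0)) - 2 * Re (dR v (dR v K) z (?p 0))) (at 0)"
    unfolding M1_def[abs_def]
    by (intro DERIV_diff DERIV_cmult diag[OF sR] right[OF sR]) (use \<delta> in auto)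
  then have M1D: "(M1 has_real_derivative G) (at 0)" unfolding p0 G_def by (simp add: algebra_simps)
  have M10: "M1 0 = 0" and M0: "M 0 = 0" unfolding M1_def M_def p0 by simp_all
  have ev: "\<forall>\<^sub>F s in at_right 0. 0 < s \<and> s < \<delta>" using \<delta> eventually_at_right[of 0 \<delta>] by auto
  \<comment> \<open>One use of l'Hopital's rule suffices: the quotient of derivatives is half the
    difference quotient of \<open>M1\<close> at 0.\<close>
  have lim: "((\<lambda>s. M s / s\<^sup>2) \<longlongrightarrow> G / 2) (at_right 0)"
  proof (rule lhopital_right_0[where f'=M1 and g'="\<lambda>s. 2 * s"])
    have "(M \<longlongrightarrow> M 0) (at_right 0)"
      using DERIV_isCont[OF MD[of 0]] \<delta> by (auto simp: isCont_def intro: filterlim_at_within_not_equal tendsto_within_subset)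
    then show "(M \<longlongrightarrow> 0) (at_right 0)" by (simp add: M0)
    have "((\<lambda>s::real. s\<^sup>2) \<longlongrightarrow> 0\<^sup>2) (at_right 0)" by (intro tendsto_intros)
    then show "((\<lambda>s::real. s\<^sup>2) \<longlongrightarrow> 0) (at_right 0)" by simp
    show "\<forall>\<^sub>F s in at_right (0::real). s\<^sup>2 \<noteq> 0" "\<forall>\<^sub>F s in at_right (0::real). 2 * s \<noteq> 0"
      using ev by (auto elim!: eventually_mono)
    show "\<forall>\<^sub>F s in at_right 0. (M has_real_derivative M1 s) (at s)"
      using ev by eventually_elim (intro MD, simp)
    show "\<forall>\<^sub>F s in at_right 0. ((\<lambda>s::real. s\<^sup>2) has_real_derivative 2 * s) (at s)"
      by (intro always_eventually allI) (auto intro!: derivative_eq_intros)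
    have "((\<lambda>s. (M1 s - M1 0) / (s - 0)) \<longlongrightarrow> G) (at 0)"
      using M1D by (simp add: has_field_derivative_iff)
    then have "((\<lambda>s. M1 s / s) \<longlongrightarrow> G) (at 0)" by (simp add: M10)
    then have "((\<lambda>s. M1 s / s) \<longlongrightarrow> G) (at_right 0)" by (rule tendsto_within_subset) simp
    from tendsto_divide[OF this tendsto_const[of 2]]
    show "((\<lambda>s. M1 s / (2 * s)) \<longlongrightarrow> G / 2) (at_right 0)" by (simp add: mult.commute)
  qed
  have lim2: "((\<lambda>s. (cmod (K z (?p s) - K z z))\<^sup>2 / s\<^sup>2) \<longlongrightarrow> (cmod (dR v K z z))\<^sup>2) (at_right 0)"
  proof -
    have "((\<lambda>w. K z w) has_derivative (\<lambda>u. dR u K z z)) (at (?p 0))" using dR_has_derivative[OF sesqui_K z z] by simp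
    from has_derivative_compose[OF dp this]
    have "((\<lambda>s. K z (?p s)) has_derivative (\<lambda>h. dR (h *\<^sub>R v) K z z)) (at 0)" .
    moreover have "dR (h *\<^sub>R v) K z z = h *\<^sub>R dR v K z z" for h
      unfolding scaleR_smult_complex by (simp add: dR_scale[OF sesqui_K z z] scaleR_conv_of_real)
    ultimately have D: "((\<lambda>s. K z (?p s)) has_derivative (\<lambda>h. h *\<^sub>R dR v K z z)) (at 0)" by simp
    have "((\<lambda>s. Re (K z (?p s))) has_real_derivative Re (dR v K z z)) (at 0)"
      "((\<lambda>s. Im (K z (?p s))) has_real_derivative Im (dR v K z z)) (at 0)"
      unfolding has_field_derivative_def
      by (rule has_derivative_eq_rhs[OF has_derivative_Re[OF D]] has_derivative_eq_rhs[OF has_derivative_Im[OF D]],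
          simp add: fun_eq_iff mult.commute)+
    then have "((\<lambda>s. (Re (K z (?p s)) - Re (K z z)) / s) \<longlongrightarrow> Re (dR v K z z)) (at 0)"
      "((\<lambda>s. (Im (K z (?p s)) - Im (K z z)) / s) \<longlongrightarrow> Im (dR v K z z)) (at 0)"
      by (simp_all add: has_field_derivative_iff)
    then have "((\<lambda>s. ((Re (K z (?p s)) - Re (K z z)) / s)\<^sup>2 + ((Im (K z (?p s)) - Im (K z z)) / s)\<^sup>2)
        \<longlongrightarrow> (Re (dR v K z z))\<^sup>2 + (Im (dR v K z z))\<^sup>2) (at 0)" by (intro tendsto_intros)
    then have "((\<lambda>s. (cmod (K z (?p s) - K z z))\<^sup>2 / s\<^sup>2) \<longlongrightarrow> (cmod (dR v K z z))\<^sup>2) (at 0)"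
      unfolding cmod_power2 power_divide add_divide_distrib by simp
    then show ?thesis by (rule tendsto_within_subset) simp
  qed
  have le: "(cmod (K z (?p s) - K z z))\<^sup>2 \<le> M s * Re (K z z)" if s: "\<bar>s\<bar> < \<delta>" for s
  proof -
    note k1 = bergman_kernel_props(1)[OF inO[OF s]] and k0 = bergman_kernel_props(1)[OF z]
    have "(cmod (K z (?p s) + (-1) * K z z))\<^sup>2 \<le> sqn (\<lambda>x. K x (?p s) + (-1) * K x z) * Re (K z z)"
      by (rule bergman_extremal[OF bergman_lincomb[OF k1 k0] z])
    also have "sqn (\<lambda>x. K x (?p s) + (-1) * K x z) = M s"
      unfolding sqn_lincomb[OF k1 k0] bergman_kernel_props(2)[OF z k1, symmetric] M_def
      using kernel_diag[OF z] kernel_diag[OF inO[OF s]] by simp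
    finally show ?thesis by simp
  qed
  have "(cmod (dR v K z z))\<^sup>2 \<le> G / 2 * Re (K z z)"
  proof (rule tendsto_le[OF _ _ lim2])
    show "((\<lambda>s. M s / s\<^sup>2 * Re (K z z)) \<longlongrightarrow> G / 2 * Re (K z z)) (at_right 0)"
      by (intro tendsto_intros lim)
    show "\<forall>\<^sub>F s in at_right 0. (cmod (K z (?p s) - K z z))\<^sup>2 / s\<^sup>2 \<le> M s / s\<^sup>2 * Re (K z z)"
      using ev by eventually_elim (use le in \<open>simp add: divide_right_mono\<close>)
  qed simp
  then have "0 \<le> dens v z * (Re (K z z))\<^sup>2" unfolding dens_formula[OF z] G_def by simp
  then show ?thesis using kernel_pos[OF z] by (simp add: zero_le_mult_iff)
qed

end

subsection \<open>Boundary geometry\<close>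

lemma prod_Basis_complex_vec:
  fixes f :: "complex^'n \<Rightarrow> real"
  shows "(\<Prod>b\<in>Basis. f b) = (\<Prod>i\<in>UNIV. f (axis i 1) * f (axis i \<i>))"
proof -
  have B: "(Basis :: (complex^'n) set) = (\<lambda>(i, u). axis i u) ` (UNIV \<times> {1, \<i>})"
    by (auto simp: Basis_vec_def Basis_complex_def image_iff)
  have inj: "inj_on (\<lambda>(i, u). axis i u :: complex^'n) (UNIV \<times> {1, \<i>})"
    by (auto simp: inj_on_def axis_eq_axis)
  have "(\<Prod>b\<in>Basis. f b) = (\<Prod>(i, u)\<in>UNIV \<times> {1, \<i>}. f (axis i u))"
    unfolding B by (subst prod.reindex[OF inj]) (simp add: case_prod_beta o_def)
  also have "\<dots> = (\<Prod>i\<in>UNIV. \<Prod>u\<in>{1, \<i>}. f (axis i u))"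
    by (rule prod.cartesian_product[symmetric])
  finally show ?thesis by (simp add: complex_eq_iff)
qed

text \<open>Squares in the real and imaginary parts are taken instead of discs, so that the set is a
  box and its volume an explicit product.\<close>

definition coord_box :: "'n \<Rightarrow> complex \<Rightarrow> real \<Rightarrow> real \<Rightarrow> (complex^'n) set" where
  "coord_box j a \<alpha> \<beta> = {y. \<bar>Re (y $ j - a)\<bar> < \<alpha> \<and> \<bar>Im (y $ j - a)\<bar> < \<alpha> \<and> (\<forall>k. k \<noteq> j \<longrightarrow> \<bar>Re (y $ k)\<bar> < \<beta> \<and> \<bar>Im (y $ k)\<bar> < \<beta>)}"

lemma coord_box:
  fixes j :: "'n::finite"
  assumes "\<alpha> > 0" "\<beta> > 0"
  shows "coord_box j a \<alpha> \<beta> \<in> sets borel"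
    and "emeasure lborel (coord_box j a \<alpha> \<beta>) = ennreal ((2 * \<alpha>)\<^sup>2 * (4 * \<beta>\<^sup>2) ^ (CARD('n) - 1))"
proof -
  define l u :: "complex^'n" where "l = (\<chi> k. if k = j then a - Complex \<alpha> \<alpha> else Complex (-\<beta>) (-\<beta>))"
    and "u = (\<chi> k. if k = j then a + Complex \<alpha> \<alpha> else Complex \<beta> \<beta>)"
  have comp: "x \<bullet> axis k b = (x $ k) \<bullet> b" for x :: "complex^'n" and k b
    by (rule inner_axis)
  have Basis_iff: "(\<forall>b\<in>Basis. Q b) \<longleftrightarrow> (\<forall>k. Q (axis k 1) \<and> Q (axis k \<i>))" for Q :: "complex^'n \<Rightarrow> bool"
    by (auto simp: Basis_vec_def Basis_complex_def)
  have box: "coord_box j a \<alpha> \<beta> = box l u"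
  proof (rule set_eqI)
    fix y :: "complex^'n"
    let ?T = "\<lambda>k. Re (l $ k) < Re (y $ k) \<and> Re (y $ k) < Re (u $ k) \<and> Im (l $ k) < Im (y $ k) \<and> Im (y $ k) < Im (u $ k)"
    have Tj: "?T j \<longleftrightarrow> \<bar>Re (y $ j - a)\<bar> < \<alpha> \<and> \<bar>Im (y $ j - a)\<bar> < \<alpha>"
      by (auto simp: l_def u_def abs_less_iff)
    have Tk: "?T k \<longleftrightarrow> \<bar>Re (y $ k)\<bar> < \<beta> \<and> \<bar>Im (y $ k)\<bar> < \<beta>" if "k \<noteq> j" for k
      using that by (auto simp: l_def u_def abs_less_iff)
    have "y \<in> box l u \<longleftrightarrow> (\<forall>k. Re (l $ k) < Re (y $ k) \<and> Re (y $ k) < Re (u $ k) \<and> Im (l $ k) < Im (y $ k) \<and> Im (y $ k) < Im (u $ k))"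
      unfolding mem_box Basis_iff comp by (simp add: inner_complex_def)
    also have "\<dots> \<longleftrightarrow> y \<in> coord_box j a \<alpha> \<beta>"
      unfolding coord_box_def mem_Collect_eq using Tj Tk by metis
    finally show "y \<in> coord_box j a \<alpha> \<beta> \<longleftrightarrow> y \<in> box l u" by simp
  qed
  show "coord_box j a \<alpha> \<beta> \<in> sets borel" unfolding box by simp
  have le: "l \<bullet> b \<le> u \<bullet> b" if "b \<in> Basis" for b
  proof -
    have "\<forall>b\<in>Basis. l \<bullet> b \<le> u \<bullet> b" unfolding Basis_iff comp l_def u_def using assms by (simp add: inner_complex_def)
    then show ?thesis using that by blast
  qed
  have "(\<Prod>b\<in>Basis. (u - l) \<bullet> b) = (\<Prod>i\<in>UNIV. if i = j then (2 * \<alpha>)\<^sup>2 else 4 * \<beta>\<^sup>2)"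
    unfolding prod_Basis_complex_vec comp l_def u_def
    by (intro prod.cong refl) (auto simp: inner_complex_def power2_eq_square)
  also have "\<dots> = (2 * \<alpha>)\<^sup>2 * (\<Prod>i\<in>UNIV - {j}. 4 * \<beta>\<^sup>2)"
    by (subst prod.remove[of _ j]) (auto intro!: prod.cong)
  also have "\<dots> = (2 * \<alpha>)\<^sup>2 * (4 * \<beta>\<^sup>2) ^ (CARD('n) - 1)"
    by (simp add: card_Diff_singleton)
  finally show "emeasure lborel (coord_box j a \<alpha> \<beta>) = ennreal ((2 * \<alpha>)\<^sup>2 * (4 * \<beta>\<^sup>2) ^ (CARD('n) - 1))"
    unfolding box using le by (simp add: emeasure_lborel_box)
qed

definition cinner :: "complex^'n \<Rightarrow> complex^'n \<Rightarrow> complex" where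
  "cinner x y = (\<Sum>k\<in>UNIV. x $ k * cnj (y $ k))"

lemma cinner_simps:
  "cinner (x + y) v = cinner x v + cinner y v" "cinner (x - y) v = cinner x v - cinner y v" "cinner (c *s x) v = c * cinner x v"
  by (simp_all add: cinner_def sum.distrib sum_subtractf sum_distrib_left algebra_simps)

lemma Re_cinner: "Re (cinner x y) = x \<bullet> y"
  by (simp add: cinner_def inner_vec_def inner_complex_def)

lemma cinner_self: "cinner x x = of_real ((norm x)\<^sup>2)"
proof -
  have "Im (cinner x x) = 0" by (simp add: cinner_def mult.commute)
  moreover have "Re (cinner x x) = (norm x)\<^sup>2" by (simp add: Re_cinner power2_norm_eq_inner)
  ultimately show ?thesis by (simp add: complex_eq_iff)
qed

lemma linear_cinner: "linear (\<lambda>x. cinner x v)"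
  by (rule linearI) (simp_all add: cinner_simps scaleR_smult_complex scaleR_conv_of_real)

text \<open>Replaces the coordinate \<open>j\<close> by the normal component. For
  \<open>\<nu> $ j \<noteq> 0\<close> this is an invertible linear map, and sets described by the
  normal component and the remaining coordinates become boxes. It takes the place of a unitary frame
  containing \<open>\<nu>\<close>.\<close>

definition skew :: "complex^'n \<Rightarrow> 'n \<Rightarrow> complex^'n \<Rightarrow> complex^'n" where
  "skew \<nu> j y = (\<chi> k. if k = j then cinner y \<nu> else y $ k)"

lemma skew_measure:
  fixes \<nu> :: "complex^'n"
  assumes "\<nu> $ j \<noteq> 0"
  obtains c :: real where "c > 0"
    "\<And>A. A \<in> sets borel \<Longrightarrow> emeasure lborel (skew \<nu> j -` A) = ennreal c * emeasure lborel A"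
proof -
  have lin: "linear (skew \<nu> j)"
    by (rule linearI) (auto simp: skew_def vec_eq_iff linear_add[OF linear_cinner] linear_cmul[OF linear_cinner])
  have "inj (skew \<nu> j)"
    unfolding linear_injective_0[OF lin]
  proof (intro allI impI)
    fix y assume "skew \<nu> j y = 0"
    then have *: "\<And>k. skew \<nu> j y $ k = 0" by simp
    have k: "y $ k = 0" if "k \<noteq> j" for k using *[of k] that by (simp add: skew_def)
    have "cinner y \<nu> = (\<Sum>k\<in>UNIV. if k = j then y $ j * cnj (\<nu> $ j) else 0)"
      unfolding cinner_def by (intro sum.cong refl) (auto simp: k)
    then have "y $ j * cnj (\<nu> $ j) = 0" using *[of j] by (simp add: skew_def)
    then have "y $ j = 0" using assms by simp
    with k show "y = 0" by (metis vec_eq_iff zero_index)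
  qed
  then have "bij (skew \<nu> j)" using lin by (simp add: bij_def linear_injective_imp_surjective)
  with lin show ?thesis using emeasure_lborel_linear_vimage that by blast
qed

section \<open>Contact with a ball and a paraboloid at a farthest point\<close>

lemma differentiable_lipschitz_at:
  fixes f :: "'a::real_normed_vector \<Rightarrow> 'b::real_normed_vector"
  assumes "f differentiable (at x)"
  obtains M \<delta> where "\<delta> > 0" "M \<ge> 0" "\<And>y. norm (y - x) < \<delta> \<Longrightarrow> norm (f y - f x) \<le> M * norm (y - x)"
proof -
  obtain f' where f': "(f has_derivative f') (at x)" using assms differentiable_def by blast
  then have bl: "bounded_linear f'" by (rule has_derivative_bounded_linear)
  obtain \<delta> where d: "\<delta> > 0" "\<And>y. norm (y - x) < \<delta> \<Longrightarrow> norm (f y - f x - f' (y - x)) \<le> 1 * norm (y - x)"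
    using f'[unfolded has_derivative_at_alt, THEN conjunct2, rule_format, of 1] by auto
  have "norm (f y - f x) \<le> (1 + onorm f') * norm (y - x)" if y: "norm (y - x) < \<delta>" for y
  proof -
    have "norm (f y - f x) \<le> norm (f y - f x - f' (y - x)) + norm (f' (y - x))"
      using norm_triangle_ineq[of "f y - f x - f' (y - x)" "f' (y - x)"] by simp
    also have "\<dots> \<le> 1 * norm (y - x) + onorm f' * norm (y - x)"
      by (intro add_mono d(2) y onorm bl)
    finally show ?thesis by (simp add: distrib_right)
  qed
  moreover have "0 \<le> 1 + onorm f'" using onorm_pos_le[OF bl] by simp
  ultimately show ?thesis using that d(1) by blast
qed

text \<open>\<open>Ck_on\<close> differentiates \<open>frechet_derivative\<close> only in fixed
  directions, so Lipschitz bounds at \<open>p\<close> are collected over the basis. The mean value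
  inequality for \<open>\<rho>\<close> minus its differential at \<open>p\<close>, on the ball
  around \<open>p\<close> through \<open>z\<close>, then gives the quadratic error.\<close>

lemma second_order_upper_bound:
  fixes \<rho> :: "'a::euclidean_space \<Rightarrow> real"
  assumes U: "open U" "p \<in> U" and sm: "smooth_on U \<rho>"
  shows "\<exists>M>0. \<exists>\<delta>>0. ball p \<delta> \<subseteq> U \<and>
    (\<forall>z. norm (z - p) < \<delta> \<longrightarrow> \<rho> z \<le> \<rho> p + frechet_derivative \<rho> (at p) (z - p) + M * (norm (z - p))\<^sup>2)"
proof -
  let ?D = "\<lambda>x. frechet_derivative \<rho> (at x)"
  have ck: "Ck_on k U \<rho>" for k using sm by (simp add: smooth_on_def)
  have diff: "(\<rho> has_derivative ?D x) (at x)" if "x \<in> U" for x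
    using ck[of "Suc 0"] that by (simp add: frechet_derivative_works)
  have "(\<lambda>x. ?D x v) differentiable (at p)" for v
    using ck[of "Suc (Suc 0)"] U(2) by simp
  then have "\<exists>M \<delta>. \<delta> > 0 \<and> M \<ge> 0 \<and> (\<forall>y. norm (y - p) < \<delta> \<longrightarrow> norm (?D y v - ?D p v) \<le> M * norm (y - p))" for v
    by (rule differentiable_lipschitz_at) blast
  then obtain Mb db where Md: "\<And>v. db v > 0" "\<And>v. Mb v \<ge> 0"
      "\<And>v y. norm (y - p) < db v \<Longrightarrow> norm (?D y v - ?D p v) \<le> Mb v * norm (y - p)"
    by metis
  obtain e where e: "e > 0" "ball p e \<subseteq> U" using U open_contains_ball by blast
  define \<delta> where "\<delta> = min e (Min (db ` Basis))"
  have \<delta>: "\<delta> > 0" "\<delta> \<le> e" "\<And>b. b \<in> Basis \<Longrightarrow> \<delta> \<le> db b"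
    unfolding \<delta>_def using e Md(1) by (auto intro: min.coboundedI2)
  define M where "M = (\<Sum>b\<in>Basis. Mb b) + 1"
  have M: "M > 0" unfolding M_def using sum_nonneg[of Basis Mb] Md(2) by (simp add: add_nonneg_pos)
  have Dlip: "\<bar>?D x v - ?D p v\<bar> \<le> M * norm (x - p) * norm v" if x: "norm (x - p) < \<delta>" for x v
  proof -
    have xU: "x \<in> U" using x \<delta>(2) e(2) by (auto simp: dist_norm norm_minus_commute subset_iff)
    have lx: "linear (?D x)" "linear (?D p)" using diff xU U(2) has_derivative_linear by blast+
    have rep: "L v = (\<Sum>b\<in>Basis. (v \<bullet> b) * L b)" if "linear L" for L :: "'a \<Rightarrow> real"
      using linear_sum[OF that, of "\<lambda>b. (v \<bullet> b) *\<^sub>R b" Basis] by (simp add: euclidean_representation linear_cmul[OF that])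
    have "\<bar>?D x v - ?D p v\<bar> = \<bar>\<Sum>b\<in>Basis. (v \<bullet> b) * (?D x b - ?D p b)\<bar>"
      unfolding rep[OF lx(1)] rep[OF lx(2)] by (simp add: sum_subtractf algebra_simps)
    also have "\<dots> \<le> (\<Sum>b\<in>Basis. \<bar>(v \<bullet> b) * (?D x b - ?D p b)\<bar>)" by (rule sum_abs)
    also have "\<dots> \<le> (\<Sum>b\<in>Basis. norm v * (Mb b * norm (x - p)))"
    proof (intro sum_mono)
      fix b :: 'a assume b: "b \<in> Basis"
      have "\<bar>?D x b - ?D p b\<bar> \<le> Mb b * norm (x - p)" using Md(3)[of x b] x \<delta>(3)[OF b] by simp
      moreover have "\<bar>v \<bullet> b\<bar> \<le> norm v" using b by (rule Basis_le_norm)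
      ultimately show "\<bar>(v \<bullet> b) * (?D x b - ?D p b)\<bar> \<le> norm v * (Mb b * norm (x - p))"
        unfolding abs_mult by (intro mult_mono) auto
    qed
    also have "\<dots> = (\<Sum>b\<in>Basis. Mb b) * (norm (x - p) * norm v)" by (simp only: sum_distrib_left sum_distrib_right mult_ac)
    also have "\<dots> \<le> M * (norm (x - p) * norm v)" by (intro mult_right_mono) (auto simp: M_def)
    finally show ?thesis by (simp add: mult.assoc)
  qed
  have "\<rho> z \<le> \<rho> p + ?D p (z - p) + M * (norm (z - p))\<^sup>2" if z: "norm (z - p) < \<delta>" for z
  proof -
    let ?B = "cball p (norm (z - p))"
    have inB: "norm (x - p) < \<delta>" "x \<in> U" if "x \<in> ?B" for x
      using that z \<delta>(2) e(2) by (auto simp: dist_norm norm_minus_commute subset_iff)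
    have lp: "linear (?D p)" using diff U(2) has_derivative_linear by blast
    have "norm ((\<rho> z - ?D p z) - (\<rho> p - ?D p p)) \<le> M * norm (z - p) * norm (z - p)"
    proof (rule differentiable_bound[where S="?B" and f="\<lambda>x. \<rho> x - ?D p x" and f'="\<lambda>x v. ?D x v - ?D p v"])
      fix x assume x: "x \<in> ?B"
      have "(?D p has_derivative ?D p) (at x within ?B)"
        using lp by (intro bounded_linear_imp_has_derivative) (simp add: linear_conv_bounded_linear)
      then show "((\<lambda>x. \<rho> x - ?D p x) has_derivative (\<lambda>v. ?D x v - ?D p v)) (at x within ?B)"
        by (intro has_derivative_diff has_derivative_at_withinI[OF diff] inB x)
      show "onorm (\<lambda>v. ?D x v - ?D p v) \<le> M * norm (z - p)"
      proof (rule onorm_bound)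
        show "norm (?D x v - ?D p v) \<le> M * norm (z - p) * norm v" for v
        proof -
          have "norm (?D x v - ?D p v) \<le> M * norm (x - p) * norm v" using Dlip[OF inB(1)[OF x]] by simp
          also have "\<dots> \<le> M * norm (z - p) * norm v"
            using x M by (intro mult_right_mono mult_left_mono) (auto simp: dist_norm norm_minus_commute)
          finally show ?thesis .
        qed
      qed (use M in simp)
    qed (auto simp: dist_norm norm_minus_commute)
    then have "(\<rho> z - ?D p z) - (\<rho> p - ?D p p) \<le> M * (norm (z - p))\<^sup>2" by (simp add: power2_eq_square mult.assoc)
    then show ?thesis by (simp add: linear_diff[OF lp])
  qed
  moreover have "ball p \<delta> \<subseteq> U" using e \<delta>(2) by auto
  ultimately show ?thesis using \<delta>(1) M by (intro exI[of _ M] exI[of _ \<delta>] conjI allI impI)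
qed

text \<open>Maximality gives the outer ball. For the inner paraboloid it remains to see that the
  differential of the defining function at \<open>p\<close> is a positive multiple of the inner
  product with \<open>\<nu>\<close>: a direction in which it is negative leads into the domain,
  hence into the ball, and so cannot point outward.\<close>

lemma farthest_point:
  fixes \<Omega> :: "(complex^'n) set"
  assumes op: "open \<Omega>" and ne: "\<Omega> \<noteq> {}" and bd: "bounded \<Omega>"
    and sp: "strongly_pseudoconvex_smooth \<Omega>"
  shows "\<exists>(p :: complex^'n) \<nu> R \<kappa> M \<delta>. R > 0 \<and> norm \<nu> = 1 \<and> p = R *\<^sub>R \<nu> \<and> (\<forall>z\<in>\<Omega>. norm z \<le> R) \<and>
    \<kappa> > 0 \<and> M > 0 \<and> \<delta> > 0 \<and>
    (\<forall>z. norm (z - p) < \<delta> \<longrightarrow> \<kappa> * ((z - p) \<bullet> \<nu>) + M * (norm (z - p))\<^sup>2 < 0 \<longrightarrow> z \<in> \<Omega>)"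
proof -
  have "compact (closure \<Omega>)" using bd by (simp add: compact_closure)
  moreover have "closure \<Omega> \<noteq> {}" using ne by simp
  ultimately obtain p where p: "p \<in> closure \<Omega>" and max: "\<And>z. z \<in> closure \<Omega> \<Longrightarrow> norm z \<le> norm p"
    using continuous_attains_sup[of "closure \<Omega>" norm] continuous_on_norm_id by blast
  define R where "R = norm p"
  have R: "R > 0"
  proof (rule ccontr)
    assume "\<not> R > 0"
    then have "\<Omega> \<subseteq> {0}" using max closure_subset unfolding R_def by fastforce
    then have "\<Omega> = {0}" using ne by auto
    then show False using op not_open_singleton by blast
  qed
  define \<nu> where "\<nu> = (1 / R) *\<^sub>R p"
  have \<nu>: "norm \<nu> = 1" "p = R *\<^sub>R \<nu>" using R by (auto simp: \<nu>_def R_def)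
  have pO: "p \<notin> \<Omega>"
  proof
    assume "p \<in> \<Omega>"
    then obtain e where e: "e > 0" "cball p e \<subseteq> \<Omega>" using op open_contains_cball by blast
    have "dist p (p + e *\<^sub>R \<nu>) \<le> e" using e \<nu> by (simp add: dist_norm)
    then have "p + e *\<^sub>R \<nu> \<in> \<Omega>" using e by auto
    then have "norm (p + e *\<^sub>R \<nu>) \<le> R" using max closure_subset unfolding R_def by blast
    moreover have "p + e *\<^sub>R \<nu> = (R + e) *\<^sub>R \<nu>" unfolding \<nu>(2) by (simp add: scaleR_add_left)
    ultimately show False using e R \<nu>(1) by simp
  qed
  have pF: "p \<in> frontier \<Omega>" using p pO op by (simp add: frontier_def interior_open)
  obtain U \<rho> where df: "smooth_defining_function \<Omega> U \<rho>" using sp unfolding strongly_pseudoconvex_smooth_def by blast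
  then have U: "open U" "frontier \<Omega> \<subseteq> U" "smooth_on U \<rho>" "\<Omega> \<inter> U = {z \<in> U. \<rho> z < 0}"
    and nz: "\<exists>v. frechet_derivative \<rho> (at p) v \<noteq> 0" using pF unfolding smooth_defining_function_def by auto
  have pU: "p \<in> U" using pF U by blast
  obtain M \<delta> where M: "\<delta> > 0" "M > 0" "ball p \<delta> \<subseteq> U"
    "\<forall>z. norm (z - p) < \<delta> \<longrightarrow> \<rho> z \<le> \<rho> p + frechet_derivative \<rho> (at p) (z - p) + M * (norm (z - p))\<^sup>2"
    using second_order_upper_bound[OF U(1) pU U(3)] by (elim exE conjE)
  let ?L = "frechet_derivative \<rho> (at p)"
  have Ld: "(\<rho> has_derivative ?L) (at p)"
    using U(3) pU unfolding smooth_on_def by (metis Ck_on.simps(2) frechet_derivative_works)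
  then have L: "linear ?L" using has_derivative_linear by blast
  have \<rho>p: "\<rho> p \<le> 0"
  proof (rule ccontr)
    assume "\<not> \<rho> p \<le> 0"
    then have "\<rho> p > 0" by simp
    have "isCont \<rho> p" using has_derivative_continuous[OF Ld] .
    then have "\<forall>\<^sub>F z in nhds p. \<rho> z > 0"
      using order_tendstoD(1)[OF _ \<open>\<rho> p > 0\<close>, of \<rho> "nhds p"] by (simp add: continuous_at_imp_continuous_at_within isCont_def tendsto_at_iff_tendsto_nhds)
    moreover have "\<forall>\<^sub>F z in nhds p. z \<in> U" using U(1) pU by (rule eventually_nhds_in_open)
    ultimately have "\<forall>\<^sub>F z in nhds p. z \<in> U \<and> \<rho> z > 0" by (simp add: eventually_conj)
    then obtain V where V: "open V" "p \<in> V" "\<And>z. z \<in> V \<Longrightarrow> z \<in> U \<and> \<rho> z > 0" unfolding eventually_nhds by blast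
    then obtain z where "z \<in> V" "z \<in> \<Omega>" using p by (metis closure_iff_nhds_not_empty disjoint_iff subset_refl)
    then show False using V(3)[of z] U(4) by force
  qed
  have inO: "z \<in> \<Omega>" if "norm (z - p) < \<delta>" "?L (z - p) + M * (norm (z - p))\<^sup>2 < 0" for z
  proof -
    have "z \<in> U" using that(1) M(3) by (auto simp: dist_norm norm_minus_commute subset_iff)
    moreover have "\<rho> z < 0" using M(4)[rule_format, OF that(1)] that(2) \<rho>p by linarith
    ultimately show ?thesis using U(4) by blast
  qed
  have dir: "v \<bullet> \<nu> \<le> 0" if v: "?L v < 0" for v
  proof -
    have v0: "v \<noteq> 0" using v linear_0[OF L] by auto
    \<comment> \<open>The first bound stays in the ball where the expansion is valid; the second
      keeps the quadratic term at most half of the linear decrease.\<close>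
    define s where "s = min (\<delta> / (2 * norm v)) (- ?L v / (2 * M * (norm v)\<^sup>2))"
    have s: "s > 0" "s \<le> \<delta> / (2 * norm v)" "s \<le> - ?L v / (2 * M * (norm v)\<^sup>2)"
      unfolding s_def using M v v0 by (auto intro!: divide_neg_pos mult_pos_pos)
    have 1: "norm ((p + s *\<^sub>R v) - p) < \<delta>"
    proof -
      have "s * norm v \<le> \<delta> / (2 * norm v) * norm v" using s by (intro mult_right_mono) auto
      also have "\<dots> < \<delta>" using v0 M by simp
      finally show ?thesis using s by simp
    qed
    have 2: "?L ((p + s *\<^sub>R v) - p) + M * (norm ((p + s *\<^sub>R v) - p))\<^sup>2 < 0"
    proof -
      have "s * (2 * M * (norm v)\<^sup>2) \<le> - ?L v" using s(3) v0 M by (subst (asm) pos_le_divide_eq) auto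
      then have "M * (norm v)\<^sup>2 * s < - ?L v" using v by (simp add: mult_ac)
      then have "s * (?L v + M * (norm v)\<^sup>2 * s) < 0" using s(1) by (intro mult_pos_neg) auto
      then show ?thesis using s by (simp add: linear_cmul[OF L] power2_eq_square algebra_simps)
    qed
    have "p + s *\<^sub>R v \<in> \<Omega>" by (rule inO[OF 1 2])
    then have "norm (p + s *\<^sub>R v) \<le> R" using max closure_subset unfolding R_def by blast
    then have "(norm (p + s *\<^sub>R v))\<^sup>2 \<le> R\<^sup>2" by (intro power_mono) auto
    moreover have "(norm (p + s *\<^sub>R v))\<^sup>2 = R\<^sup>2 + 2 * s * (v \<bullet> p) + s\<^sup>2 * (norm v)\<^sup>2"
      unfolding R_def power2_norm_eq_inner by (simp add: inner_add inner_commute power2_eq_square algebra_simps)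
    ultimately have "2 * s * (v \<bullet> p) \<le> 0" by (smt (verit) zero_le_power2 mult_nonneg_nonneg)
    then have "v \<bullet> p \<le> 0" using s(1) by (simp add: mult_le_0_iff)
    then show ?thesis using R unfolding \<nu>(2) by (simp add: mult_le_0_iff)
  qed
  have pos: "?L v \<ge> 0" if "v \<bullet> \<nu> > 0" for v using dir[of v] that by force
  \<comment> \<open>Tangent vectors are limits of vectors with positive normal component. Used for
    both \<open>v\<close> and \<open>- v\<close>, this makes the differential vanish on the tangent
    space of the sphere.\<close>
  have ker0: "?L v \<ge> 0" if v: "v \<bullet> \<nu> = 0" for v
  proof -
    have "0 \<le> ?L v + e * ?L \<nu>" if e: "e > 0" for e
      using pos[of "v + e *\<^sub>R \<nu>"] v e \<nu>(1) by (simp add: inner_add power2_norm_eq_inner[symmetric] linear_add[OF L] linear_cmul[OF L] norm_eq_1)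
    then have "\<forall>\<^sub>F e in at_right 0. 0 \<le> ?L v + e * ?L \<nu>" by (simp add: eventually_at_right_less eventually_mono[OF eventually_at_right_less])
    moreover have "((\<lambda>e. ?L v + e * ?L \<nu>) \<longlongrightarrow> ?L v + 0 * ?L \<nu>) (at_right 0)" by (intro tendsto_intros)
    ultimately have "0 \<le> ?L v + 0 * ?L \<nu>" by (intro tendsto_lowerbound) auto
    then show ?thesis by simp
  qed
  have ker: "?L v = 0" if "v \<bullet> \<nu> = 0" for v
    using ker0[OF that] ker0[of "- v"] that by (simp add: linear_neg[OF L])
  define \<kappa> where "\<kappa> = ?L \<nu>"
  have \<nu>1: "\<nu> \<bullet> \<nu> = 1" using \<nu>(1) by (simp add: norm_eq_1)
  have Leq: "?L v = \<kappa> * (v \<bullet> \<nu>)" for v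
  proof -
    have "?L (v - (v \<bullet> \<nu>) *\<^sub>R \<nu>) = 0" by (rule ker) (simp add: inner_diff \<nu>1)
    then show ?thesis by (simp add: \<kappa>_def linear_diff[OF L] linear_cmul[OF L])
  qed
  have "\<kappa> \<ge> 0" unfolding \<kappa>_def by (rule pos) (simp add: \<nu>1)
  moreover have "\<kappa> \<noteq> 0" using nz Leq by auto
  ultimately have \<kappa>: "\<kappa> > 0" by simp
  have "\<forall>z\<in>\<Omega>. norm z \<le> R" using max closure_subset by (auto simp: R_def subset_iff)
  moreover have "\<forall>z. norm (z - p) < \<delta> \<longrightarrow> \<kappa> * ((z - p) \<bullet> \<nu>) + M * (norm (z - p))\<^sup>2 < 0 \<longrightarrow> z \<in> \<Omega>"
    using inO unfolding Leq by blast
  ultimately show ?thesis using R \<nu> \<kappa> M(1,2)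
    by (intro exI[of _ p] exI[of _ \<nu>] exI[of _ R] exI[of _ \<kappa>] exI[of _ M] exI[of _ \<delta>] conjI)
qed

subsection \<open>Boundary growth of the kernel\<close>

lemma emeasure_lborel_reflect_vimage:
  fixes A :: "'a::euclidean_space set"
  assumes [measurable]: "A \<in> sets borel"
  shows "emeasure lborel ((\<lambda>z. p - z) -` A) = emeasure lborel A"
proof -
  have m: "(\<lambda>y. y + p) -` A \<in> sets borel"
    using measurable_sets[of "\<lambda>y. y + p" borel borel A] by simp
  have "(\<lambda>z. p - z) -` A = uminus -` ((\<lambda>y. y + p) -` A)" by auto
  then have "emeasure lborel ((\<lambda>z. p - z) -` A) = emeasure lborel ((\<lambda>y. y + p) -` A)"
    using emeasure_lborel_uminus_vimage[OF m] by simp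
  also have "\<dots> = (\<integral>\<^sup>+y. indicator ((\<lambda>y. y + p) -` A) y \<partial>lborel)"
    using m by (subst nn_integral_indicator) auto
  also have "\<dots> = (\<integral>\<^sup>+y. indicator A (y + p) \<partial>lborel)"
    by (intro nn_integral_cong) (simp add: indicator_def)
  also have "\<dots> = (\<integral>\<^sup>+y. indicator A y \<partial>lborel)" by (rule nn_integral_lborel_plus) measurable
  finally show ?thesis by simp
qed

lemma dyadic_upper_bound:
  assumes x: "s \<le> x" "x < 2 ^ N * s" and s: "s > 0"
  obtains k where "k < N" "2 ^ k * s \<le> x" "x < 2 ^ Suc k * (s::real)"
proof -
  let ?P = "\<lambda>k. x < 2 ^ Suc k * s"
  have N: "N > 0" using x by (intro gr0I) auto
  then have PN: "?P (N - 1)" using x by simp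
  define k where "k = (LEAST k. ?P k)"
  have k: "?P k" unfolding k_def by (rule LeastI[of ?P, OF PN])
  have "k \<le> N - 1" unfolding k_def by (rule Least_le[of ?P, OF PN])
  then have "k < N" using N by simp
  moreover have "2 ^ k * s \<le> x"
  proof (cases k)
    case 0
    then show ?thesis using x by simp
  next
    case (Suc i)
    then have "\<not> ?P i" unfolding k_def using not_less_Least by (metis lessI)
    then show ?thesis using Suc by simp
  qed
  ultimately show ?thesis using that k by blast
qed

lemma norm_le_sum_components: "norm (v::complex^'n) \<le> (\<Sum>k\<in>UNIV. cmod (v $ k))"
  unfolding norm_vec_def by (rule L2_set_le_sum) simp

context bounded_open_set
begin

text \<open>The test function \<open>(\<langle>p - z, \<nu>\<rangle> + conj \<langle>p - z\<^sub>0, \<nu>\<rangle>)\<^bsup>-(n+1)\<^esup>\<close> has \<open>L\<^sup>2\<close>-norm of order \<open>s\<^bsup>-(n+1)/2\<^esup>\<close>, where \<open>s = Re \<langle>p - z\<^sub>0, \<nu>\<rangle>\<close>,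
  by dyadic decomposition: on the part of \<open>\<Omega>\<close> where the denominator is of size \<open>\<rho>\<close>, the normal
  component is confined to a disc of radius \<open>\<rho>\<close> and, since \<open>\<Omega>\<close> lies in a ball touching \<open>p\<close>, the
  remaining components are \<open>O(\<surd>\<rho>)\<close>.\<close>

lemma kernel_lower_bound:
  fixes p \<nu> :: "complex^'n"
  assumes R: "R > 0" and \<nu>: "norm \<nu> = 1" and p: "p = R *\<^sub>R \<nu>" and outer': "\<forall>z\<in>\<Omega>. norm z \<le> R"
  shows "\<exists>c>0. \<forall>z\<in>\<Omega>. 0 < (p - z) \<bullet> \<nu> \<longrightarrow> c \<le> Re (K z z) * ((p - z) \<bullet> \<nu>) ^ (CARD('n) + 1)"
proof -
  note outer = bspec[OF outer']
  define m where "m = CARD('n) + 1"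
  have "\<nu> \<noteq> 0" using \<nu> by auto
  then obtain j where j: "\<nu> $ j \<noteq> 0" by (metis vec_eq_iff zero_index)
  obtain cs where cs: "cs > 0" "\<And>A. A \<in> sets borel \<Longrightarrow> emeasure lborel (skew \<nu> j -` A) = ennreal cs * emeasure lborel A"
    using skew_measure[OF j] by blast
  \<comment> \<open>A box with normal half-width \<rho> and remaining half-widths sqrt (4 R \<rho>)
    has volume (2 \<rho>)^2 (16 R \<rho>)^(n - 1), and its preimage under \<open>skew\<close> has
    measure C0 \<rho>^(n + 1).\<close>
  define C0 where "C0 = cs * (4 * (16 * R) ^ (CARD('n) - 1))"
  have C0: "C0 > 0" using cs(1) R by (simp add: C0_def)
  \<comment> \<open>On each shell the outer radius is twice the inner one, which costs
    \<open>2 ^ m\<close>; the remaining factor 2 bounds the geometric series.\<close>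
  define C1 where "C1 = C0 * 2 ^ Suc m"
  have C1: "C1 > 0" using C0 by (simp add: C1_def)
  define u where "u z = cinner (p - z) \<nu>" for z
  have Reu: "Re (u z) = (p - z) \<bullet> \<nu>" for z by (simp add: u_def Re_cinner)
  \<comment> \<open>Expanding |z|^2 \<le> R^2 around \<open>p\<close>: contact with the ball bounds
    all components by the square root of the normal one.\<close>
  have near: "(norm (p - z))\<^sup>2 \<le> 2 * R * Re (u z)" if z: "z \<in> \<Omega>" for z
  proof -
    have "(norm z)\<^sup>2 \<le> R\<^sup>2" using outer[OF z] by (intro power_mono) auto
    moreover have "(norm (p - (p - z)))\<^sup>2 = R\<^sup>2 - 2 * R * Re (u z) + (norm (p - z))\<^sup>2"
    proof -
      have "(norm (p - (p - z)))\<^sup>2 = (norm p)\<^sup>2 - 2 * (p \<bullet> (p - z)) + (norm (p - z))\<^sup>2"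
        by (simp only: power2_norm_eq_inner inner_diff_left inner_diff_right) (simp add: inner_commute)
      also have "norm p = R" using R \<nu> p by simp
      also have "p \<bullet> (p - z) = R * Re (u z)" unfolding Reu by (subst p) (simp add: inner_commute)
      finally show ?thesis by simp
    qed
    ultimately show ?thesis by simp
  qed
  have Reu0: "0 \<le> Re (u z)" if "z \<in> \<Omega>" for z
    using near[OF that] R by (smt (verit) zero_le_power2 mult_pos_neg)
  have main: "1 / (4 ^ m * C1) \<le> Re (K z0 z0) * Re (u z0) ^ m" if z0: "z0 \<in> \<Omega>" and s0: "0 < Re (u z0)" for z0
  proof -
    define s where "s = Re (u z0)"
    have s: "s > 0" using s0 by (simp add: s_def)
    define g where "g z = u z + cnj (u z0)" for z
    have Reg: "s \<le> Re (g z)" if "z \<in> \<Omega>" for z using Reu0[OF that] by (simp add: g_def s_def)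
    have gs: "s \<le> cmod (g z)" if "z \<in> \<Omega>" for z using Reg[OF that] complex_Re_le_cmod[of "g z"] by linarith
    have g0: "g z \<noteq> 0" if "z \<in> \<Omega>" for z using gs[OF that] s by auto
    define f where "f z = inverse (g z) ^ m" for z
    have gd: "(g has_derivative (\<lambda>v. - cinner v \<nu>)) (at z)" for z
    proof -
      have "bounded_linear (\<lambda>v. cinner v \<nu>)" using linear_cinner by (simp add: linear_conv_bounded_linear)
      moreover have "((\<lambda>z. p - z) has_derivative (\<lambda>v. 0 - v)) (at z)"
        by (intro has_derivative_diff has_derivative_const has_derivative_ident)
      ultimately have "((\<lambda>z. cinner (p - z) \<nu>) has_derivative (\<lambda>v. cinner (0 - v) \<nu>)) (at z)"
        by (rule bounded_linear.has_derivative)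
      moreover have "cinner (0 - v) \<nu> = - cinner v \<nu>" for v by (simp add: cinner_def sum_negf)
      ultimately show ?thesis
        unfolding g_def[abs_def] u_def using has_derivative_add[OF _ has_derivative_const, of "\<lambda>z. cinner (p - z) \<nu>" "\<lambda>v. - cinner v \<nu>" "at z" "cnj (u z0)"]
        by (simp add: u_def)
    qed
    have hol: "holomorphic_Cn_on \<Omega> f"
      unfolding holomorphic_Cn_on_def
    proof
      fix z assume z: "z \<in> \<Omega>"
      have "\<exists>D. ((\<lambda>w. inverse w ^ m) has_field_derivative D) (at (g z))"
        by (rule exI) (rule derivative_eq_intros refl g0[OF z])+
      then obtain D where "((\<lambda>w. inverse w ^ m) has_field_derivative D) (at (g z))" by blast
      then have "((\<lambda>w. inverse w ^ m) has_derivative (\<lambda>h. D * h)) (at (g z))"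
        by (simp add: has_field_derivative_def)
      from has_derivative_compose[OF gd this]
      have "(f has_derivative (\<lambda>v. D * (- cinner v \<nu>))) (at z)" by (simp add: f_def[abs_def])
      moreover have "D * (- cinner (c *s v) \<nu>) = c * (D * (- cinner v \<nu>))" for c v by (simp add: cinner_simps)
      ultimately show "\<exists>f'. (f has_derivative f') (at z) \<and> (\<forall>c v. f' (c *s v) = c * f' v)" by blast
    qed
    have fsq: "(cmod (f z))\<^sup>2 = inverse (cmod (g z)) ^ (2 * m)" for z
      by (simp add: f_def norm_power norm_inverse power_mult[symmetric] mult.commute)
    have fle: "(cmod (f z))\<^sup>2 \<le> inverse t ^ (2 * m)" if "0 < t" "t \<le> cmod (g z)" for z t
      unfolding fsq using that by (intro power_mono le_imp_inverse_le) (auto intro: order_trans)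
    have "set_integrable lborel \<Omega> (\<lambda>z. (cmod (f z))\<^sup>2)"
    proof (rule set_integrable_bound[OF bergmanD(2)[OF bergman_const[of "of_real (inverse s ^ m)"]]])
      have "continuous_on \<Omega> (\<lambda>z. (cmod (f z))\<^sup>2)" by (intro continuous_intros holomorphic_Cn_on_continuous hol)
      from borel_measurable_continuous_on_indicator[OF sets_domain this]
      show "set_borel_measurable lborel \<Omega> (\<lambda>z. (cmod (f z))\<^sup>2)" by (simp add: set_borel_measurable_def)
      have "(cmod (complex_of_real (inverse s ^ m)))\<^sup>2 = inverse s ^ (2 * m)"
        using s by (simp only: norm_of_real power2_abs power_mult[symmetric] mult.commute)
      then show "AE z in lborel. z \<in> \<Omega> \<longrightarrow> norm ((cmod (f z))\<^sup>2) \<le> norm ((cmod (complex_of_real (inverse s ^ m)))\<^sup>2)"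
        using order_trans[OF fle[OF s gs] abs_ge_self] by (intro AE_I2 impI) (simp only: real_norm_def abs_power2)
    qed
    then have fA: "f \<in> bergman_space \<Omega>" using hol by (simp add: bergman_space_def)
    \<comment> \<open>Boundedness of the domain makes finitely many dyadic shells suffice.\<close>
    obtain N where N: "\<And>z. z \<in> \<Omega> \<Longrightarrow> cmod (g z) < 2 ^ N * s"
    proof -
      have bl: "bounded_linear (\<lambda>v. cinner v \<nu>)" using linear_cinner by (simp add: linear_conv_bounded_linear)
      have gb: "cmod (g z) \<le> onorm (\<lambda>v. cinner v \<nu>) * (2 * R) + cmod (u z0)" if z: "z \<in> \<Omega>" for z
      proof -
        have "cmod (g z) \<le> cmod (u z) + cmod (u z0)" unfolding g_def using norm_triangle_ineq[of "u z" "cnj (u z0)"] by simp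
        also have "cmod (u z) \<le> onorm (\<lambda>v. cinner v \<nu>) * norm (p - z)" unfolding u_def by (rule onorm[OF bl])
        also have "norm (p - z) \<le> 2 * R" using norm_triangle_ineq4[of p z] outer[OF z] R \<nu> p by simp
        finally show ?thesis using onorm_pos_le[OF bl] by (simp add: mult_left_mono)
      qed
      obtain N where "(onorm (\<lambda>v. cinner v \<nu>) * (2 * R) + cmod (u z0)) / s < 2 ^ N"
        using real_arch_pow[of 2] by auto
      then have "onorm (\<lambda>v. cinner v \<nu>) * (2 * R) + cmod (u z0) < 2 ^ N * s" using s by (simp add: pos_divide_less_eq)
      then show ?thesis using that[of N] gb by (meson order_le_less_trans)
    qed
    \<comment> \<open>This centre makes the offset of the coordinate \<open>j\<close> equal to
      \<open>g z\<close>.\<close>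
    define Bx where "Bx k = coord_box j (- cnj (u z0)) (2 ^ Suc k * s) (sqrt (4 * R * (2 ^ Suc k * s)))" for k
    define E where "E k = (\<lambda>z. p - z) -` (skew \<nu> j -` Bx k)" for k :: nat
    have Epos: "2 ^ Suc k * s > 0" "sqrt (4 * R * (2 ^ Suc k * s)) > 0" for k using s R by auto
    have lin: "linear (skew \<nu> j)"
      by (rule linearI) (auto simp: skew_def vec_eq_iff linear_add[OF linear_cinner] linear_cmul[OF linear_cinner])
    have skm: "skew \<nu> j -` A \<in> sets borel" if "A \<in> sets borel" for A
    proof -
      have "skew \<nu> j \<in> borel_measurable borel"
        using lin by (intro borel_measurable_continuous_onI linear_continuous_on) (simp add: linear_conv_bounded_linear)
      from measurable_sets[OF this that] show ?thesis by simp
    qed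
    have Bxm: "Bx k \<in> sets borel" for k unfolding Bx_def by (rule coord_box(1)[OF Epos])
    have Em[measurable]: "E k \<in> sets borel" for k
      unfolding E_def using measurable_sets[OF _ skm[OF Bxm[of k]], of "\<lambda>z. p - z" borel] by simp
    have Emeas: "emeasure lborel (E k) = ennreal (C0 * (2 ^ Suc k * s) ^ m)" for k
    proof -
      let ?\<rho> = "2 ^ Suc k * s"
      have "emeasure lborel (E k) = ennreal cs * emeasure lborel (Bx k)"
        unfolding E_def using emeasure_lborel_reflect_vimage[OF skm[OF Bxm]] cs(2)[OF Bxm] by simp
      also have "\<dots> = ennreal (cs * ((2 * ?\<rho>)\<^sup>2 * (4 * (sqrt (4 * R * ?\<rho>))\<^sup>2) ^ (CARD('n) - 1)))"
        unfolding Bx_def coord_box(2)[OF Epos] using cs(1) by (simp add: ennreal_mult')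
      also have "cs * ((2 * ?\<rho>)\<^sup>2 * (4 * (sqrt (4 * R * ?\<rho>))\<^sup>2) ^ (CARD('n) - 1)) = C0 * ?\<rho> ^ m"
      proof -
        have 1: "4 * (sqrt (4 * R * ?\<rho>))\<^sup>2 = 16 * R * ?\<rho>" using s R by simp
        have "m = Suc (Suc (CARD('n) - 1))" unfolding m_def by simp
        then have 2: "?\<rho> ^ m = ?\<rho>\<^sup>2 * ?\<rho> ^ (CARD('n) - 1)" by (simp only: power_Suc power2_eq_square mult.assoc)
        show ?thesis unfolding 1 2 C0_def by (simp only: power_mult_distrib) (simp add: mult_ac)
      qed
      finally show ?thesis .
    qed
    have pt: "indicator \<Omega> z * ennreal ((cmod (f z))\<^sup>2) \<le> (\<Sum>k<N. ennreal (inverse (2 ^ k * s) ^ (2 * m)) * indicator (E k) z)" for z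
    proof (cases "z \<in> \<Omega>")
      case True
      obtain k where k: "k < N" "2 ^ k * s \<le> cmod (g z)" "cmod (g z) < 2 ^ Suc k * s"
        using dyadic_upper_bound[OF gs[OF True] N[OF True] s] by blast
      have "z \<in> E k"
        unfolding E_def Bx_def coord_box_def vimage_def mem_Collect_eq
      proof (intro conjI allI impI)
        have g: "skew \<nu> j (p - z) $ j - - cnj (u z0) = g z" by (simp add: skew_def g_def u_def)
        show "\<bar>Re (skew \<nu> j (p - z) $ j - - cnj (u z0))\<bar> < 2 ^ Suc k * s"
          unfolding g using abs_Re_le_cmod[of "g z"] k(3) by linarith
        show "\<bar>Im (skew \<nu> j (p - z) $ j - - cnj (u z0))\<bar> < 2 ^ Suc k * s"
          unfolding g using abs_Im_le_cmod[of "g z"] k(3) by linarith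
        fix i assume i: "i \<noteq> j"
        have "Re (u z) \<le> Re (g z)" using s by (simp add: g_def s_def)
        also have "\<dots> < 2 ^ Suc k * s" using complex_Re_le_cmod[of "g z"] k(3) by linarith
        finally have "2 * R * Re (u z) < 2 * R * (2 ^ Suc k * s)"
          using R by (intro mult_strict_left_mono) auto
        also have "\<dots> \<le> 4 * R * (2 ^ Suc k * s)"
          using R Epos(1)[of k] by (intro mult_right_mono) auto
        finally have "2 * R * Re (u z) < 4 * R * (2 ^ Suc k * s)" .
        with near[OF True] have "(norm (p - z))\<^sup>2 < 4 * R * (2 ^ Suc k * s)" by linarith
        then have "norm (p - z) < sqrt (4 * R * (2 ^ Suc k * s))" by (rule real_less_rsqrt)
        moreover have "cmod ((p - z) $ i) \<le> norm (p - z)" unfolding norm_vec_def by (rule member_le_L2_set) auto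
        moreover have "skew \<nu> j (p - z) $ i = (p - z) $ i" using i by (simp add: skew_def)
        ultimately have c: "cmod (skew \<nu> j (p - z) $ i) < sqrt (4 * R * (2 ^ Suc k * s))" by simp
        show "\<bar>Re (skew \<nu> j (p - z) $ i)\<bar> < sqrt (4 * R * (2 ^ Suc k * s))"
          using abs_Re_le_cmod c by (rule order_le_less_trans)
        show "\<bar>Im (skew \<nu> j (p - z) $ i)\<bar> < sqrt (4 * R * (2 ^ Suc k * s))"
          using abs_Im_le_cmod c by (rule order_le_less_trans)
      qed
      then have "indicator \<Omega> z * ennreal ((cmod (f z))\<^sup>2) \<le> ennreal (inverse (2 ^ k * s) ^ (2 * m)) * indicator (E k) z"
        using True fle[OF _ k(2)] s by (simp add: ennreal_leI)
      also have "\<dots> \<le> (\<Sum>k<N. ennreal (inverse (2 ^ k * s) ^ (2 * m)) * indicator (E k) z)"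
        using k(1) by (intro member_le_sum) auto
      finally show ?thesis .
    qed simp
    have "ennreal (sqn f) = (\<integral>\<^sup>+z. indicator \<Omega> z * ennreal ((cmod (f z))\<^sup>2) \<partial>lborel)" by (rule nn_integral_sqn[OF fA, symmetric])
    also have "\<dots> \<le> (\<integral>\<^sup>+z. (\<Sum>k<N. ennreal (inverse (2 ^ k * s) ^ (2 * m)) * indicator (E k) z) \<partial>lborel)"
      by (intro nn_integral_mono pt)
    also have "\<dots> = (\<Sum>k<N. ennreal (inverse (2 ^ k * s) ^ (2 * m)) * emeasure lborel (E k))"
      by (subst nn_integral_sum) (auto simp: nn_integral_cmult)
    also have "\<dots> = (\<Sum>k<N. ennreal (inverse (2 ^ k * s) ^ (2 * m) * (C0 * (2 ^ Suc k * s) ^ m)))"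
      unfolding Emeas using s by (intro sum.cong refl ennreal_mult'[symmetric]) auto
    also have "\<dots> = ennreal (\<Sum>k<N. inverse (2 ^ k * s) ^ (2 * m) * (C0 * (2 ^ Suc k * s) ^ m))"
      using s C0 by (intro sum_ennreal) auto
    finally have "sqn f \<le> (\<Sum>k<N. inverse (2 ^ k * s) ^ (2 * m) * (C0 * (2 ^ Suc k * s) ^ m))"
      using s C0 by (subst (asm) ennreal_le_iff) (auto intro!: sum_nonneg)
    \<comment> \<open>The integrand on shell k is at most (2^k s)^(-2 m) and the volume is C0 (2^(k
      + 1) s)^m, so the contribution is C0 2^m s^(-m) 2^(-k m), which is summable in k.\<close>
    also have "\<dots> \<le> (\<Sum>k<N. C0 * 2 ^ m * inverse s ^ m * (1/2) ^ k)"
    proof (intro sum_mono)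
      fix k
      have a: "(2::real) ^ k * s > 0" using s by simp
      have "inverse (2 ^ k * s) ^ (2 * m) * (C0 * (2 ^ Suc k * s) ^ m)
          = C0 * 2 ^ m * (inverse (2 ^ k * s) ^ m * (inverse (2 ^ k * s) ^ m * (2 ^ k * s) ^ m))"
      proof -
        have "inverse (2 ^ k * s) ^ (2 * m) = inverse (2 ^ k * s) ^ m * inverse (2 ^ k * s) ^ m"
          by (simp only: mult_2 power_add)
        moreover have "(2 ^ Suc k * s) ^ m = 2 ^ m * (2 ^ k * s) ^ m"
          by (simp only: power_Suc power_mult_distrib mult.assoc)
        ultimately show ?thesis by (simp only: mult_ac)
      qed
      also have "inverse (2 ^ k * s) ^ m * (2 ^ k * s) ^ m = (inverse (2 ^ k * s) * (2 ^ k * s)) ^ m"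
        by (simp only: power_mult_distrib)
      also have "inverse (2 ^ k * s) * (2 ^ k * s) = 1" by (rule left_inverse) (use s in simp)
      also have "inverse (2 ^ k * s) ^ m * 1 ^ m = inverse s ^ m * ((1/2) ^ k) ^ m"
        using s by (simp add: power_mult_distrib power_one_over inverse_eq_divide power_divide)
      also have "((1/2::real) ^ k) ^ m \<le> (1/2) ^ k"
        using power_decreasing[of 1 m "(1/2::real) ^ k"] by (simp add: m_def power_le_one)
      finally show "inverse (2 ^ k * s) ^ (2 * m) * (C0 * (2 ^ Suc k * s) ^ m) \<le> C0 * 2 ^ m * inverse s ^ m * (1/2) ^ k"
        using C0 s by (simp add: mult_left_mono mult.assoc)
    qed
    also have "\<dots> = C0 * 2 ^ m * inverse s ^ m * (\<Sum>k<N. (1/2) ^ k)" by (simp only: sum_distrib_left)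
    also have "(\<Sum>k<N. (1/2::real) ^ k) \<le> 2"
      by (simp add: sum_gp_strict)
    finally have sq: "sqn f \<le> C1 * inverse s ^ m" using C0 s by (simp add: C1_def mult_left_mono mult_ac)
    have "(cmod (f z0))\<^sup>2 \<le> sqn f * Re (K z0 z0)" by (rule bergman_extremal[OF fA z0])
    also have "\<dots> \<le> C1 * inverse s ^ m * Re (K z0 z0)"
      using kernel_pos[OF z0] by (intro mult_right_mono sq) auto
    \<comment> \<open>At \<open>z0\<close> the imaginary parts cancel and the denominator is the
      real number 2 s; squaring the modulus of \<open>f\<close> there produces the factor
      4^(-m).\<close>
    also have "(cmod (f z0))\<^sup>2 = inverse (4 ^ m) * (inverse s ^ m * inverse s ^ m)"
    proof -
      have "g z0 = of_real (2 * s)" by (simp add: g_def s_def complex_eq_iff)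
      then have "cmod (g z0) = 2 * s" using s by (simp only: norm_of_real abs_of_pos)
      then have "(cmod (f z0))\<^sup>2 = inverse (2 * s) ^ (m + m)" unfolding fsq by (simp only: mult_2)
      also have "\<dots> = (inverse 2 ^ m * inverse 2 ^ m) * (inverse s ^ m * inverse s ^ m)"
        by (simp only: power_add inverse_mult_distrib power_mult_distrib mult_ac)
      also have "inverse 2 ^ m * inverse 2 ^ m = inverse ((4::real) ^ m)"
        by (simp only: power_mult_distrib[symmetric] power_inverse[symmetric]) simp
      finally show ?thesis .
    qed
    finally have "inverse s ^ m * (inverse (4 ^ m) * inverse s ^ m) \<le> inverse s ^ m * (C1 * Re (K z0 z0))" by (simp only: mult_ac)
    then have "inverse (4 ^ m) * inverse s ^ m \<le> C1 * Re (K z0 z0)" using s by (simp only: mult_le_cancel_left_pos zero_less_power positive_imp_inverse_positive)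
    then have "inverse (4 ^ m) * inverse s ^ m * s ^ m \<le> C1 * Re (K z0 z0) * s ^ m" using s by (intro mult_right_mono) auto
    moreover have "inverse s ^ m * s ^ m = 1" using s by (simp add: power_mult_distrib[symmetric])
    ultimately have "inverse (4 ^ m) \<le> C1 * (Re (K z0 z0) * s ^ m)" by (simp only: mult.assoc mult_1_right)
    then show ?thesis using C1 unfolding s_def[symmetric] by (simp add: field_simps)
  qed
  show ?thesis
    by (rule exI[of _ "1 / (4 ^ m * C1)"]) (use C1 main in \<open>simp add: Reu m_def\<close>)
qed

text \<open>The translate to z of a balanced set of normal size a t and tangential size b sqrt t
  fits into the inner paraboloid, and its volume is of order t^(n + 1);
  \<open>kernel_diag_upper\<close> then applies. The estimate is uniform for \<open>w\<close> in a
  bounded part of a half-plane, and the containment of z in \<open>\<Omega>\<close> is what later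
  keeps the discs inside.\<close>

lemma kernel_upper_bound:
  fixes p \<nu> :: "complex^'n"
  assumes \<nu>: "norm \<nu> = 1" and pos: "\<kappa> > 0" "M > 0" "\<delta> > 0" "m0 > 0" "W > 0"
    and inner: "\<forall>z. norm (z - p) < \<delta> \<longrightarrow> \<kappa> * ((z - p) \<bullet> \<nu>) + M * (norm (z - p))\<^sup>2 < 0 \<longrightarrow> z \<in> \<Omega>"
  shows "\<exists>t0>0. \<exists>C>0. \<forall>t w z. 0 < t \<longrightarrow> t < t0 \<longrightarrow> m0 \<le> Re w \<longrightarrow> cmod w \<le> W \<longrightarrow> z = p - (of_real t * w) *s \<nu> \<longrightarrow>
    z \<in> \<Omega> \<and> Re (K z z) * t ^ (CARD('n) + 1) \<le> C"
proof -
  define n where "n = real CARD('n)"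
  have n: "n \<ge> 1" by (simp add: n_def)
  have "\<nu> \<noteq> 0" using \<nu> by auto
  then obtain j where j: "\<nu> $ j \<noteq> 0" by (metis vec_eq_iff zero_index)
  obtain cs where cs: "cs > 0" "\<And>A. A \<in> sets borel \<Longrightarrow> emeasure lborel (skew \<nu> j -` A) = ennreal cs * emeasure lborel A"
    using skew_measure[OF j] by blast
  define \<mu> where "\<mu> = cmod (\<nu> $ j)"
  have \<mu>: "\<mu> > 0" using j by (simp add: \<mu>_def)
  have \<nu>le: "cmod (\<nu> $ k) \<le> 1" for k
  proof -
    have "cmod (\<nu> $ k) \<le> norm \<nu>" unfolding norm_vec_def by (rule member_le_L2_set) auto
    then show ?thesis using \<nu> by simp
  qed
  \<comment> \<open>The constant in norm v \<le> b sqrt t \<Lambda> on \<open>E t\<close>: n bounds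
    the coordinates other than \<open>j\<close>, and (1 + n) / \<mu> accounts for recovering the
    coordinate \<open>j\<close> from the normal component.\<close>
  define \<Lambda> where "\<Lambda> = n + (1 + n) / \<mu>"
  have \<Lambda>: "\<Lambda> > 0" using n \<mu> unfolding \<Lambda>_def by (intro add_pos_nonneg divide_nonneg_pos) auto
  \<comment> \<open>The set \<open>E t\<close> may use up half of the normal displacement t m0 of z;
    \<open>b\<close> is then chosen so that its tangential part contributes t \<kappa> m0 / 8 to the
    quadratic term.\<close>
  define a where "a = m0 / 2"
  define b where "b = sqrt (\<kappa> * m0 / (16 * M * \<Lambda>\<^sup>2))"
  have a: "a > 0" using pos by (simp add: a_def)
  have b: "b > 0" unfolding b_def using pos \<Lambda> by (intro real_sqrt_gt_zero divide_pos_pos mult_pos_pos) auto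
  have b2: "2 * M * (b\<^sup>2 * \<Lambda>\<^sup>2) = \<kappa> * m0 / 8"
  proof -
    have "b\<^sup>2 = \<kappa> * m0 / (16 * M * \<Lambda>\<^sup>2)" unfolding b_def using pos by (intro real_sqrt_pow2) auto
    then show ?thesis using pos \<Lambda> by (simp add: field_simps)
  qed
  define D where "D = W + b * \<Lambda>"
  have D: "D > 0" using pos b \<Lambda> by (simp add: D_def add_pos_pos)
  \<comment> \<open>The four bounds give in turn t \<le> sqrt t, a t \<le> b sqrt t, smallness of
    the quadratic term coming from \<open>w\<close>, and membership in the ball of radius
    \<open>\<delta>\<close>.\<close>
  define t0 where "t0 = Min {1, (b / a)\<^sup>2, \<kappa> * m0 / (16 * M * W\<^sup>2), (\<delta> / D)\<^sup>2}"
  have t0: "t0 > 0" unfolding t0_def using pos a b D by simp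
  have tle: "t < 1" "t < (b / a)\<^sup>2" "t < \<kappa> * m0 / (16 * M * W\<^sup>2)" "t < (\<delta> / D)\<^sup>2" if "t < t0" for t
    using that unfolding t0_def by simp_all
  define E where "E t = {v. cmod (cinner v \<nu>) < a * t \<and> (\<forall>k\<in>UNIV - {j}. cmod (v $ k) < b * sqrt t)}" for t
  have Enorm: "norm v \<le> b * sqrt t * \<Lambda>" if t: "0 < t" "t < t0" and v: "v \<in> E t" for t v
  proof -
    have st: "sqrt t > 0" using t by simp
    have vk: "cmod (v $ k) < b * sqrt t" if "k \<noteq> j" for k using v that by (simp add: E_def)
    have "sqrt t * sqrt t = t" using t by simp
    moreover have "sqrt t < b / a" using tle(2)[OF t(2)] b a by (intro real_less_lsqrt) auto
    ultimately have at: "a * t \<le> b * sqrt t"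
    proof -
      assume 1: "sqrt t * sqrt t = t" and 2: "sqrt t < b / a"
      have "a * sqrt t < b" using 2 a by (simp add: field_simps)
      then have "a * sqrt t * sqrt t \<le> b * sqrt t" using st by (intro mult_right_mono) auto
      then show ?thesis using 1 by (simp add: mult.assoc)
    qed
    have sumle: "(\<Sum>k\<in>UNIV - {j}. cmod (v $ k)) \<le> n * (b * sqrt t)"
    proof -
      have "(\<Sum>k\<in>UNIV - {j}. cmod (v $ k)) \<le> (\<Sum>k\<in>UNIV - {j}. b * sqrt t)"
        using vk by (intro sum_mono less_imp_le) auto
      also have "\<dots> \<le> (\<Sum>k\<in>(UNIV::'n set). b * sqrt t)"
        using b st by (intro sum_mono2) auto
      finally show ?thesis by (simp add: n_def)
    qed
    have "v $ j * cnj (\<nu> $ j) = cinner v \<nu> - (\<Sum>k\<in>UNIV - {j}. v $ k * cnj (\<nu> $ k))"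
      unfolding cinner_def by (simp add: sum.remove[of UNIV j])
    then have "cmod (v $ j) * \<mu> = cmod (cinner v \<nu> - (\<Sum>k\<in>UNIV - {j}. v $ k * cnj (\<nu> $ k)))"
      by (metis \<mu>_def complex_mod_cnj norm_mult)
    also have "\<dots> \<le> cmod (cinner v \<nu>) + (\<Sum>k\<in>UNIV - {j}. cmod (v $ k * cnj (\<nu> $ k)))"
      by (rule order_trans[OF norm_triangle_ineq4 add_left_mono[OF norm_sum]])
    also have "\<dots> \<le> b * sqrt t + (\<Sum>k\<in>UNIV - {j}. cmod (v $ k))"
    proof (intro add_mono sum_mono)
      show "cmod (cinner v \<nu>) \<le> b * sqrt t" using v at by (simp add: E_def)
      show "cmod (v $ k * cnj (\<nu> $ k)) \<le> cmod (v $ k)" for k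
        using \<nu>le[of k] by (simp add: norm_mult mult_left_le)
    qed
    also have "\<dots> \<le> b * sqrt t + n * (b * sqrt t)" using sumle by simp
    finally have "cmod (v $ j) \<le> (1 + n) / \<mu> * (b * sqrt t)" using \<mu> by (simp add: field_simps)
    moreover have "norm v \<le> cmod (v $ j) + (\<Sum>k\<in>UNIV - {j}. cmod (v $ k))"
      using norm_le_sum_components[of v] by (simp add: sum.remove[of UNIV j])
    ultimately have "norm v \<le> (1 + n) / \<mu> * (b * sqrt t) + n * (b * sqrt t)" using sumle by linarith
    also have "\<dots> = b * sqrt t * \<Lambda>" by (simp add: \<Lambda>_def algebra_simps)
    finally show ?thesis .
  qed
  have inside: "p - (of_real t * w) *s \<nu> + v \<in> \<Omega>"
    if t: "0 < t" "t < t0" and w: "m0 \<le> Re w" "cmod w \<le> W" and v: "v \<in> E t" for t w v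
  proof (rule inner[rule_format])
    let ?y = "p - (of_real t * w) *s \<nu> + v - p"
    have y: "?y = v - (of_real t * w) *s \<nu>" by simp
    have st: "sqrt t > 0" "sqrt t * sqrt t = t" using t by auto
    have sq: "t \<le> sqrt t"
    proof -
      have "sqrt t \<le> 1" using tle(1)[OF t(2)] by simp
      then have "sqrt t * sqrt t \<le> 1 * sqrt t" using st by (intro mult_right_mono) auto
      then show ?thesis using st by simp
    qed
    have nw: "norm ((of_real t * w) *s \<nu>) \<le> t * W"
      using t w \<nu> by (simp add: norm_smult_complex norm_mult mult_left_mono)
    have "norm ?y \<le> norm v + norm ((of_real t * w) *s \<nu>)" unfolding y by (rule norm_triangle_ineq4)
    then have ny: "norm ?y \<le> b * sqrt t * \<Lambda> + t * W" using Enorm[OF t v] nw by linarith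
    have "t * W \<le> sqrt t * W" using sq pos by (intro mult_right_mono) auto
    with ny have "norm ?y \<le> sqrt t * D" by (simp add: D_def algebra_simps)
    also have "\<dots> < \<delta>"
    proof -
      have "sqrt t < \<delta> / D" using tle(4)[OF t(2)] pos D by (intro real_less_lsqrt) auto
      then show ?thesis using D by (simp add: field_simps)
    qed
    finally show "norm ?y < \<delta>" .
    have "(norm ?y)\<^sup>2 \<le> (b * sqrt t * \<Lambda> + t * W)\<^sup>2" using ny by (intro power_mono) auto
    also have "\<dots> \<le> 2 * (b * sqrt t * \<Lambda>)\<^sup>2 + 2 * (t * W)\<^sup>2"
      using sum_squares_bound[of "b * sqrt t * \<Lambda>" "t * W"] by (simp add: power2_sum)
    also have "(b * sqrt t * \<Lambda>)\<^sup>2 = t * (b\<^sup>2 * \<Lambda>\<^sup>2)" using t by (simp add: power_mult_distrib)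
    finally have "M * (norm ?y)\<^sup>2 \<le> M * (2 * (t * (b\<^sup>2 * \<Lambda>\<^sup>2)) + 2 * (t * W)\<^sup>2)" using pos by (intro mult_left_mono) auto
    also have "\<dots> = t * (2 * M * (b\<^sup>2 * \<Lambda>\<^sup>2)) + t * (2 * M * W\<^sup>2 * t)" by (simp add: power2_eq_square algebra_simps)
    also have "\<dots> \<le> t * (\<kappa> * m0 / 8) + t * (\<kappa> * m0 / 8)"
    proof (intro add_mono mult_left_mono)
      have "t * (16 * M * W\<^sup>2) \<le> \<kappa> * m0" using tle(3)[OF t(2)] pos by (simp add: pos_less_divide_eq)
      then show "2 * M * W\<^sup>2 * t \<le> \<kappa> * m0 / 8" by (simp add: algebra_simps)
    qed (use t b2 in auto)
    \<comment> \<open>Half of the linear gain t \<kappa> m0 / 2 obtained below, so the defining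
      inequality of the paraboloid stays strict.\<close>
    finally have 1: "M * (norm ?y)\<^sup>2 \<le> t * \<kappa> * m0 / 4" by (simp add: mult_ac)
    have "?y \<bullet> \<nu> = Re (cinner v \<nu>) - Re (of_real t * w)"
      unfolding Re_cinner[symmetric] y cinner_simps cinner_self \<nu> by simp
    also have "\<dots> \<le> a * t - t * m0"
    proof -
      have "Re (cinner v \<nu>) \<le> a * t" using v complex_Re_le_cmod[of "cinner v \<nu>"] by (simp add: E_def)
      moreover have "t * m0 \<le> Re (of_real t * w)" using w t by (simp add: mult_left_mono)
      ultimately show ?thesis by linarith
    qed
    also have "\<dots> = - (t * m0 / 2)" by (simp add: a_def)
    finally have "\<kappa> * (?y \<bullet> \<nu>) \<le> \<kappa> * (- (t * m0 / 2))" using pos by (intro mult_left_mono) auto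
    moreover have "t * \<kappa> * m0 > 0" using t pos by simp
    ultimately show "\<kappa> * (?y \<bullet> \<nu>) + M * (norm ?y)\<^sup>2 < 0" using 1 by (simp add: mult_ac)
  qed
  have E0: "0 \<in> E t" if "0 < t" for t using that a b by (simp add: E_def cinner_def)
  have Ebal: "balanced (E t)" for t
    unfolding balanced_def
  proof (intro allI ballI impI)
    fix c :: complex and v assume v: "v \<in> E t" and c: "cmod c \<le> 1"
    have *: "cmod (c * x) \<le> cmod x" for x using c by (simp add: norm_mult mult_left_le_one_le)
    show "c *s v \<in> E t"
      using v order_le_less_trans[OF *] by (simp add: E_def cinner_simps)
  qed
  have Eopen: "open (E t)" for t
  proof -
    have bl: "bounded_linear (\<lambda>v. cinner v \<nu>)" using linear_cinner by (simp add: linear_conv_bounded_linear)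
    have c: "continuous_on UNIV (\<lambda>v. cinner v \<nu>)" by (rule linear_continuous_on[OF bl])
    have "E t = {v. cmod (cinner v \<nu>) < a * t} \<inter> (\<Inter>k\<in>UNIV - {j}. {v. cmod (v $ k) < b * sqrt t})"
      by (auto simp: E_def)
    moreover have "open {v. cmod (cinner v \<nu>) < a * t}"
      by (intro open_Collect_less continuous_on_norm c continuous_on_const)
    moreover have "open (\<Inter>k\<in>UNIV - {j}. {v :: complex^'n. cmod (v $ k) < b * sqrt t})"
      by (intro open_INT ballI open_Collect_less continuous_intros) auto
    ultimately show ?thesis by (simp add: open_Int)
  qed
  define c0 where "c0 = cs * (a\<^sup>2 * (b\<^sup>2) ^ (CARD('n) - 1))"
  have c0: "c0 > 0" using cs(1) a b by (simp add: c0_def)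
  have Emeas: "c0 * t ^ (CARD('n) + 1) \<le> measure lborel (E t)" if t: "0 < t" "t < t0" for t
  proof -
    have st: "sqrt t > 0" using t by simp
    let ?B = "coord_box j 0 (a * t / 2) (b * sqrt t / 2)"
    have p: "a * t / 2 > 0" "b * sqrt t / 2 > 0" using a b st t by auto
    have sub: "skew \<nu> j -` ?B \<subseteq> E t"
    proof
      fix v assume "v \<in> skew \<nu> j -` ?B"
      then have v: "\<bar>Re (cinner v \<nu>)\<bar> < a * t / 2" "\<bar>Im (cinner v \<nu>)\<bar> < a * t / 2"
        "\<And>k. k \<noteq> j \<Longrightarrow> \<bar>Re (v $ k)\<bar> < b * sqrt t / 2 \<and> \<bar>Im (v $ k)\<bar> < b * sqrt t / 2"
        by (auto simp: coord_box_def skew_def)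
      have "cmod (cinner v \<nu>) < a * t" using cmod_le[of "cinner v \<nu>"] v(1,2) by linarith
      moreover have "cmod (v $ k) < b * sqrt t" if "k \<noteq> j" for k
        using cmod_le[of "v $ k"] v(3)[OF that] by linarith
      ultimately show "v \<in> E t" by (simp add: E_def)
    qed
    have fin: "emeasure lborel (E t) < \<infinity>"
      by (rule emeasure_bounded_finite) (use Enorm[OF t] in \<open>auto simp: bounded_iff\<close>)
    have eq: "cs * ((2 * (a * t / 2))\<^sup>2 * (4 * (b * sqrt t / 2)\<^sup>2) ^ (CARD('n) - 1)) = c0 * t ^ (CARD('n) + 1)"
    proof -
      have 1: "4 * (b * sqrt t / 2)\<^sup>2 = b\<^sup>2 * t" using t by (simp add: power_mult_distrib power_divide)
      have 2: "2 * (a * t / 2) = a * t" by simp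
      have "CARD('n) + 1 = Suc (Suc (CARD('n) - 1))" by simp
      then have 3: "t ^ (CARD('n) + 1) = t\<^sup>2 * t ^ (CARD('n) - 1)" by (simp only: power_Suc power2_eq_square mult.assoc)
      show ?thesis unfolding 1 2 3 c0_def by (simp only: power_mult_distrib mult_ac)
    qed
    have "ennreal (c0 * t ^ (CARD('n) + 1)) = ennreal cs * emeasure lborel ?B"
      unfolding coord_box(2)[OF p] eq[symmetric] using cs(1) by (intro ennreal_mult') simp
    also have "\<dots> = emeasure lborel (skew \<nu> j -` ?B)" by (rule cs(2)[OF coord_box(1)[OF p], symmetric])
    also have "\<dots> \<le> emeasure lborel (E t)" using Eopen by (intro emeasure_mono sub) auto
    also have "\<dots> = ennreal (measure lborel (E t))"
      using fin by (intro emeasure_eq_ennreal_measure less_imp_neq) simp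
    finally show ?thesis by simp
  qed
  have *: "p - (of_real t * w) *s \<nu> \<in> \<Omega>" if "0 < t" "t < t0" "m0 \<le> Re w" "cmod w \<le> W" for t w
    using inside[OF that E0[OF that(1)]] by simp
  have "Re (K z z) * t ^ (CARD('n) + 1) \<le> 1 / c0"
    if t: "0 < t" "t < t0" and w: "m0 \<le> Re w" "cmod w \<le> W" and z: "z = p - (of_real t * w) *s \<nu>" for t w z
  proof -
    have zO: "z \<in> \<Omega>" unfolding z by (rule *[OF t w])
    have "Re (K z z) * measure lborel (E t) \<le> 1"
    proof (rule kernel_diag_upper[OF zO _ _ Ebal])
      show "E t \<in> sets borel" using Eopen by simp
      show "bounded (E t)" using Enorm[OF t] by (auto simp: bounded_iff)
      show "z + v \<in> \<Omega>" if "v \<in> E t" for v unfolding z by (rule inside[OF t w that])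
    qed
    moreover have "Re (K z z) * (c0 * t ^ (CARD('n) + 1)) \<le> Re (K z z) * measure lborel (E t)"
      using kernel_pos[OF zO] by (intro mult_left_mono Emeas t) auto
    ultimately have "Re (K z z) * (c0 * t ^ (CARD('n) + 1)) \<le> 1" by linarith
    then show ?thesis using c0 by (simp add: field_simps)
  qed
  note up = this
  show ?thesis
  proof (rule exI[of _ t0], rule conjI[OF t0], rule exI[of _ "1 / c0"], intro conjI allI impI)
    show "1 / c0 > 0" using c0 by simp
    fix t w z assume t: "0 < t" "t < t0" "m0 \<le> Re w" "cmod w \<le> W" and z: "z = p - (of_real t * w) *s \<nu>"
    show "z \<in> \<Omega>" unfolding z by (rule *[OF t])
    show "Re (K z z) * t ^ (CARD('n) + 1) \<le> 1 / c0" by (rule up[OF t z])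
  qed
qed

end

subsection \<open>The lower bound for primitives\<close>

lemma mean_value_circle_2pi:
  assumes g: "g holomorphic_on cball 0 r" and r: "r > 0"
  shows "((\<lambda>\<theta>. g (of_real r * cis \<theta>)) has_integral of_real (2 * pi) * g 0) {0..2*pi}"
proof -
  have "((\<lambda>x. g (of_real r * cis (2 * pi * x))) has_integral g 0) (cbox 0 1)"
    using mean_value_circle[OF g r] by simp
  from has_integral_affinity'[OF this, of "1 / (2 * pi)" 0]
  show ?thesis by (simp add: scaleR_conv_of_real)
qed

text \<open>The integrand is the real part of Ln (1 + z), which is holomorphic on the disc because
  Re (1 + z) > 0 there, and which vanishes at 0. Thus the denominator of the Cayley transform
  contributes nothing to circle means.\<close>

lemma integral_ln_norm_one_plus:
  assumes R: "0 < R" "R < 1"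
  shows "((\<lambda>\<theta>. ln (cmod (1 + of_real R * cis \<theta>))) has_integral 0) {0..2*pi}"
proof -
  have re: "0 < Re (1 + z)" if "z \<in> cball 0 R" for z
    using that R abs_Re_le_cmod[of z] by simp
  have "(\<lambda>z. Ln (1 + z)) holomorphic_on cball 0 R"
    using re by (intro holomorphic_intros) (auto simp: complex_nonpos_Reals_iff, force)
  from has_integral_linear[OF mean_value_circle_2pi[OF this R(1)] bounded_linear_Re]
  have *: "((\<lambda>\<theta>. Re (Ln (1 + of_real R * cis \<theta>))) has_integral 0) {0..2*pi}" by (simp add: o_def)
  show ?thesis
  proof (rule has_integral_eq[OF _ *])
    fix \<theta>
    have "of_real R * cis \<theta> \<in> cball 0 R" using R by (simp add: norm_mult)
    from re[OF this] have "1 + of_real R * cis \<theta> \<noteq> 0" by (metis less_irrefl zero_complex.sel(1))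
    then show "Re (Ln (1 + of_real R * cis \<theta>)) = ln (cmod (1 + of_real R * cis \<theta>))" by simp
  qed
qed

text \<open>Maps the unit disc onto the right half-plane and 0 to 1, so that the normal discs
  approach the boundary from inside.\<close>

definition cayley :: "complex \<Rightarrow> complex" where
  "cayley \<zeta> = (1 - \<zeta>) / (1 + \<zeta>)"

lemma Re_cayley: "cmod \<zeta> < 1 \<Longrightarrow> Re (cayley \<zeta>) = (1 - (cmod \<zeta>)\<^sup>2) / (cmod (1 + \<zeta>))\<^sup>2"
  unfolding cayley_def cmod_power2 by (simp add: Re_divide power2_eq_square algebra_simps)

text \<open>On the disc of radius \<open>r\<close> the modulus of 1 + \<zeta> lies between 1 - r and
  2. The two bounds serve as the parameters \<open>m0\<close> and \<open>W\<close> of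
  \<open>kernel_upper_bound\<close>.\<close>

lemma cayley_bounds:
  assumes \<zeta>: "cmod \<zeta> \<le> r" and r: "r < 1"
  shows "(1 - r\<^sup>2) / 4 \<le> Re (cayley \<zeta>)" "cmod (cayley \<zeta>) \<le> 2 / (1 - r)"
proof -
  have l: "1 - r \<le> cmod (1 + \<zeta>)" using norm_triangle_ineq2[of 1 "- \<zeta>"] \<zeta> by simp
  have u: "cmod (1 + \<zeta>) \<le> 2" using norm_triangle_ineq[of 1 \<zeta>] \<zeta> r by simp
  have p: "cmod (1 + \<zeta>) > 0" using l r by linarith
  have "(cmod (1 + \<zeta>))\<^sup>2 \<le> 2\<^sup>2" using u by (intro power_mono) auto
  moreover have "(cmod \<zeta>)\<^sup>2 \<le> r\<^sup>2" using \<zeta> by (intro power_mono) auto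
  moreover have "(cmod \<zeta>)\<^sup>2 \<le> 1" using \<zeta> r by (intro power_le_one) auto
  ultimately have "(1 - r\<^sup>2) / 4 \<le> (1 - (cmod \<zeta>)\<^sup>2) / (cmod (1 + \<zeta>))\<^sup>2"
    using p by (intro order_trans[OF divide_right_mono[of "1 - r\<^sup>2" "1 - (cmod \<zeta>)\<^sup>2" 4] divide_left_mono]) auto
  then show "(1 - r\<^sup>2) / 4 \<le> Re (cayley \<zeta>)" using Re_cayley[of \<zeta>] \<zeta> r by simp
  have "cmod (1 - \<zeta>) \<le> 2" using norm_triangle_ineq4[of 1 \<zeta>] \<zeta> r by simp
  then show "cmod (cayley \<zeta>) \<le> 2 / (1 - r)" unfolding cayley_def norm_divide using l r by (intro frac_le) auto
qed

lemma cayley_deriv: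
  assumes "cmod \<zeta> < 1"
  shows "(cayley has_field_derivative - 2 / (1 + \<zeta>)\<^sup>2) (at \<zeta>)"
    and "((\<lambda>\<zeta>. - 2 / (1 + \<zeta>)\<^sup>2) has_field_derivative 4 / (1 + \<zeta>) ^ 3) (at \<zeta>)"
proof -
  have n: "1 + \<zeta> \<noteq> 0" using assms by (metis add.commute add_eq_0_iff norm_minus_cancel norm_one order_less_irrefl)
  show "(cayley has_field_derivative - 2 / (1 + \<zeta>)\<^sup>2) (at \<zeta>)"
    unfolding cayley_def[abs_def] using n
    by (auto intro!: derivative_eq_intros simp: power2_eq_square field_simps)
  show "((\<lambda>\<zeta>. - 2 / (1 + \<zeta>)\<^sup>2) has_field_derivative 4 / (1 + \<zeta>) ^ 3) (at \<zeta>)"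
  proof -
    have "((\<lambda>\<zeta>. - 2 * (inverse (1 + \<zeta>) * inverse (1 + \<zeta>))) has_field_derivative
        - 2 * (inverse (1 + \<zeta>) * - (inverse (1 + \<zeta>) * 1 * inverse (1 + \<zeta>)) + - (inverse (1 + \<zeta>) * 1 * inverse (1 + \<zeta>)) * inverse (1 + \<zeta>))) (at \<zeta>)"
      using n by (auto intro!: derivative_eq_intros)
    then show ?thesis
      by (simp add: power2_eq_square power3_eq_cube divide_inverse mult.assoc)
  qed
qed

text \<open>A real \<open>1\<close>-form \<open>a dx + b dy\<close> on a complex line is encoded by the function \<open>a - \<i> b\<close>, so that pulling it
  back by a holomorphic \<open>g\<close> is multiplication by \<open>g'\<close>.\<close>

lemma pullback_has_derivative:
  fixes \<gamma> :: "complex^'n \<Rightarrow> complex"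
  assumes g: "(g has_field_derivative g1 \<zeta>) (at \<zeta>)" and g1: "(g1 has_field_derivative g2) (at \<zeta>)"
    and \<gamma>: "(\<gamma> has_derivative \<gamma>') (at (p + g \<zeta> *s \<nu>))"
  shows "((\<lambda>\<zeta>. g1 \<zeta> * \<gamma> (p + g \<zeta> *s \<nu>)) has_derivative
      (\<lambda>h. g2 * h * \<gamma> (p + g \<zeta> *s \<nu>) + g1 \<zeta> * (of_real (Re (g1 \<zeta> * h)) * \<gamma>' \<nu> + of_real (Im (g1 \<zeta> * h)) * \<gamma>' (\<i> *s \<nu>)))) (at \<zeta>)"
proof -
  have "((\<lambda>\<zeta>. g \<zeta> *s \<nu>) has_derivative (\<lambda>h. (g1 \<zeta> * h) *s \<nu>)) (at \<zeta>)"
    by (rule bounded_linear.has_derivative[OF bounded_linear_smult_left g[unfolded has_field_derivative_def]])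
  then have F: "((\<lambda>\<zeta>. p + g \<zeta> *s \<nu>) has_derivative (\<lambda>h. (g1 \<zeta> * h) *s \<nu>)) (at \<zeta>)"
    using has_derivative_add[OF has_derivative_const[of p]] by fastforce
  have l: "linear \<gamma>'" using \<gamma> has_derivative_linear by blast
  have c: "\<gamma>' (c *s \<nu>) = of_real (Re c) * \<gamma>' \<nu> + of_real (Im c) * \<gamma>' (\<i> *s \<nu>)" for c
  proof -
    have "c *s \<nu> = Re c *\<^sub>R \<nu> + Im c *\<^sub>R (\<i> *s \<nu>)"
      by (simp add: scaleR_smult_complex vector_smult_assoc flip: vector_sadd_rdistrib) (simp add: complex_eq_iff mult.commute)
    then have "\<gamma>' (c *s \<nu>) = Re c *\<^sub>R \<gamma>' \<nu> + Im c *\<^sub>R \<gamma>' (\<i> *s \<nu>)"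
      by (simp only: linear_add[OF l] linear_cmul[OF l])
    then show ?thesis by (simp only: scaleR_conv_of_real)
  qed
  have "((\<lambda>\<zeta>. g1 \<zeta> * \<gamma> (p + g \<zeta> *s \<nu>)) has_derivative
      (\<lambda>h. g1 \<zeta> * \<gamma>' ((g1 \<zeta> * h) *s \<nu>) + (g2 * h) * \<gamma> (p + g \<zeta> *s \<nu>))) (at \<zeta>)"
    by (rule has_derivative_mult[OF g1[unfolded has_field_derivative_def] has_derivative_compose[OF F \<gamma>]])
  then show ?thesis unfolding c[of "g1 \<zeta> * h" for h] by (simp only: add.commute)
qed

text \<open>The combination D(1) + i D(i) annihilates complex linear maps, so the term with
  \<open>G\<close>, which carries the second derivative of the disc, drops out; the rest scales by
  the Jacobian |a|^2.\<close>

lemma pullback_curl: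
  fixes a x y G :: complex
  defines "D \<equiv> \<lambda>h. G * h + a * (of_real (Re (a * h)) * x + of_real (Im (a * h)) * y)"
  shows "D 1 + \<i> * D \<i> = of_real ((cmod a)\<^sup>2) * (x + \<i> * y)"
  unfolding D_def complex_norm_square by (simp add: complex_eq_iff algebra_simps)

text \<open>For R = 1 - exp (- X) both logarithms equal X up to bounded terms, so a coefficient N
  larger than D is contradicted by a large X.\<close>

lemma le_of_log_growth:
  fixes N D B :: real
  assumes le: "\<And>R. 1/2 < R \<Longrightarrow> R < 1 \<Longrightarrow> - N * ln (1 - R\<^sup>2) - B \<le> D * ln (2 / (1 - R))" and N: "N > 0"
  shows "N \<le> D"
proof (rule ccontr)
  assume "\<not> N \<le> D"
  then have ND: "N - D > 0" by simp
  \<comment> \<open>Just beyond the value at which the inequality would force a contradiction; the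
    lower bound 2 ensures R > 1/2.\<close>
  define X where "X = max 2 ((B + (N + D) * ln 2) / (N - D) + 1)"
  have X: "X \<ge> 2" "(B + (N + D) * ln 2) / (N - D) < X" by (auto simp: X_def)
  define R where "R = 1 - exp (- X)"
  have e: "exp (- X) < (1/2::real)"
  proof -
    have "exp (-X) \<le> exp (-2)" using X by simp
    also have "exp (-2) < (1/2::real)"
      using less_imp_inverse_less[of 2 "exp 2 :: real"] exp_ge_add_one_self[of "2::real"] by (simp add: exp_minus)
    finally show ?thesis .
  qed
  have R: "1/2 < R" "R < 1" using e by (auto simp: R_def)
  have "1 - R\<^sup>2 = (1 + R) * (1 - R)" by (simp add: power2_eq_square algebra_simps)
  also have "\<dots> \<le> 2 * (1 - R)" using R by (intro mult_right_mono) auto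
  also have "\<dots> = 2 * exp (- X)" by (simp add: R_def)
  finally have "ln (1 - R\<^sup>2) \<le> ln (2 * exp (- X))"
    using R by (subst ln_le_cancel_iff) (auto simp: abs_square_less_1)
  also have "\<dots> = ln 2 - X" by (simp add: ln_mult)
  finally have "N * ln (1 - R\<^sup>2) \<le> N * (ln 2 - X)" using N by (intro mult_left_mono) auto
  then have "N * (X - ln 2) \<le> - N * ln (1 - R\<^sup>2)" by (simp add: right_diff_distrib)
  also have "\<dots> \<le> D * ln (2 / (1 - R)) + B" using le[OF R] by simp
  also have "ln (2 / (1 - R)) = ln 2 + X" by (simp add: R_def ln_div)
  finally have "(N - D) * X \<le> B + (N + D) * ln 2" by (simp add: algebra_simps)
  then have "X \<le> (B + (N + D) * ln 2) / (N - D)" using ND by (simp add: pos_le_divide_eq mult.commute)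
  then show False using X by simp
qed

section \<open>Comparison of the two growth rates along normal discs\<close>

context bounded_open_set
begin

text \<open>Both the primitive and the form given by the potential are restricted to the line and
  pulled back by the disc; each has curl |g1|^2 times \<open>dens\<close>, so
  \<open>disc_mean_growth\<close> applies. For the primitive this is d\<eta> = \<omega> evaluated on
  \<open>\<nu>\<close> and i times \<open>\<nu>\<close>.\<close>

lemma primitive_disc_bound:
  fixes p \<nu> :: "complex^'n" and \<eta> :: "complex^'n \<Rightarrow> complex^'n \<Rightarrow> real"
  assumes prim: "is_primitive_on \<Omega> \<eta> (bergman_form \<Omega>)"
    and bd: "\<And>z c. z \<in> \<Omega> \<Longrightarrow> \<bar>\<eta> z (c *s \<nu>)\<bar> \<le> C * cmod c * sqrt (dens \<nu> z)" and C: "C > 0"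
    and g: "\<And>\<zeta>. \<zeta> \<in> ball 0 \<rho> \<Longrightarrow> (g has_field_derivative g1 \<zeta>) (at \<zeta>)"
    and g1: "\<And>\<zeta>. \<zeta> \<in> ball 0 \<rho> \<Longrightarrow> (g1 has_field_derivative g2 \<zeta>) (at \<zeta>)"
    and g2: "continuous_on (ball 0 \<rho>) g2"
    and inO: "\<And>\<zeta>. \<zeta> \<in> ball 0 \<rho> \<Longrightarrow> p + g \<zeta> *s \<nu> \<in> \<Omega>"
    and r: "0 < r" "r < R" "R < s" "s < \<rho>"
  shows "integral {0..2*pi} (\<lambda>\<theta>. pot (p + g (of_real R * cis \<theta>) *s \<nu>)) - integral {0..2*pi} (\<lambda>\<theta>. pot (p + g (of_real r * cis \<theta>) *s \<nu>))
    \<le> 4 * pi * C\<^sup>2 * (ln (ln (s / r)) - ln (ln (s / R)))"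
proof -
  let ?F = "\<lambda>\<zeta>. p + g \<zeta> *s \<nu>" and ?B = "ball 0 \<rho> :: complex set"
  have of1: "one_form_on \<Omega> \<eta>" and dp: "\<And>z u v. z \<in> \<Omega> \<Longrightarrow> exterior_derivative \<eta> z u v = bergman_form \<Omega> z u v"
    using prim by (auto simp: is_primitive_on_def)
  have lin: "linear (\<eta> z)" if "z \<in> \<Omega>" for z using of1 that by (simp add: one_form_on_def)
  have ck: "Ck_on k \<Omega> (\<lambda>z. \<eta> z v)" for k v using of1 by (simp add: one_form_on_def smooth_on_def)
  let ?D = "\<lambda>v z. frechet_derivative (\<lambda>z. \<eta> z v) (at z)"
  have \<eta>d: "((\<lambda>z. \<eta> z v) has_derivative ?D v z) (at z)" if "z \<in> \<Omega>" for v z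
    using ck[of "Suc 0" v] that by (simp add: frechet_derivative_works)
  have \<eta>c: "continuous_on \<Omega> (\<lambda>z. ?D v z u)" for u v using ck[of "Suc 0" v] by simp
  have \<eta>c0: "continuous_on \<Omega> (\<lambda>z. \<eta> z v)" for v using ck[of 0 v] by simp
  define \<gamma> where "\<gamma> z = complex_of_real (\<eta> z \<nu>) - \<i> * complex_of_real (\<eta> z (\<i> *s \<nu>))" for z
  define \<gamma>' where "\<gamma>' z u = complex_of_real (?D \<nu> z u) - \<i> * complex_of_real (?D (\<i> *s \<nu>) z u)" for z u
  \<comment> \<open>Encodes the form taking u to - d pot(i u) / 2, the primitive of \<omega> on the
    line that comes from the potential.\<close>
  define \<delta> where "\<delta> z = - \<i> * cnj (P \<nu> z)" for z
  define \<delta>' where "\<delta>' z u = - \<i> * cnj (P' \<nu> z u)" for z u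
  have \<gamma>d: "(\<gamma> has_derivative \<gamma>' z) (at z)" if "z \<in> \<Omega>" for z
    unfolding \<gamma>_def[abs_def] \<gamma>'_def[abs_def]
    by (intro has_derivative_diff has_derivative_of_real has_derivative_mult_right \<eta>d that)
  have \<delta>d: "(\<delta> has_derivative \<delta>' z) (at z)" if "z \<in> \<Omega>" for z
    unfolding \<delta>_def[abs_def] \<delta>'_def[abs_def]
    by (intro has_derivative_mult_right has_derivative_cnj P_has_derivative that)
  have \<gamma>c: "continuous_on \<Omega> (\<lambda>z. \<gamma>' z u)" for u
    unfolding \<gamma>'_def by (intro continuous_on_diff continuous_on_mult continuous_on_const continuous_on_of_real \<eta>c)
  have \<delta>c: "continuous_on \<Omega> (\<lambda>z. \<delta>' z u)" for u
    unfolding \<delta>'_def by (intro continuous_on_mult continuous_on_const continuous_on_cnj P'_continuous)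
  have gc: "continuous_on ?B g" and g1c: "continuous_on ?B g1"
    using g g1 by (meson DERIV_isCont continuous_at_imp_continuous_on)+
  have Fc: "continuous_on ?B ?F" by (intro continuous_on_add continuous_on_const continuous_on_smult gc)
  have comp: "continuous_on ?B (\<lambda>\<zeta>. q (?F \<zeta>))" if "continuous_on \<Omega> q" for q :: "complex^'n \<Rightarrow> complex"
    by (rule continuous_on_compose2[OF that Fc]) (use inO in auto)
  have c1: "continuous_on ?B (\<lambda>\<zeta>. g2 \<zeta> * h * q (?F \<zeta>) + g1 \<zeta> * (of_real (Re (g1 \<zeta> * h)) * q' (?F \<zeta>) \<nu> + of_real (Im (g1 \<zeta> * h)) * q' (?F \<zeta>) (\<i> *s \<nu>)))"
    if "\<And>z. z \<in> \<Omega> \<Longrightarrow> (q has_derivative q' z) (at z)" "\<And>u. continuous_on \<Omega> (\<lambda>z. q' z u)" for q q' h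
  proof -
    have "continuous_on \<Omega> q" using that(1) by (meson continuous_at_imp_continuous_on has_derivative_continuous)
    note cq = comp[OF this] comp[OF that(2)[of \<nu>]] comp[OF that(2)[of "\<i> *s \<nu>"]]
    show ?thesis
      by (intro continuous_on_add continuous_on_mult continuous_on_const continuous_on_of_real continuous_on_Re continuous_on_Im g2 g1c cq)
  qed
  have curl\<gamma>: "Im (\<gamma>' z \<nu> + \<i> * \<gamma>' z (\<i> *s \<nu>)) = - dens \<nu> z" if z: "z \<in> \<Omega>" for z
  proof -
    have "bergman_form \<Omega> z \<nu> (\<i> *s \<nu>) = dens \<nu> z" using bergman_form_line[OF z, of 1 \<nu>] by simp
    with dp[OF z, of \<nu> "\<i> *s \<nu>"] show ?thesis by (simp add: exterior_derivative_def \<gamma>'_def)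
  qed
  have curl\<delta>: "Im (\<delta>' z \<nu> + \<i> * \<delta>' z (\<i> *s \<nu>)) = - dens \<nu> z" for z
    by (simp add: \<delta>'_def dens_def)
  let ?pb = "\<lambda>q q' \<zeta> h. g2 \<zeta> * h * q (?F \<zeta>) + g1 \<zeta> * (of_real (Re (g1 \<zeta> * h)) * q' (?F \<zeta>) \<nu> + of_real (Im (g1 \<zeta> * h)) * q' (?F \<zeta>) (\<i> *s \<nu>))"
  have curl: "Im (?pb q q' \<zeta> 1 + \<i> * ?pb q q' \<zeta> \<i>) = (cmod (g1 \<zeta>))\<^sup>2 * Im (q' (?F \<zeta>) \<nu> + \<i> * q' (?F \<zeta>) (\<i> *s \<nu>))" for q :: "complex^'n \<Rightarrow> complex" and q' \<zeta>
  proof -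
    have "?pb q q' \<zeta> 1 + \<i> * ?pb q q' \<zeta> \<i> = of_real ((cmod (g1 \<zeta>))\<^sup>2) * (q' (?F \<zeta>) \<nu> + \<i> * q' (?F \<zeta>) (\<i> *s \<nu>))"
      using pullback_curl[of "g2 \<zeta> * q (?F \<zeta>)" "g1 \<zeta>" "q' (?F \<zeta>) \<nu>" "q' (?F \<zeta>) (\<i> *s \<nu>)"] by (simp only: mult_ac)
    then show ?thesis by (simp only: Im_complex_of_real times_complex.sel Re_complex_of_real mult_zero_left add_0_right)
  qed
  have cc\<gamma>: "continuous_on ?B (\<lambda>\<zeta>. ?pb \<gamma> \<gamma>' \<zeta> h)" for h by (rule c1[OF \<gamma>d \<gamma>c])
  have cc\<delta>: "continuous_on ?B (\<lambda>\<zeta>. ?pb \<delta> \<delta>' \<zeta> h)" for h by (rule c1[OF \<delta>d \<delta>c])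
  show ?thesis
  proof (rule disc_mean_growth[where \<phi>="\<lambda>\<zeta>. pot (?F \<zeta>)" and \<kappa>="\<lambda>\<zeta>. (cmod (g1 \<zeta>))\<^sup>2 * dens \<nu> (?F \<zeta>)"
        and c="\<lambda>\<zeta>. g1 \<zeta> * \<gamma> (?F \<zeta>)" and c'="?pb \<gamma> \<gamma>'" and d="\<lambda>\<zeta>. g1 \<zeta> * \<delta> (?F \<zeta>)" and d'="?pb \<delta> \<delta>'" and \<rho>=\<rho>, OF _ _ _ _ _ _ _ _ _ _ _ C r])
    fix \<zeta> assume \<zeta>: "\<zeta> \<in> ?B"
    note FO = inO[OF \<zeta>]
    show "((\<lambda>\<zeta>. g1 \<zeta> * \<gamma> (?F \<zeta>)) has_derivative ?pb \<gamma> \<gamma>' \<zeta>) (at \<zeta>)"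
      by (rule pullback_has_derivative[OF g[OF \<zeta>] g1[OF \<zeta>] \<gamma>d[OF FO]])
    show "((\<lambda>\<zeta>. g1 \<zeta> * \<delta> (?F \<zeta>)) has_derivative ?pb \<delta> \<delta>' \<zeta>) (at \<zeta>)"
      by (rule pullback_has_derivative[OF g[OF \<zeta>] g1[OF \<zeta>] \<delta>d[OF FO]])
    show "Im (?pb \<gamma> \<gamma>' \<zeta> 1 + \<i> * ?pb \<gamma> \<gamma>' \<zeta> \<i>) = - ((cmod (g1 \<zeta>))\<^sup>2 * dens \<nu> (?F \<zeta>))"
      unfolding curl curl\<gamma>[OF FO] by simp
    show "Im (?pb \<delta> \<delta>' \<zeta> 1 + \<i> * ?pb \<delta> \<delta>' \<zeta> \<i>) = - ((cmod (g1 \<zeta>))\<^sup>2 * dens \<nu> (?F \<zeta>))"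
      unfolding curl curl\<delta> by simp
    show "0 \<le> (cmod (g1 \<zeta>))\<^sup>2 * dens \<nu> (?F \<zeta>)" using dens_nonneg[OF FO] by simp
    fix v
    have "Re (g1 \<zeta> * \<gamma> (?F \<zeta>) * v) = \<eta> (?F \<zeta>) ((g1 \<zeta> * v) *s \<nu>)"
    proof -
      have "(g1 \<zeta> * v) *s \<nu> = Re (g1 \<zeta> * v) *\<^sub>R \<nu> + Im (g1 \<zeta> * v) *\<^sub>R (\<i> *s \<nu>)"
        by (simp only: scaleR_smult_complex vector_smult_assoc vector_sadd_rdistrib[symmetric])
           (rule arg_cong[where f="\<lambda>c. c *s \<nu>"], simp add: complex_eq_iff)
      then have "\<eta> (?F \<zeta>) ((g1 \<zeta> * v) *s \<nu>) = Re (g1 \<zeta> * v) * \<eta> (?F \<zeta>) \<nu> + Im (g1 \<zeta> * v) * \<eta> (?F \<zeta>) (\<i> *s \<nu>)"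
        by (simp only: linear_add[OF lin[OF FO]] linear_cmul[OF lin[OF FO]] real_scaleR_def)
      moreover have "Re (g1 \<zeta> * \<gamma> (?F \<zeta>) * v) = Re ((g1 \<zeta> * v) * \<gamma> (?F \<zeta>))" by (simp only: mult_ac)
      moreover have "Re (a * \<gamma> z) = Re a * \<eta> z \<nu> + Im a * \<eta> z (\<i> *s \<nu>)" for a z by (simp add: \<gamma>_def)
      ultimately show ?thesis by (simp only:)
    qed
    also have "\<bar>\<dots>\<bar> \<le> C * cmod (g1 \<zeta> * v) * sqrt (dens \<nu> (?F \<zeta>))" by (rule bd[OF FO])
    also have "\<dots> = C * cmod v * sqrt ((cmod (g1 \<zeta>))\<^sup>2 * dens \<nu> (?F \<zeta>))"
      by (simp add: norm_mult real_sqrt_mult)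
    finally show "\<bar>Re (g1 \<zeta> * \<gamma> (?F \<zeta>) * v)\<bar> \<le> C * cmod v * sqrt ((cmod (g1 \<zeta>))\<^sup>2 * dens \<nu> (?F \<zeta>))" .
  next
    fix \<zeta> assume \<zeta>: "\<zeta> \<in> ?B"
    note FO = inO[OF \<zeta>]
    have "((\<lambda>\<zeta>. g \<zeta> *s \<nu>) has_derivative (\<lambda>h. (g1 \<zeta> * h) *s \<nu>)) (at \<zeta>)"
      by (rule bounded_linear.has_derivative[OF bounded_linear_smult_left g[OF \<zeta>, unfolded has_field_derivative_def]])
    then have "(?F has_derivative (\<lambda>h. 0 + (g1 \<zeta> * h) *s \<nu>)) (at \<zeta>)"
      by (intro has_derivative_add has_derivative_const)
    then have "(?F has_derivative (\<lambda>h. (g1 \<zeta> * h) *s \<nu>)) (at \<zeta>)" by simp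
    from has_derivative_compose[OF this pot_has_derivative[OF FO]]
    show "((\<lambda>\<zeta>. pot (?F \<zeta>)) has_derivative (\<lambda>v. 2 * Re (\<i> * (g1 \<zeta> * \<delta> (?F \<zeta>)) * v))) (at \<zeta>)"
      by (rule has_derivative_eq_rhs) (simp add: fun_eq_iff P_scale[OF FO] \<delta>_def algebra_simps)
  qed (rule cc\<gamma> cc\<delta>)+
qed

lemma primitive_bound_lower:
  fixes \<eta> :: "complex^'n \<Rightarrow> complex^'n \<Rightarrow> real"
  assumes prim: "is_primitive_on \<Omega> \<eta> (bergman_form \<Omega>)"
    and bd: "\<And>z v c. z \<in> \<Omega> \<Longrightarrow> \<bar>\<eta> z (c *s v)\<bar> \<le> C * cmod c * sqrt (dens v z)" and C: "C > 0"
    and ne: "\<Omega> \<noteq> {}" and sp: "strongly_pseudoconvex_smooth \<Omega>"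
  shows "(real CARD('n) + 1) / 2 \<le> C\<^sup>2"
proof -
  define N where "N = real (CARD('n) + 1)"
  have N0: "N > 0" by (simp add: N_def)
  obtain p \<nu> :: "complex^'n" and R0 \<kappa> M \<delta> :: real
    where R0: "R0 > 0" and \<nu>: "norm \<nu> = 1" and p: "p = R0 *\<^sub>R \<nu>" and outer: "\<forall>z\<in>\<Omega>. norm z \<le> R0"
      and pos: "\<kappa> > 0" "M > 0" "\<delta> > 0"
      and inner: "\<forall>z. norm (z - p) < \<delta> \<longrightarrow> \<kappa> * ((z - p) \<bullet> \<nu>) + M * (norm (z - p))\<^sup>2 < 0 \<longrightarrow> z \<in> \<Omega>"
    using farthest_point[OF open_domain ne bounded_domain sp] by (elim exE conjE)
  obtain c where c: "c > 0" and low: "\<forall>z\<in>\<Omega>. 0 < (p - z) \<bullet> \<nu> \<longrightarrow> c \<le> Re (K z z) * ((p - z) \<bullet> \<nu>) ^ (CARD('n) + 1)"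
    using kernel_lower_bound[OF R0 \<nu> p outer] by (elim exE conjE)
  \<comment> \<open>The inner radius is fixed once and for all, so that \<open>Cu\<close> and
    \<open>t1\<close> do not depend on \<open>R\<close>.\<close>
  let ?r = "1 / 2 :: real"
  have mW: "0 < (1 - ?r\<^sup>2) / 4" "0 < 2 / (1 - ?r)" by (simp_all add: power2_eq_square)
  obtain t1 Cu where t1: "t1 > 0" and Cu: "Cu > 0"
    and up: "\<forall>t w z. 0 < t \<longrightarrow> t < t1 \<longrightarrow> (1 - ?r\<^sup>2) / 4 \<le> Re w \<longrightarrow> cmod w \<le> 2 / (1 - ?r) \<longrightarrow> z = p - (of_real t * w) *s \<nu> \<longrightarrow>
      z \<in> \<Omega> \<and> Re (K z z) * t ^ (CARD('n) + 1) \<le> Cu"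
    using kernel_upper_bound[OF \<nu> pos mW inner] by (elim exE conjE)
  have main: "- N * ln (1 - R\<^sup>2) - (ln Cu - ln c) \<le> (2 * C\<^sup>2) * ln (2 / (1 - R))" if R: "1/2 < R" "R < 1" for R
  proof -
    \<comment> \<open>The geometric mean of R and 1: then ln (s / R) = - ln R / 2 is at least (1 -
      R) / 2, which converts the iterated logarithm into ln (2 / (1 - R)).\<close>
    define s where "s = sqrt R"
    have s: "R < s" "s < 1" "s > 0"
    proof -
      have "R * R < R * 1" using R by (intro mult_strict_left_mono) auto
      then show "R < s" unfolding s_def using R by (intro real_less_rsqrt) (simp add: power2_eq_square)
    qed (use R in \<open>auto simp: s_def\<close>)
    define \<rho> where "\<rho> = (1 + s) / 2"
    have \<rho>: "s < \<rho>" "\<rho> < 1" "0 < \<rho>" using s by (auto simp: \<rho>_def)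
    have \<rho>2: "\<rho>\<^sup>2 < 1" using \<rho> by (simp add: abs_square_less_1)
    have mW2: "0 < (1 - \<rho>\<^sup>2) / 4" "0 < 2 / (1 - \<rho>)" using \<rho> \<rho>2 by simp_all
    \<comment> \<open>A second application, at the larger radius \<open>\<rho>\<close>, for the
      containment of the whole disc; the threshold \<open>t2\<close> depends on
      \<open>R\<close>.\<close>
    obtain t2 C2 where t2: "t2 > 0"
      and in2: "\<forall>t w z. 0 < t \<longrightarrow> t < t2 \<longrightarrow> (1 - \<rho>\<^sup>2) / 4 \<le> Re w \<longrightarrow> cmod w \<le> 2 / (1 - \<rho>) \<longrightarrow> z = p - (of_real t * w) *s \<nu> \<longrightarrow>
        z \<in> \<Omega> \<and> Re (K z z) * t ^ (CARD('n) + 1) \<le> C2"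
      using kernel_upper_bound[OF \<nu> pos mW2 inner] by (elim exE conjE)
    define t where "t = min t1 t2 / 2"
    have t: "t > 0" "t < t1" "t < t2" using t1 t2 by (auto simp: t_def)
    define g where "g \<zeta> = - (complex_of_real t * cayley \<zeta>)" for \<zeta>
    define g1 where "g1 \<zeta> = - (complex_of_real t * (- 2 / (1 + \<zeta>)\<^sup>2))" for \<zeta>
    define g2 where "g2 \<zeta> = - (complex_of_real t * (4 / (1 + \<zeta>) ^ 3))" for \<zeta>
    have F: "p + g \<zeta> *s \<nu> = p - (of_real t * cayley \<zeta>) *s \<nu>" for \<zeta>
      by (simp add: g_def vec_eq_iff)
    have g: "(g has_field_derivative g1 \<zeta>) (at \<zeta>)" "(g1 has_field_derivative g2 \<zeta>) (at \<zeta>)" if "\<zeta> \<in> ball 0 \<rho>" for \<zeta>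
    proof -
      have "cmod \<zeta> < 1" using that \<rho> by simp
      then show "(g has_field_derivative g1 \<zeta>) (at \<zeta>)" "(g1 has_field_derivative g2 \<zeta>) (at \<zeta>)"
        unfolding g_def[abs_def] g1_def[abs_def] g2_def by (intro DERIV_minus DERIV_cmult cayley_deriv; assumption)+
    qed
    have nz: "1 + \<zeta> \<noteq> 0" if "cmod \<zeta> < 1" for \<zeta> :: complex
      using that by (metis add.commute add_eq_0_iff norm_minus_cancel norm_one order_less_irrefl)
    have g2c: "continuous_on (ball 0 \<rho>) g2"
      unfolding g2_def using nz \<rho> by (intro continuous_intros) auto
    have inO: "p + g \<zeta> *s \<nu> \<in> \<Omega>" if "\<zeta> \<in> ball 0 \<rho>" for \<zeta>
    proof -
      have "cmod \<zeta> \<le> \<rho>" using that by simp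
      from in2[rule_format, OF t(1,3) cayley_bounds[OF this \<rho>(2)] F] show ?thesis ..
    qed
    let ?f = "\<lambda>R \<theta>. pot (p + g (of_real R * cis \<theta>) *s \<nu>)"
    have ineq: "integral {0..2*pi} (?f R) - integral {0..2*pi} (?f ?r) \<le> 4 * pi * C\<^sup>2 * (ln (ln (s / ?r)) - ln (ln (s / R)))"
      by (rule primitive_disc_bound[OF prim bd C g g2c inO _ _ s(1) \<rho>(1)]) (use R in auto)
    have int: "?f R integrable_on {0..2*pi}" if R: "0 < R" "R < \<rho>" for R
    proof -
      have "continuous_on \<Omega> pot"
        using pot_has_derivative by (meson continuous_at_imp_continuous_on has_derivative_continuous)
      moreover have "continuous_on (ball 0 \<rho>) g"
        using g(1) by (meson DERIV_isCont continuous_at_imp_continuous_on)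
      then have "continuous_on (ball 0 \<rho>) (\<lambda>\<zeta>. p + g \<zeta> *s \<nu>)"
        by (intro continuous_on_add continuous_on_const continuous_on_smult)
      ultimately have "continuous_on (ball 0 \<rho>) (\<lambda>\<zeta>. pot (p + g \<zeta> *s \<nu>))"
        by (rule continuous_on_compose2) (use inO in auto)
      then have "continuous_on {0..2*pi} (?f R)"
        by (rule continuous_on_polar) (use R in \<open>auto intro!: continuous_intros\<close>)
      then show ?thesis by (rule integrable_continuous_interval)
    qed
    have upper: "integral {0..2*pi} (?f ?r) \<le> 2 * pi * (ln Cu - N * ln t)"
    proof -
      have "?f ?r \<theta> \<le> ln Cu - N * ln t" for \<theta>
      proof -
        let ?\<zeta> = "of_real ?r * cis \<theta>" and ?z = "p + g (of_real ?r * cis \<theta>) *s \<nu>"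
        have n: "cmod ?\<zeta> \<le> ?r" by (simp add: norm_mult)
        have zO: "?z \<in> \<Omega>" using \<rho> s R by (intro inO) (simp add: norm_mult)
        have k: "Re (K ?z ?z) > 0" by (rule kernel_pos[OF zO])
        have "Re (K ?z ?z) * t ^ (CARD('n) + 1) \<le> Cu"
          using up[rule_format, OF t(1,2) cayley_bounds[OF n] F] by simp
        then have "ln (Re (K ?z ?z) * t ^ (CARD('n) + 1)) \<le> ln Cu" using k t Cu by (subst ln_le_cancel_iff) auto
        moreover have "ln (Re (K ?z ?z) * t ^ (CARD('n) + 1)) = ln (Re (K ?z ?z)) + N * ln t"
          using k t by (simp only: ln_mult_pos zero_less_power ln_realpow N_def)
        ultimately show ?thesis by (simp add: pot_def)
      qed
      then have "integral {0..2*pi} (?f ?r) \<le> integral {0..2*pi} (\<lambda>\<theta>. ln Cu - N * ln t)"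
        using R s \<rho> by (intro integral_le int) auto
      then show ?thesis by simp
    qed
    have lower: "2 * pi * (ln c - N * ln t - N * ln (1 - R\<^sup>2)) \<le> integral {0..2*pi} (?f R)"
    proof -
      \<comment> \<open>The logarithm of the lower kernel bound with Re (cayley \<zeta>) = (1 - R^2)
        / |1 + \<zeta>|^2 inserted; the last term has circle mean 0.\<close>
      let ?l = "\<lambda>\<theta>. (ln c - N * ln t - N * ln (1 - R\<^sup>2)) + 2 * N * ln (cmod (1 + of_real R * cis \<theta>))"
      have Rp: "0 < R" "R < \<rho>" "R\<^sup>2 < 1" using R s \<rho> by (auto simp: abs_square_less_1)
      have le: "?l \<theta> \<le> ?f R \<theta>" for \<theta>
      proof -
        let ?\<zeta> = "of_real R * cis \<theta>" and ?z = "p + g (of_real R * cis \<theta>) *s \<nu>"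
        have n: "cmod ?\<zeta> = R" using Rp by (simp add: norm_mult)
        have zO: "?z \<in> \<Omega>" using n Rp by (intro inO) simp
        have k: "Re (K ?z ?z) > 0" by (rule kernel_pos[OF zO])
        have p1: "cmod (1 + ?\<zeta>) > 0" using nz[of ?\<zeta>] n R by simp
        have w: "Re (cayley ?\<zeta>) = (1 - R\<^sup>2) / (cmod (1 + ?\<zeta>))\<^sup>2" using Re_cayley[of ?\<zeta>] n R by simp
        then have w0: "Re (cayley ?\<zeta>) > 0" using p1 Rp by simp
        have pz: "(p - ?z) \<bullet> \<nu> = t * Re (cayley ?\<zeta>)"
          unfolding F Re_cinner[symmetric] by (simp add: cinner_simps cinner_self \<nu>)
        have "c \<le> Re (K ?z ?z) * (t * Re (cayley ?\<zeta>)) ^ (CARD('n) + 1)"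
          using low[THEN bspec, OF zO] w0 t unfolding pz by simp
        then have "ln c \<le> ln (Re (K ?z ?z) * (t * Re (cayley ?\<zeta>)) ^ (CARD('n) + 1))"
          using c k w0 t by (subst ln_le_cancel_iff) auto
        also have "\<dots> = ln (Re (K ?z ?z)) + N * (ln t + ln (Re (cayley ?\<zeta>)))"
          using k t w0 by (simp only: ln_mult_pos zero_less_power ln_realpow N_def mult_pos_pos)
        also have "ln (Re (cayley ?\<zeta>)) = ln (1 - R\<^sup>2) - 2 * ln (cmod (1 + ?\<zeta>))"
          unfolding w using p1 Rp by (simp add: ln_div ln_realpow)
        finally show ?thesis by (simp add: pot_def algebra_simps)
      qed
      have "((\<lambda>\<theta>. 2 * N * ln (cmod (1 + of_real R * cis \<theta>))) has_integral 2 * N * 0) {0..2*pi}"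
        using integral_ln_norm_one_plus[of R] R by (intro has_integral_mult_right) auto
      moreover have "((\<lambda>\<theta>. ln c - N * ln t - N * ln (1 - R\<^sup>2)) has_integral (2 * pi - 0) *\<^sub>R (ln c - N * ln t - N * ln (1 - R\<^sup>2))) {0..2*pi}"
        using has_integral_const_real[of "ln c - N * ln t - N * ln (1 - R\<^sup>2)" 0 "2*pi"] by simp
      ultimately have l: "(?l has_integral (2 * pi - 0) *\<^sub>R (ln c - N * ln t - N * ln (1 - R\<^sup>2)) + 2 * N * 0) {0..2*pi}"
        by (intro has_integral_add)
      have "(2 * pi - 0) *\<^sub>R (ln c - N * ln t - N * ln (1 - R\<^sup>2)) + 2 * N * 0 \<le> integral {0..2*pi} (?f R)"
        by (rule has_integral_le[OF l integrable_integral[OF int[OF Rp(1,2)]] le])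
      then show ?thesis by simp
    qed
    have ll1: "ln (ln (s / ?r)) \<le> 0"
    proof -
      have "ln (s / ?r) \<le> ln 2" using s by (subst ln_le_cancel_iff) auto
      also have "\<dots> \<le> 1" using ln_2_less_1 by simp
      finally have "ln (s / ?r) \<le> 1" .
      moreover have "0 < ln (s / ?r)" using s R by simp
      ultimately show ?thesis by simp
    qed
    have ll2: "- ln (ln (s / R)) \<le> ln (2 / (1 - R))"
    proof -
      have "ln (s / R) = - ln R / 2" using R s by (simp add: s_def ln_div ln_sqrt)
      moreover have "ln R \<le> R - 1" using R by (intro ln_le_minus_one) auto
      ultimately have "(1 - R) / 2 \<le> ln (s / R)" by simp
      then have "ln ((1 - R) / 2) \<le> ln (ln (s / R))" using R by (subst ln_le_cancel_iff) auto
      moreover have "ln (2 / (1 - R)) = - ln ((1 - R) / 2)" using R by (simp add: ln_div)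
      ultimately show ?thesis by simp
    qed
    have "4 * pi * C\<^sup>2 * (ln (ln (s / ?r)) - ln (ln (s / R))) \<le> 4 * pi * C\<^sup>2 * ln (2 / (1 - R))"
      using ll1 ll2 by (intro mult_left_mono) auto
    with ineq upper lower have "2 * pi * (ln c - N * ln t - N * ln (1 - R\<^sup>2)) - 2 * pi * (ln Cu - N * ln t) \<le> 4 * pi * C\<^sup>2 * ln (2 / (1 - R))"
      by linarith
    then have "(2 * pi) * (- N * ln (1 - R\<^sup>2) - (ln Cu - ln c)) \<le> (2 * pi) * ((2 * C\<^sup>2) * ln (2 / (1 - R)))"
      by (simp add: algebra_simps)
    then show ?thesis by (simp only: mult_le_cancel_left_pos[OF pi_gt_zero[THEN mult_pos_pos[OF zero_less_numeral]]])
  qed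
  have "N \<le> 2 * C\<^sup>2" by (rule le_of_log_growth[OF main N0])
  then show ?thesis by (simp add: N_def)
qed

text \<open>For a direction of positive length the dual norm is tested on the normalised vector. As
  \<open>dens_nonneg\<close> is not strict, length 0 is a separate case: all multiples then belong
  to the unit ball, so a finite dual norm forces \<eta> to vanish there.\<close>

lemma form_length_bound:
  assumes z: "z \<in> \<Omega>" and lin: "linear (\<eta> z)" and le: "form_length (bergman_form \<Omega>) \<eta> z \<le> ennreal C" and C: "C \<ge> 0"
  shows "\<bar>\<eta> z (c *s v)\<bar> \<le> C * cmod c * sqrt (dens v z)"
proof -
  let ?u = "c *s v"
  have m: "assoc_metric (bergman_form \<Omega>) z (r *\<^sub>R ?u) (r *\<^sub>R ?u) = r\<^sup>2 * (cmod c)\<^sup>2 * dens v z" for r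
  proof -
    have "r *\<^sub>R ?u = (of_real r * c) *s v" by (simp add: scaleR_smult_complex vector_smult_assoc)
    then show ?thesis unfolding assoc_metric_def
      by (simp only: bergman_form_line[OF z] norm_mult norm_of_real power_mult_distrib power2_abs)
  qed
  have b: "r * \<bar>\<eta> z ?u\<bar> \<le> C" if "r \<ge> 0" "r\<^sup>2 * (cmod c)\<^sup>2 * dens v z \<le> 1" for r
  proof -
    have "ennreal \<bar>\<eta> z (r *\<^sub>R ?u)\<bar> \<le> form_length (bergman_form \<Omega>) \<eta> z"
      unfolding form_length_def using that(2) m[of r] by (intro SUP_upper) simp
    also note le
    finally have "\<bar>\<eta> z (r *\<^sub>R ?u)\<bar> \<le> C" using C by simp
    then show ?thesis using that(1) by (simp add: linear_cmul[OF lin] abs_mult)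
  qed
  define q where "q = (cmod c)\<^sup>2 * dens v z"
  have q: "q \<ge> 0" using dens_nonneg[OF z] by (simp add: q_def)
  have sq: "sqrt q = cmod c * sqrt (dens v z)" by (simp add: q_def real_sqrt_mult)
  show ?thesis
  proof (cases "q = 0")
    case True
    have "\<bar>\<eta> z ?u\<bar> \<le> 0"
    proof (rule ccontr)
      assume "\<not> \<bar>\<eta> z ?u\<bar> \<le> 0"
      then have p: "\<bar>\<eta> z ?u\<bar> > 0" by simp
      have "(C + 1) / \<bar>\<eta> z ?u\<bar> * \<bar>\<eta> z ?u\<bar> \<le> C"
      proof (rule b)
        show "((C + 1) / \<bar>\<eta> z ?u\<bar>)\<^sup>2 * (cmod c)\<^sup>2 * dens v z \<le> 1"
          unfolding mult.assoc q_def[symmetric] True by simp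
      qed (use C in simp)
      then show False using p by simp
    qed
    then show ?thesis using C dens_nonneg[OF z] by (simp add: mult_nonneg_nonneg)
  next
    case False
    then have q0: "q > 0" using q by simp
    have "1 / sqrt q * \<bar>\<eta> z ?u\<bar> \<le> C"
    proof (rule b)
      show "(1 / sqrt q)\<^sup>2 * (cmod c)\<^sup>2 * dens v z \<le> 1"
        unfolding mult.assoc q_def[symmetric] using q0 by (simp add: power_divide)
    qed (use q in simp)
    then show ?thesis using q0 by (simp add: sq[symmetric] mult.assoc field_simps)
  qed
qed

lemma form_sup_norm_lower:
  fixes \<eta> :: "complex^'n \<Rightarrow> complex^'n \<Rightarrow> real"
  assumes prim: "is_primitive_on \<Omega> \<eta> (bergman_form \<Omega>)" and ne: "\<Omega> \<noteq> {}" and sp: "strongly_pseudoconvex_smooth \<Omega>"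
  shows "ennreal ((real CARD('n) + 1) / 2) \<le> (form_sup_norm \<Omega> (bergman_form \<Omega>) \<eta>)\<^sup>2"
proof (cases "form_sup_norm \<Omega> (bergman_form \<Omega>) \<eta> = \<infinity>")
  case True
  then show ?thesis by (simp add: power2_eq_square)
next
  case False
  define C0 where "C0 = enn2real (form_sup_norm \<Omega> (bergman_form \<Omega>) \<eta>)"
  have C0: "ennreal C0 = form_sup_norm \<Omega> (bergman_form \<Omega>) \<eta>" "C0 \<ge> 0"
    using False by (auto simp: C0_def less_top)
  have lin: "linear (\<eta> z)" if "z \<in> \<Omega>" for z using prim that by (simp add: is_primitive_on_def one_form_on_def)
  \<comment> \<open>Working with every C > C0 guarantees C > 0 even if C0 = 0; the limit C
    \<rightarrow> C0 restores the norm itself.\<close>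
  have *: "(real CARD('n) + 1) / 2 \<le> C\<^sup>2" if C: "C > C0" for C
  proof (rule primitive_bound_lower[OF prim _ _ ne sp])
    show "C > 0" using C C0 by simp
    fix z v :: "complex^'n" and c assume z: "z \<in> \<Omega>"
    have "form_length (bergman_form \<Omega>) \<eta> z \<le> ennreal C0"
      unfolding C0(1) form_sup_norm_def by (rule SUP_upper[OF z])
    also have "\<dots> \<le> ennreal C" using C by (intro ennreal_leI) simp
    finally show "\<bar>\<eta> z (c *s v)\<bar> \<le> C * cmod c * sqrt (dens v z)"
      using z lin C C0 by (intro form_length_bound) auto
  qed
  have lim: "((\<lambda>C. C\<^sup>2) \<longlongrightarrow> C0\<^sup>2) (at_right C0)" by (intro tendsto_intros)
  have ev: "\<forall>\<^sub>F C in at_right C0. (real CARD('n) + 1) / 2 \<le> C\<^sup>2"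
    by (rule eventually_mono[OF eventually_at_right_less[of C0]]) (rule *)
  have "(real CARD('n) + 1) / 2 \<le> C0\<^sup>2"
    by (rule tendsto_lowerbound[OF lim ev]) simp
  then have "ennreal ((real CARD('n) + 1) / 2) \<le> ennreal (C0\<^sup>2)" by (rule ennreal_leI)
  then show ?thesis using C0 by (simp add: ennreal_power flip: C0(1))
qed

end

theorem theorem4p4:
  fixes \<Omega> :: "(complex^'n) set" and n :: real
  assumes "n = real CARD('n)"
    and "open \<Omega>" and "connected \<Omega>" and "\<Omega> \<noteq> {}"
    and "simply_connected \<Omega>"
    and "bounded \<Omega>"
    and "strongly_pseudoconvex_smooth \<Omega>"
  shows "(\<forall>\<eta>. is_primitive_on \<Omega> \<eta> (bergman_form \<Omega>) \<longrightarrow>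
            (form_sup_norm \<Omega> (bergman_form \<Omega>) \<eta>)\<^sup>2 \<ge> ennreal ((n + 1) / 2))
       \<and> kahler_hyperbolicity_modulus \<Omega> (bergman_form \<Omega>) \<ge> ennreal (n\<^sup>2 / (2 * (n + 1)))"
proof -
  interpret bounded_open_set \<Omega> by unfold_locales fact+
  have 1: "ennreal ((n + 1) / 2) \<le> (form_sup_norm \<Omega> (bergman_form \<Omega>) \<eta>)\<^sup>2"
    if "is_primitive_on \<Omega> \<eta> (bergman_form \<Omega>)" for \<eta>
    using form_sup_norm_lower[OF that assms(4,7)] assms(1) by simp
  have n: "n \<ge> 0" using assms(1) by simp
  \<comment> \<open>The constant for the modulus is the weaker one: n^2 / (2 (n + 1)) \<le> (n + 1)
    / 2 amounts to this inequality.\<close>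
  have "n\<^sup>2 \<le> (n + 1)\<^sup>2" using n by (intro power_mono) auto
  then have "n\<^sup>2 / (2 * (n + 1)) \<le> (n + 1)\<^sup>2 / (2 * (n + 1))" using n by (intro divide_right_mono) auto
  also have "\<dots> = (n + 1) / 2"
    using n mult_divide_mult_cancel_right[of "n + 1" "n + 1" 2] unfolding power2_eq_square by simp
  finally have "ennreal (n\<^sup>2 / (2 * (n + 1))) \<le> ennreal ((n + 1) / 2)" by (rule ennreal_leI)
  then have "ennreal (n\<^sup>2 / (2 * (n + 1))) \<le> kahler_hyperbolicity_modulus \<Omega> (bergman_form \<Omega>)"
    unfolding kahler_hyperbolicity_modulus_def by (intro INF_greatest order_trans[OF _ 1]) auto
  with 1 show ?thesis by blast
qed

end
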